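(* Let $L>0$ and let $\gamma(s)=(x(s),y(s))$, $s\in[0,L]$, be a smooth, simple, non-closed plane curve parametrized by arc length and symmetric with respect to the $y$-axis, i.e. $x(L-s)=-x(s)$ and $y(L-s)=y(s)$ for $s\in[0,L/2]$. Let $k(s)$ be its signed curvature. Let $\delta:[0,L]\to(0,\infty)$ be smooth, even with respect to $s=L/2$, and nonconstant. Put $$D^F=\{(s,r)\in\mathbb{R}^2: 0<s<L,\ 0<r<\delta(s)\},\qquad D=\{(x(s)+ry'(s),\,y(s)-rx'(s)): (s,r)\in D^F\},$$ and assume that the map $(s,r)\mapsto (x(s)+ry'(s),\,y(s)-rx'(s))$ is one-to-one from $\overline{D^F}$ onto $\overline{D}$. Let $p>1$. Suppose that $\delta(s)$ is concave on $[0,L]$, that at least one of the functions $\delta(s)k(s)$, $\delta(s)^2k(s)$ is concave on $[0,L]$, and that $|\delta'(s)|\le 1$ in $[0,L]$. If $1+rk(s)>0$ on $\overline{D^F}$, then $$\mu_1^{odd}(D)\ge B_p\left(\frac{\pi_p}{L}\right)^p,$$ where $$B_p=\begin{cases}2^{-p/2}\min\left\{1,\ \min_{(s,r)\in\overline{D^F}}\dfrac{1}{(1+rk(s))^p}\right\} & \text{if } 1<p<2,\\[2mm] 2^{1-p}\min\left\{1,\ \min_{(s,r)\in\overline{D^F}}\dfrac{1}{(1+rk(s))^p}\right\} & \text{if } p\ge 2,\end{cases}$$ and $$\pi_p=2\int_0^{+\infty}\frac{1}{1+\frac{1}{p-1}s^p}\,ds=2\pi\frac{(p-1)^{1/p}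}{p\sin(\pi/p)}.$$
   Context: Signed curvature: $k(s)=x'(s)y''(s)-x''(s)y'(s)$, so that the Jacobian of the map $(s,r)\mapsto(x(s)+ry'(s),y(s)-rx'(s))$ has absolute value $|1+rk(s)|$. For $p>1$ the Neumann $p$-Laplace eigenvalue problem on $D$ is $-\mathrm{div}(|\nabla u|^{p-2}\nabla u)=\mu|u|^{p-2}u$ in $D$, $|\nabla u|^{p-2}\frac{\partial u}{\partial\mathbf{n}}=0$ on $\partial D$ (in the weak sense). $\mu_1^{odd}(D)$ denotes the lowest nonzero eigenvalue of this problem having a corresponding eigenfunction that is odd with respect to the $y$-axis ($u(-x,y)=-u(x,y)$); equivalently, it is the minimum of $\int_D|\nabla v|^p\,dxdy\big/\int_D|v|^p\,dxdy$ over nonzero $v\in W^{1,p}(D)$ odd with respect to the $y$-axis. *)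

theory Defs
  imports "HOL-Analysis.Analysis"
begin

section \<open>Smoothness\<close>

definition deriv_within :: "real set \<Rightarrow> (real \<Rightarrow> real) \<Rightarrow> real \<Rightarrow> real" where
  "deriv_within S f s = vector_derivative f (at s within S)"

text \<open>Infinite differentiability on a nondegenerate interval, with one-sided derivatives at
  endpoints that belong to it.\<close>

definition smooth_on_interval :: "real set \<Rightarrow> (real \<Rightarrow> real) \<Rightarrow> bool" where
  "smooth_on_interval S f \<longleftrightarrow> (\<forall>n. (deriv_within S ^^ n) f differentiable_on S)"

text \<open>All iterated partial derivatives, in any order of the coordinates, exist and are
  differentiable (hence continuous).\<close>

definition smooth_fun :: "('a::euclidean_space \<Rightarrow> real) \<Rightarrow> bool" where
  "smooth_fun \<phi> \<longleftrightarrow>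
     (\<forall>bs \<in> lists Basis.
        fold (\<lambda>b f z. frechet_derivative f (at z) b) bs \<phi> differentiable_on UNIV)"

definition test_function :: "'a::euclidean_space set \<Rightarrow> ('a \<Rightarrow> real) \<Rightarrow> bool" where
  "test_function D \<phi> \<longleftrightarrow>
     smooth_fun \<phi> \<and> compact (closure {z. \<phi> z \<noteq> 0}) \<and> closure {z. \<phi> z \<noteq> 0} \<subseteq> D"

section \<open>Sobolev functions and the Neumann p-Laplacian\<close>

definition in_Lp ::
  "real \<Rightarrow> 'a::euclidean_space set \<Rightarrow> ('a \<Rightarrow> 'b::euclidean_space) \<Rightarrow> bool" where
  "in_Lp p D f \<longleftrightarrow>
     f \<in> borel_measurable (lebesgue_on D) \<and> integrable (lebesgue_on D) (\<lambda>z. norm (f z) powr p)"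

definition locally_integrable ::
  "'a::euclidean_space set \<Rightarrow> ('a \<Rightarrow> 'b::euclidean_space) \<Rightarrow> bool" where
  "locally_integrable D f \<longleftrightarrow> (\<forall>K. compact K \<and> K \<subseteq> D \<longrightarrow> integrable (lebesgue_on K) f)"

definition has_weak_gradient ::
  "'a::euclidean_space set \<Rightarrow> ('a \<Rightarrow> real) \<Rightarrow> ('a \<Rightarrow> 'a) \<Rightarrow> bool" where
  "has_weak_gradient D u U \<longleftrightarrow>
     locally_integrable D u \<and> locally_integrable D U \<and>
     (\<forall>\<phi>. test_function D \<phi> \<longrightarrow>
        (\<forall>b\<in>Basis.
           (LINT z|lebesgue_on D. u z * frechet_derivative \<phi> (at z) b) =
           - (LINT z|lebesgue_on D. (U z \<bullet> b) * \<phi> z)))"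

text \<open>\<open>u\<close> belongs to the Sobolev space \<open>W^{1,p}(D)\<close> and \<open>U\<close> is (a representative of) its weak
  gradient, which is unique almost everywhere.\<close>

definition sobolev_with_gradient ::
  "real \<Rightarrow> 'a::euclidean_space set \<Rightarrow> ('a \<Rightarrow> real) \<Rightarrow> ('a \<Rightarrow> 'a) \<Rightarrow> bool" where
  "sobolev_with_gradient p D u U \<longleftrightarrow> in_Lp p D u \<and> in_Lp p D U \<and> has_weak_gradient D u U"

text \<open>Weak form of
  \<open>-div(|\<nabla>u|^{p-2} \<nabla>u) = \<mu> |u|^{p-2} u\<close> in \<open>D\<close>, \<open>|\<nabla>u|^{p-2} \<partial>u/\<partial>n = 0\<close> on the boundary:
  the Neumann condition is encoded by testing against all of \<open>W^{1,p}(D)\<close>.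
  Since \<open>0 powr a = 0\<close>, the coefficients \<open>|\<nabla>u|^{p-2} \<nabla>u\<close> and \<open>|u|^{p-2} u\<close> vanish where
  \<open>\<nabla>u\<close>, respectively \<open>u\<close>, does, also when \<open>p < 2\<close>.\<close>

definition neumann_eigenfunction ::
  "real \<Rightarrow> 'a::euclidean_space set \<Rightarrow> real \<Rightarrow> ('a \<Rightarrow> real) \<Rightarrow> bool" where
  "neumann_eigenfunction p D \<mu> u \<longleftrightarrow>
     \<not> (AE z in lebesgue_on D. u z = 0) \<and>
     (\<exists>U. sobolev_with_gradient p D u U \<and>
       (\<forall>v V. sobolev_with_gradient p D v V \<longrightarrow>
          (LINT z|lebesgue_on D. norm (U z) powr (p - 2) * (U z \<bullet> V z)) =
          \<mu> * (LINT z|lebesgue_on D. \<bar>u z\<bar> powr (p - 2) * u z * v z)))"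

definition odd_in_x :: "(real \<times> real) set \<Rightarrow> (real \<times> real \<Rightarrow> real) \<Rightarrow> bool" where
  "odd_in_x D u \<longleftrightarrow> (AE z in lebesgue_on D. u (- fst z, snd z) = - u z)"

text \<open>Lowest nonzero eigenvalue with an odd eigenfunction, as an infimum in the extended reals.\<close>

definition mu1_odd :: "real \<Rightarrow> (real \<times> real) set \<Rightarrow> ereal" where
  "mu1_odd p D =
     (INF \<mu> \<in> {\<mu>. \<mu> \<noteq> 0 \<and> (\<exists>u. neumann_eigenfunction p D \<mu> u \<and> odd_in_x D u)}. ereal \<mu>)"

section \<open>The strip along a curve\<close>

definition signed_curvature :: "real \<Rightarrow> (real \<Rightarrow> real) \<Rightarrow> (real \<Rightarrow> real) \<Rightarrow> real \<Rightarrow> real" where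
  "signed_curvature L x y s =
     (let d = deriv_within {0..L} in d x s * d (d y) s - d (d x) s * d y s)"

definition flat_domain :: "real \<Rightarrow> (real \<Rightarrow> real) \<Rightarrow> (real \<times> real) set" where
  "flat_domain L \<delta> = {(s, r). 0 < s \<and> s < L \<and> 0 < r \<and> r < \<delta> s}"

definition strip_map ::
  "real \<Rightarrow> (real \<Rightarrow> real) \<Rightarrow> (real \<Rightarrow> real) \<Rightarrow> real \<times> real \<Rightarrow> real \<times> real" where
  "strip_map L x y =
     (\<lambda>(s, r). (x s + r * deriv_within {0..L} y s, y s - r * deriv_within {0..L} x s))"

definition strip ::
  "real \<Rightarrow> (real \<Rightarrow> real) \<Rightarrow> (real \<Rightarrow> real) \<Rightarrow> (real \<Rightarrow> real) \<Rightarrow> (real \<times> real) set" where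
  "strip L x y \<delta> = strip_map L x y ` flat_domain L \<delta>"

section \<open>The constants\<close>

definition pi_p :: "real \<Rightarrow> real" where
  "pi_p p = 2 * (LINT s:{0..}|lborel. 1 / (1 + 1 / (p - 1) * s powr p))"

text \<open>The infimum is a minimum when \<open>1 + r k(s) > 0\<close> on the compact set \<open>closure F\<close>
  and \<open>k\<close> is continuous.\<close>

definition B_p :: "real \<Rightarrow> (real \<times> real) set \<Rightarrow> (real \<Rightarrow> real) \<Rightarrow> real" where
  "B_p p F k =
     (if p < 2 then 2 powr (- p / 2) else 2 powr (1 - p)) *
     min 1 (INF (s, r) \<in> closure F. 1 / (1 + r * k s) powr p)"

end

theory Submission
  imports Defs "HOL-Computational_Algebra.Polynomial"
begin

text \<open>
  Testing the equation with \<open>v = u\<close> gives \<open>\<mu> = \<integral>|\<nabla>u|\<^sup>p / \<integral>|u|\<^sup>p\<close>, so the claim is a Poincare-type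
  inequality for odd \<open>u\<close>. In the coordinates \<open>(s, t)\<close> with \<open>r = t \<delta>(s)\<close> the area element is
  \<open>w\<^sub>t(s) ds dt\<close> with \<open>w\<^sub>t = \<delta> (1 + t \<delta> k)\<close>, and \<open>|\<delta>'| \<le> 1\<close> bounds the speed of \<open>s \<mapsto> (s, t)\<close> by
  \<open>\<surd>2 max 1 (1 + r k)\<close>; this is where \<open>B_p\<close> comes from. Each concavity hypothesis together with the
  symmetry makes \<open>w\<^sub>t\<close> nondecreasing on the left half of the interval, and for such weights a
  function that vanishes at the midpoint satisfies the one-dimensional inequality with the constant
  \<open>(\<pi>\<^sub>p / L)\<^sup>p\<close> of the unweighted problem: Young's inequality (Picone's argument) reduces this to a
  solution of \<open>G' = \<lambda> + (p - 1) G\<^sup>p\<^sup>/\<^sup>(\<^sup>p\<^sup>-\<^sup>1\<^sup>)\<close>, and the monotonicity of the weight gives the remaining term its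
  sign. Mollification transfers the inequality to Sobolev functions: on compact coordinate boxes
  Jensen's inequality bounds the mollified gradient by \<open>\<integral>|\<nabla>u|\<^sup>p\<close>, so almost everywhere convergence of
  the mollified functions along a subsequence and Fatou's lemma suffice.
\<close>

section \<open>The constant \<open>\<pi>\<^sub>p\<close>\<close>

text \<open>Lines of constant \<open>r\<close> leave the strip where \<open>\<delta>\<close> falls
  below \<open>r\<close>, so they would give intervals of varying length. Lines of constant
  \<open>t\<close> all run over the whole parameter interval and all cross the axis at
  \<open>s = L / 2\<close>; the price is a normal component \<open>t \<delta>'\<close> of their
  velocity, which the slope bound controls. The weak gradient and the gradient of a mollification
  are tied together only at a positive distance from the boundary of \<open>D\<close>. Cutting off a
  box costs nothing, however: on a symmetric subinterval \<open>{a..L - a}\<close> the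
  one-dimensional inequality keeps the constant of the full interval and imposes no condition at the
  ends. A Sobolev function has no values on the axis, which is a null set, whereas the slices need a
  zero at their midpoint. A kernel that is invariant under the reflection yields functions that
  vanish at every point of the axis. The constant \<open>\<pi>\<^sub>p\<close> enters as a blow-up
  time: the Riccati solution started at 0 becomes infinite exactly after time
  \<open>L / 2\<close>.\<close>

lemma Gamma_reflection_real:
  fixes x :: real
  shows "Gamma x * Gamma (1 - x) = pi / sin (pi * x)"
proof -
  have "complex_of_real (Gamma x * Gamma (1 - x)) = complex_of_real (pi / sin (pi * x))"
    using Gamma_reflection_complex[of "of_real x"] Gamma_complex_of_real[of "1 - x"]
    by (simp add: Gamma_complex_of_real sin_of_real[of "pi * x", symmetric])
  then show ?thesis
    by (simp only: of_real_eq_iff)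
qed

text \<open>The substitution \<open>x = 1 / (1 + t powr q)\<close> maps the half-line onto the unit
  interval and turns \<open>q\<close> times the integral into a Beta integral with parameters
  \<open>1 - 1 / q\<close> and \<open>1 / q\<close>. These add up to 1, so the reflection formula
  evaluates it.\<close>

lemma integral_inverse_one_plus_powr:
  fixes q :: real
  assumes q: "1 < q"
  shows "(\<lambda>t. 1 / (1 + t powr q)) absolutely_integrable_on {0<..}" (is ?A)
    and "integral {0<..} (\<lambda>t. 1 / (1 + t powr q)) = pi / (q * sin (pi / q))" (is ?B)
proof -
  define a where "a = 1 - 1 / q"
  define b where "b = 1 / q"
  have ab: "0 < a" "0 < b" "a + b = 1"
    using q by (auto simp: a_def b_def)
  define g where "g t = 1 / (1 + t powr q)" for t
  define g' where "g' t = - (q * t powr (q - 1)) / (1 + t powr q)\<^sup>2" for t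
  define f where "f x = x powr (a - 1) * (1 - x) powr (b - 1)" for x :: real
  have pos: "0 < 1 + t powr q" for t :: real
    by (simp add: add_pos_nonneg)
  have der: "(g has_field_derivative g' t) (at t within {0<..})" if "t \<in> {0<..}" for t
    using that pos[of t] unfolding g_def g'_def
    by (auto intro!: derivative_eq_intros simp: power2_eq_square)
  have inj: "inj_on g {0<..}"
  proof (rule inj_onI)
    fix s t :: real assume "s \<in> {0<..}" "t \<in> {0<..}" "g s = g t"
    then have "s powr q = t powr q"
      using pos[of s] pos[of t] by (simp add: g_def)
    then have "(s powr q) powr (1/q) = (t powr q) powr (1/q)"
      by simp
    then show "s = t"
      using \<open>s \<in> _\<close> \<open>t \<in> _\<close> q by (simp add: powr_powr)
  qed
  have img: "g ` {0<..} = {0<..<1}"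
  proof
    show "g ` {0<..} \<subseteq> {0<..<1}"
      using pos by (auto simp: g_def)
    show "{0<..<1} \<subseteq> g ` {0<..}"
    proof
      fix x :: real assume x: "x \<in> {0<..<1}"
      have "x = g (((1 - x) / x) powr (1 / q))"
        using x q by (simp add: g_def powr_powr field_simps)
      moreover have "((1 - x) / x) powr (1 / q) \<in> {0<..}"
        using x by simp
      ultimately show "x \<in> g ` {0<..}" by blast
    qed
  qed
  \<comment> \<open>Since \<open>a + b = 1\<close>, the powers of \<open>1 + t powr q\<close> in
    \<open>f (g t)\<close> combine to the exponent 1, and the remaining
    \<open>t powr (1 - q)\<close> cancels the power of \<open>t\<close> in
    \<open>g'\<close>.\<close>
  have fg: "\<bar>g' t\<bar> * f (g t) = q * (1 / (1 + t powr q))" if "t \<in> {0<..}" for t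
  proof -
    let ?P = "1 + t powr q"
    have t: "0 < t" using that by simp
    have g1: "1 - g t = t powr q / ?P"
      using pos[of t] by (simp add: g_def field_simps)
    have "f (g t) = ?P powr (1 - a) * (t powr (q * (b - 1)) * ?P powr (1 - b))"
      unfolding f_def g1 using pos[of t] t
      by (simp add: g_def powr_divide powr_powr powr_minus_divide[symmetric] divide_powr_uminus algebra_simps)
    also have "\<dots> = ?P powr 1 * t powr (1 - q)"
      using ab q by (simp add: b_def a_def algebra_simps flip: powr_add)
    finally have "f (g t) = ?P * t powr (1 - q)"
      using pos[of t] by simp
    moreover have "t powr (q - 1) * t powr (1 - q) = 1"
      using t by (simp flip: powr_add)
    moreover have "\<bar>g' t\<bar> = q * t powr (q - 1) / (?P * ?P)"
      using q by (simp add: g'_def power2_eq_square abs_mult abs_divide)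
    ultimately have "\<bar>g' t\<bar> * f (g t) = q * (t powr (q - 1) * t powr (1 - q)) * ?P / (?P * ?P)"
      by simp
    then show ?thesis
      using pos[of t] \<open>t powr (q - 1) * t powr (1 - q) = 1\<close> by simp
  qed
  have "(f has_integral Beta a b) {0<..<1}"
    using has_integral_Beta_real[OF ab(1,2)] by (simp add: f_def[abs_def] has_integral_Icc_iff_Ioo)
  moreover have "f absolutely_integrable_on {0<..<1}"
    using calculation by (intro nonnegative_absolutely_integrable_1) (auto simp: f_def)
  ultimately have "(\<lambda>t. \<bar>g' t\<bar> * f (g t)) absolutely_integrable_on {0<..} \<and>
      integral {0<..} (\<lambda>t. \<bar>g' t\<bar> * f (g t)) = Beta a b"
    by (subst has_absolute_integral_change_of_variables_1'[OF _ der inj])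
      (auto simp: img integral_unique)
  then have 1: "(\<lambda>t. q * (1 / (1 + t powr q))) absolutely_integrable_on {0<..}"
    and 2: "integral {0<..} (\<lambda>t. q * (1 / (1 + t powr q))) = Beta a b"
    by (simp_all only: fg cong: set_integrable_cong integral_cong)
  from 1 show A: ?A
    using q by (subst (asm) set_integrable_mult_right_iff) auto
  have "Beta a b = pi / sin (pi / q)"
    using Gamma_reflection_real[of b] by (simp add: Beta_def ab a_def b_def mult.commute)
  moreover have "q * integral {0<..} (\<lambda>t. 1 / (1 + t powr q)) = Beta a b"
    using 2 by (simp only: integral_mult_right)
  then have "integral {0<..} (\<lambda>t. 1 / (1 + t powr q)) = Beta a b / q"
    using q by (simp add: field_simps)
  ultimately show ?B
    by (simp add: mult.commute)
qed

text \<open>Rescaling by \<open>m\<close> makes both coefficients equal to 1. The lemma serves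
  twice: with exponent \<open>p\<close> for the constant \<open>pi_p\<close>, and with the conjugate
  exponent for the blow-up time of the Riccati equation.\<close>

lemma integral_inverse_plus_powr:
  fixes q a c :: real
  assumes q: "1 < q" and a: "0 < a" and c: "0 < c"
  shows "(\<lambda>t. 1 / (a + c * t powr q)) absolutely_integrable_on {0..}"
    and "integral {0..} (\<lambda>t. 1 / (a + c * t powr q)) =
      (1 / a) * (a / c) powr (1 / q) * (pi / (q * sin (pi / q)))"
proof -
  define m where "m = (c / a) powr (1 / q)"
  have m: "0 < m" using a c by (simp add: m_def)
  have mq: "m powr q = c / a" using a c q by (simp add: m_def powr_powr)
  have img: "(\<lambda>t. m * t) ` {0<..} = {0<..}"
  proof
    show "{0<..} \<subseteq> (\<lambda>t. m * t) ` {0<..}"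
    proof
      fix x :: real assume "x \<in> {0<..}"
      then show "x \<in> (\<lambda>t. m * t) ` {0<..}"
        using m by (intro image_eqI[of _ _ "x / m"]) auto
    qed
  qed (use m in auto)
  have "(\<lambda>t. \<bar>m\<bar> * (1 / (1 + (m * t) powr q))) absolutely_integrable_on {0<..} \<and>
      integral {0<..} (\<lambda>t. \<bar>m\<bar> * (1 / (1 + (m * t) powr q))) = pi / (q * sin (pi / q))"
    using integral_inverse_one_plus_powr[OF q] m
    by (subst has_absolute_integral_change_of_variables_1')
      (auto simp: img inj_on_def intro!: derivative_eq_intros)
  moreover have "\<bar>m\<bar> * (1 / (1 + (m * t) powr q)) = (m * a) * (1 / (a + c * t powr q))"
    if "t \<in> {0<..}" for t
  proof -
    have "0 < a + c * t powr q" using a c by (simp add: add_pos_nonneg)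
    then show ?thesis
      using that m a by (simp add: powr_mult mq field_simps)
  qed
  ultimately have 1: "(\<lambda>t. (m * a) * (1 / (a + c * t powr q))) absolutely_integrable_on {0<..}"
    and 2: "integral {0<..} (\<lambda>t. (m * a) * (1 / (a + c * t powr q))) = pi / (q * sin (pi / q))"
    by (simp_all only: cong: set_integrable_cong integral_cong)
  from 1 have ai: "(\<lambda>t. 1 / (a + c * t powr q)) absolutely_integrable_on {0<..}"
    using m a by (subst (asm) set_integrable_mult_right_iff) auto
  have "1 / m = (a / c) powr (1 / q)"
    using a c by (simp add: m_def powr_divide)
  moreover have eq: "I = (1 / b) * X" if "b * I = X" "0 < b" for b I X :: real
    using that by (simp add: field_simps)
  have "(m * a) * integral {0<..} (\<lambda>t. 1 / (a + c * t powr q)) = pi / (q * sin (pi / q))"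
    using 2 by (simp only: integral_mult_right)
  from eq[OF this] have "integral {0<..} (\<lambda>t. 1 / (a + c * t powr q)) =
      (1 / a) * (1 / m) * (pi / (q * sin (pi / q)))"
    using m a by (simp add: mult_ac)
  ultimately have val: "integral {0<..} (\<lambda>t. 1 / (a + c * t powr q)) =
      (1 / a) * (a / c) powr (1 / q) * (pi / (q * sin (pi / q)))"
    by (simp only:)
  have "((\<lambda>t. 1 / (a + c * t powr q)) has_integral
      (1 / a) * (a / c) powr (1 / q) * (pi / (q * sin (pi / q)))) {0<..}"
    unfolding val[symmetric] using ai
    by (intro integrable_integral set_lebesgue_integral_eq_integral(1))
  then have hi: "((\<lambda>t. 1 / (a + c * t powr q)) has_integral
      (1 / a) * (a / c) powr (1 / q) * (pi / (q * sin (pi / q)))) {0..}"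
    by (rule has_integral_spike_set_eq[THEN iffD1, rotated 2])
      (auto intro: negligible_subset[OF negligible_sing[of 0]])
  then show "integral {0..} (\<lambda>t. 1 / (a + c * t powr q)) =
      (1 / a) * (a / c) powr (1 / q) * (pi / (q * sin (pi / q)))"
    by (rule integral_unique)
  show "(\<lambda>t. 1 / (a + c * t powr q)) absolutely_integrable_on {0..}"
    by (rule nonnegative_absolutely_integrable_1) (use a c hi in auto)
qed

lemma pi_p_eq:
  assumes p: "1 < p"
  shows "pi_p p = 2 * pi * ((p - 1) powr (1 / p) / (p * sin (pi / p)))"
proof -
  let ?f = "\<lambda>s. 1 / (1 + 1 / (p - 1) * s powr p)"
  have ai: "?f absolutely_integrable_on {0..}"
    and val: "integral {0..} ?f = (p - 1) powr (1 / p) * (pi / (p * sin (pi / p)))"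
    using integral_inverse_plus_powr[of p 1 "1 / (p - 1)"] p by auto
  have "(LINT s:{0..}|lebesgue. ?f s) = integral {0..} ?f"
    using ai by (rule set_lebesgue_integral_eq_integral(2))
  moreover have "(LINT s:{0..}|lebesgue. ?f s) = (LINT s:{0..}|lborel. ?f s)"
    unfolding set_lebesgue_integral_def by (rule integral_completion) measurable
  ultimately have "(LINT s:{0..}|lborel. ?f s) = (p - 1) powr (1 / p) * (pi / (p * sin (pi / p)))"
    using val by (simp only:)
  then show ?thesis
    unfolding pi_p_def by simp
qed

lemma pi_p_pos:
  assumes "1 < p" shows "0 < pi_p p"
proof -
  have "pi / p < pi" using assms by (simp add: divide_less_eq)
  then have "0 < sin (pi / p)" using assms by (intro sin_gt_zero) auto
  then show ?thesis using assms by (simp add: pi_p_eq)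
qed

text \<open>Separation of variables: this integral is the time in which a solution of
  \<open>G' = lam + (p - 1) * G powr (p / (p - 1))\<close> rises from 0 to infinity. The conjugate
  exponent \<open>q\<close> satisfies \<open>pi / q = pi - pi / p\<close>, so both exponents have
  the same sine; this is why \<open>pi_p p\<close> appears although the integrand involves
  \<open>q\<close>.\<close>

lemma integral_riccati:
  fixes p L :: real
  assumes p: "1 < p" and L: "0 < L"
  defines "lam \<equiv> (pi_p p / L) powr p"
  shows "integral {0..} (\<lambda>t. 1 / (lam + (p - 1) * t powr (p / (p - 1)))) = L / 2"
proof -
  define q where "q = p / (p - 1)"
  have q: "1 < q" using p by (simp add: q_def)
  have iq: "1 / q = 1 - 1 / p" using p by (simp add: q_def field_simps)
  have piq: "pi / q = pi - pi / p" using iq by (metis mult.right_neutral right_diff_distrib times_divide_eq_right)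
  have sinq: "sin (pi / q) = sin (pi / p)" by (simp add: piq)
  have lp: "0 < lam" using pi_p_pos[OF p] L by (simp add: lam_def)
  have lam1: "lam powr (1 / p) = pi_p p / L"
    using p pi_p_pos[OF p] L by (simp add: lam_def powr_powr)
  have "(1 / lam) * (lam / (p - 1)) powr (1 / q) =
      lam powr (1 / q - 1) * (p - 1) powr (- (1 / q))"
    using lp p by (simp add: powr_divide powr_diff powr_minus_divide)
  also have "\<dots> = lam powr (- (1 / p)) * (p - 1) powr (1 / p - 1)"
    by (simp add: iq)
  also have "\<dots> = (L / pi_p p) * ((p - 1) powr (1 / p) / (p - 1))"
    using lam1 p by (simp add: powr_minus_divide powr_diff)
  finally have *: "(1 / lam) * (lam / (p - 1)) powr (1 / q) =
     (L / pi_p p) * ((p - 1) powr (1 / p) / (p - 1))" .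
  have "pi / (q * sin (pi / q)) = (p - 1) * (pi / (p * sin (pi / p)))"
    using p by (simp add: sinq) (simp add: q_def field_simps)
  then have "(1 / lam) * (lam / (p - 1)) powr (1 / q) * (pi / (q * sin (pi / q))) =
     (L / pi_p p) * ((p - 1) powr (1 / p) * (pi / (p * sin (pi / p))))"
    unfolding * using p by simp
  also have "(p - 1) powr (1 / p) * (pi / (p * sin (pi / p))) = pi_p p / 2"
    using p by (simp add: pi_p_eq)
  also have "L / pi_p p * (pi_p p / 2) = L / 2"
    using pi_p_pos[OF p] by simp
  finally show ?thesis
    using integral_inverse_plus_powr(2)[OF q lp, of "p - 1"] p by (simp add: q_def)
qed

section \<open>The weighted one-dimensional inequality\<close>

text \<open>\<open>G = (-\<phi>'/\<phi>)\<^sup>p\<^sup>-\<^sup>1\<close> for the first eigenfunction \<open>\<phi>\<close> of the one-dimensional problem on the half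
  interval; it is obtained by inverting the time that the Riccati flow needs to reach a height.\<close>

lemma riccati_solution:
  fixes p L :: real
  assumes p: "1 < p" and L: "0 < L"
  defines "lam \<equiv> (pi_p p / L) powr p"
  obtains G where "\<And>s. s \<in> {0<..<L/2} \<Longrightarrow> 0 < G s"
    and "\<And>s. s \<in> {0<..<L/2} \<Longrightarrow>
      (G has_field_derivative lam + (p - 1) * G s powr (p / (p - 1))) (at s)"
proof -
  define q where "q = p / (p - 1)"
  have q: "1 < q" using p by (simp add: q_def)
  have lp: "0 < lam" using pi_p_pos[OF p] L by (simp add: lam_def)
  define f where "f t = 1 / (lam + (p - 1) * t powr q)" for t
  have den: "0 < lam + (p - 1) * t powr q" for t
    using lp p by (simp add: add_pos_nonneg)
  have fpos: "0 < f t" for t using den by (simp add: f_def)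
  have contf: "continuous_on {0..b} f" for b
  proof -
    have "lam + (p - 1) * t powr q \<noteq> 0" for t
      using den[of t] by simp
    then show ?thesis
      unfolding f_def using q by (intro continuous_intros continuous_on_powr') auto
  qed
  define F where "F t = integral {0..t} f" for t
  have derF: "(F has_field_derivative f t) (at t)" if "0 < t" for t
  proof -
    have "(F has_real_derivative f t) (at t within {0..t + 1})"
      unfolding F_def using that by (intro integral_has_real_derivative contf) auto
    then show ?thesis
      using that at_within_interior[of t "{0..t + 1}"] by (simp add: interior_atLeastAtMost_real)
  qed
  have contF: "continuous_on {0..b} F" for b
    unfolding F_def using contf[of b]
    by (intro indefinite_integral_continuous_1 integrable_continuous_real)
  have mono: "F s < F t" if "0 \<le> s" "s < t" for s t
  proof (rule DERIV_pos_imp_increasing_open[OF that(2)])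
    fix x assume "s < x" "x < t"
    then show "\<exists>y. (F has_real_derivative y) (at x) \<and> 0 < y"
      using derF[of x] fpos[of x] that by auto
  qed (use that contF[of t] in \<open>auto intro: continuous_on_subset\<close>)
  have fai: "f absolutely_integrable_on {0..}" and fval: "integral {0..} f = L / 2"
    using integral_inverse_plus_powr(1)[OF q lp, of "p - 1"] integral_riccati[OF p L] p
    by (simp_all add: f_def[abs_def] q_def lam_def)
  \<comment> \<open>\<open>F\<close> increases to the full blow-up time \<open>L / 2\<close>, so it
    takes every value of \<open>{0<..<L/2}\<close> and its inverse lives on that whole
    interval.\<close>
  have "((\<lambda>b. LINT t:{0..b}|lebesgue. f t) \<longlongrightarrow> (LINT t:{0..}|lebesgue. f t)) at_top"
    using fai by (intro tendsto_set_lebesgue_integral_at_top) auto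
  moreover have "(LINT t:{0..}|lebesgue. f t) = L / 2"
    using set_lebesgue_integral_eq_integral(2)[OF fai] fval by simp
  moreover have "(LINT t:{0..b}|lebesgue. f t) = F b" for b
    unfolding F_def
    by (rule set_lebesgue_integral_eq_integral(2)) (rule set_integrable_subset[OF fai], auto)
  ultimately have lim: "(F \<longlongrightarrow> L / 2) at_top" by simp
  have surj: "\<exists>t>0. F t = s" if s: "s \<in> {0<..<L/2}" for s
  proof -
    have "\<forall>\<^sub>F b in at_top. s < F b"
      using s by (intro order_tendstoD(1)[OF lim]) simp
    then have "\<forall>\<^sub>F b in at_top. s < F b \<and> 0 < b"
      by (intro eventually_conj eventually_gt_at_top)
    then obtain b where b: "0 < b" "s < F b"
      by (auto simp: eventually_at_top_linorder)
    have "\<exists>t\<ge>0. t \<le> b \<and> F t = s"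
      by (rule IVT') (use b s contF in \<open>auto simp: F_def\<close>)
    then obtain t where "0 \<le> t" "F t = s" by blast
    moreover have "t \<noteq> 0" using \<open>F t = s\<close> s by (auto simp: F_def)
    ultimately show ?thesis by (intro exI[of _ t]) auto
  qed
  define G where "G s = inv_into {0<..} F s" for s
  have inj: "inj_on F {0<..}"
  proof (rule inj_onI)
    fix s t :: real assume "s \<in> {0<..}" "t \<in> {0<..}" "F s = F t"
    then show "s = t"
      using mono[of s t] mono[of t s] by (cases s t rule: linorder_cases) auto
  qed
  have G: "0 < G s" "F (G s) = s" if "s \<in> {0<..<L/2}" for s
    using surj[OF that] inv_into_into[of s F "{0<..}"] f_inv_into_f[of s F "{0<..}"]
    by (auto simp: G_def)
  have GF: "G (F t) = t" if "0 < t" for t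
    using that inj by (simp add: G_def)
  have "(G has_field_derivative lam + (p - 1) * G s powr q) (at s)" if s: "s \<in> {0<..<L/2}" for s
  proof -
    have "isCont G (F (G s))"
    proof (rule isCont_inverse_function[where f = F and x = "G s" and d = "G s / 2"])
      show "0 < G s / 2" using G[OF s] by simp
    next
      fix z assume "\<bar>z - G s\<bar> \<le> G s / 2"
      then have "0 < z" using G(1)[OF s] by linarith
      then show "G (F z) = z" using GF by simp
    next
      fix z assume "\<bar>z - G s\<bar> \<le> G s / 2"
      then have "0 < z" using G(1)[OF s] by linarith
      then show "isCont F z"
        using DERIV_isCont[OF derF[of z]] by simp
    qed
    then have "(G has_field_derivative inverse (f (G s))) (at s)"
      using G[OF s] s derF[of "G s"] fpos[of "G s"] G(2)
      by (intro DERIV_inverse_function[where f = F and a = 0 and b = "L / 2"]) auto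
    then show ?thesis by (simp add: f_def)
  qed
  with G show ?thesis
    by (intro that[of G]) (auto simp: q_def)
qed

text \<open>Because \<open>p > 1\<close>, the formula also holds at 0, where the difference quotient
  is \<open>sgn h * \<bar>h\<bar> powr (p - 1)\<close>. Zeros of the function inside the power
  therefore need no separate treatment later.\<close>

lemma has_field_derivative_abs_powr:
  fixes p x :: real
  assumes p: "1 < p"
  shows "((\<lambda>x. \<bar>x\<bar> powr p) has_field_derivative p * \<bar>x\<bar> powr (p - 1) * sgn x) (at x)"
proof (cases "x = 0")
  case False
  have "((\<lambda>y. (sgn x * y) powr p) has_field_derivative p * \<bar>x\<bar> powr (p - 1) * sgn x) (at x)"
    using False by (auto intro!: derivative_eq_intros simp: sgn_if)
  then show ?thesis
  proof (rule has_field_derivative_transform_within_open[where S = "{y. 0 < sgn x * y}"])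
    show "open {y. 0 < sgn x * y}"
      by (intro open_Collect_less continuous_intros)
    show "(sgn x * y) powr p = \<bar>y\<bar> powr p" if "y \<in> {y. 0 < sgn x * y}" for y
      using that by (auto simp: sgn_if split: if_splits)
  qed (use False in \<open>auto simp: sgn_if\<close>)
next
  case True
  have "((\<lambda>h. \<bar>h\<bar> powr (p - 1)) \<longlongrightarrow> \<bar>0\<bar> powr (p - 1)) (at (0::real))"
    by (intro tendsto_powr' tendsto_intros) (use p in auto)
  then have "((\<lambda>h. \<bar>h\<bar> powr (p - 1)) \<longlongrightarrow> 0) (at (0::real))"
    using p by simp
  then have "((\<lambda>h. sgn h * \<bar>h\<bar> powr (p - 1)) \<longlongrightarrow> 0) (at (0::real))"
    by (rule Lim_null_comparison[rotated]) (auto simp: abs_mult abs_sgn_eq)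
  then have "((\<lambda>h. \<bar>h\<bar> powr p / h) \<longlongrightarrow> 0) (at (0::real))"
  proof (rule Lim_transform_eventually)
    show "\<forall>\<^sub>F h in at (0::real). sgn h * \<bar>h\<bar> powr (p - 1) = \<bar>h\<bar> powr p / h"
      by (auto simp: eventually_at_filter powr_diff sgn_if)
  qed
  then show ?thesis
    using True p by (simp add: has_field_derivative_iff)
qed

text \<open>Young's inequality for \<open>a\<close> and \<open>b powr (p - 1)\<close> with exponents
  \<open>p\<close> and \<open>p / (p - 1)\<close>. It is used once as Picone's pointwise estimate
  and once as the tangent line inequality for the power function behind Jensen's inequality.\<close>

lemma young_powr:
  fixes p a b :: real
  assumes p: "1 < p" and a: "0 \<le> a" and b: "0 \<le> b"
  shows "p * a * b powr (p - 1) \<le> a powr p + (p - 1) * b powr p"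
proof (cases "a = 0 \<or> b = 0")
  case True
  then show ?thesis using p by auto
next
  case False
  then have ab: "0 < a" "0 < b" using a b by auto
  define q where "q = p / (p - 1)"
  have q: "1 < q" "1 / p + 1 / q = 1" and pq: "(p - 1) * q = p"
    using p by (auto simp: q_def field_simps)
  have "a * b powr (p - 1) \<le> a powr p / p + (b powr (p - 1)) powr q / q"
    using Youngs_inequality[of p q a "b powr (p - 1)"] p q ab by simp
  also have "(b powr (p - 1)) powr q = b powr p"
    using pq by (simp add: powr_powr)
  also have "b powr p / q = (p - 1) * b powr p / p"
    by (simp add: q_def)
  finally have "p * (a * b powr (p - 1)) \<le> p * (a powr p / p + (p - 1) * b powr p / p)"
    using p by (intro mult_left_mono) auto
  also have "\<dots> = a powr p + (p - 1) * b powr p"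
    using p by (simp add: field_simps)
  finally show ?thesis by (simp add: mult.assoc)
qed

text \<open>The difference of the two integrands is at most the derivative of
  \<open>H = g * w * \<bar>v\<bar> powr p\<close>, with \<open>g\<close> a shifted Riccati solution.
  Its integral is thus at most \<open>H c - H a\<close>, where \<open>H c = 0\<close> by the zero of
  \<open>v\<close> and \<open>H a \<ge> 0\<close> by positivity. The left end is free, as the
  Neumann condition demands.\<close>

lemma weighted_poincare_half:
  fixes p L a c :: real and v v' w w' :: "real \<Rightarrow> real"
  assumes p: "1 < p" and L: "0 < L" and ac: "a \<le> c" "c - a < L / 2"
    and v: "\<And>s. s \<in> {a..c} \<Longrightarrow> (v has_field_derivative v' s) (at s within {a..c})"
    and v': "continuous_on {a..c} v'"
    and w: "\<And>s. s \<in> {a..c} \<Longrightarrow> (w has_field_derivative w' s) (at s within {a..c})"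
    and w'_nonneg: "\<And>s. s \<in> {a..c} \<Longrightarrow> 0 \<le> w' s"
    and w_nonneg: "\<And>s. s \<in> {a..c} \<Longrightarrow> 0 \<le> w s"
    and vc: "v c = 0"
  shows "(pi_p p / L) powr p * integral {a..c} (\<lambda>s. \<bar>v s\<bar> powr p * w s)
    \<le> integral {a..c} (\<lambda>s. \<bar>v' s\<bar> powr p * w s)"
proof -
  define lam where "lam = (pi_p p / L) powr p"
  obtain G where Gpos: "\<And>s. s \<in> {0<..<L/2} \<Longrightarrow> 0 < G s"
    and G: "\<And>s. s \<in> {0<..<L/2} \<Longrightarrow>
      (G has_field_derivative lam + (p - 1) * G s powr (p / (p - 1))) (at s)"
    using riccati_solution[OF p L] unfolding lam_def by blast
  \<comment> \<open>Half of the slack \<open>L / 2 - (c - a)\<close>: the shift moves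
    \<open>{a..c}\<close> into the open interval on which \<open>G\<close> is defined, away from 0
    and from the blow-up at \<open>L / 2\<close>.\<close>
  define e where "e = (L / 2 - (c - a)) / 2"
  have e: "0 < e" "e + (c - a) < L / 2" using ac by (auto simp: e_def field_simps)
  define g where "g s = G (s - a + e)" for s
  define g' where "g' s = lam + (p - 1) * g s powr (p / (p - 1))" for s
  have gpos: "0 < g s" if "s \<in> {a..c}" for s
    using that e by (auto simp: g_def intro!: Gpos)
  have g: "(g has_field_derivative g' s) (at s within {a..c})" if "s \<in> {a..c}" for s
  proof -
    have "((\<lambda>s. G (s - a + e)) has_field_derivative g' s * 1) (at s within {a..c})"
      unfolding g'_def g_def
      by (rule DERIV_chain2[OF G]) (use that e in \<open>auto intro!: derivative_eq_intros\<close>)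
    then show ?thesis by (simp add: g_def[abs_def])
  qed
  define P' where "P' s = p * \<bar>v s\<bar> powr (p - 1) * sgn (v s) * v' s" for s
  have P: "((\<lambda>s. \<bar>v s\<bar> powr p) has_field_derivative P' s) (at s within {a..c})"
    if "s \<in> {a..c}" for s
    unfolding P'_def by (rule DERIV_chain2[OF has_field_derivative_abs_powr[OF p] v[OF that]])
  define H where "H s = g s * w s * \<bar>v s\<bar> powr p" for s
  define H' where "H' s = g' s * w s * \<bar>v s\<bar> powr p + g s * w' s * \<bar>v s\<bar> powr p + g s * w s * P' s" for s
  have H: "(H has_field_derivative H' s) (at s within {a..c})" if "s \<in> {a..c}" for s
    unfolding H_def H'_def
    by (rule derivative_eq_intros g[OF that] w[OF that] P[OF that] refl)+
      (simp add: algebra_simps)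
  have lower: "lam * (\<bar>v s\<bar> powr p * w s) - \<bar>v' s\<bar> powr p * w s \<le> H' s" if s: "s \<in> {a..c}" for s
  proof -
    \<comment> \<open>This choice makes \<open>?b powr p\<close> reproduce the nonlinear term of the
      Riccati equation, while \<open>?b powr (p - 1)\<close> reproduces the coefficient of
      \<open>v'\<close> in \<open>g * P'\<close>.\<close>
    let ?b = "g s powr (1 / (p - 1)) * \<bar>v s\<bar>"
    have b1: "?b powr (p - 1) = g s * \<bar>v s\<bar> powr (p - 1)"
      using gpos[OF s] p by (simp add: powr_mult powr_powr)
    have b2: "?b powr p = g s powr (p / (p - 1)) * \<bar>v s\<bar> powr p"
      using gpos[OF s] p by (simp add: powr_mult powr_powr)
    have "p * \<bar>v' s\<bar> * (g s * \<bar>v s\<bar> powr (p - 1)) \<le>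
        \<bar>v' s\<bar> powr p + (p - 1) * (g s powr (p / (p - 1)) * \<bar>v s\<bar> powr p)"
      using young_powr[OF p, of "\<bar>v' s\<bar>" ?b] unfolding b1 b2 by simp
    moreover have "- (p * \<bar>v' s\<bar> * (g s * \<bar>v s\<bar> powr (p - 1))) \<le> g s * P' s"
    proof -
      have "\<bar>g s * P' s\<bar> \<le> p * \<bar>v' s\<bar> * (g s * \<bar>v s\<bar> powr (p - 1))"
        using gpos[OF s] p by (auto simp: P'_def abs_mult sgn_if)
      then show ?thesis by linarith
    qed
    ultimately have "lam * \<bar>v s\<bar> powr p - \<bar>v' s\<bar> powr p \<le> g' s * \<bar>v s\<bar> powr p + g s * P' s"
      by (simp add: g'_def algebra_simps)
    from mult_left_mono[OF this w_nonneg[OF s]] have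
      "lam * (\<bar>v s\<bar> powr p * w s) - \<bar>v' s\<bar> powr p * w s \<le> g' s * w s * \<bar>v s\<bar> powr p + g s * w s * P' s"
      by (simp add: algebra_simps)
    \<comment> \<open>The one term of \<open>H'\<close> without a counterpart in the unweighted
      problem. It has the favourable sign because the weight is nondecreasing.\<close>
    moreover have "0 \<le> g s * w' s * \<bar>v s\<bar> powr p"
      using gpos[OF s] w'_nonneg[OF s] by simp
    ultimately show ?thesis by (simp add: H'_def)
  qed
  have contv: "continuous_on {a..c} v" and contw: "continuous_on {a..c} w"
    using DERIV_continuous_on[OF v] DERIV_continuous_on[OF w] by auto
  have int1: "(\<lambda>s. \<bar>v s\<bar> powr p * w s) integrable_on {a..c}"
    and int2: "(\<lambda>s. \<bar>v' s\<bar> powr p * w s) integrable_on {a..c}"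
    using p by (intro integrable_continuous_real continuous_intros continuous_on_powr' contv contw v'; simp)+
  have HH: "(H' has_integral (H c - H a)) {a..c}"
    using H ac by (intro fundamental_theorem_of_calculus)
      (auto simp: has_real_derivative_iff_has_vector_derivative)
  have "((\<lambda>s. lam * (\<bar>v s\<bar> powr p * w s) - \<bar>v' s\<bar> powr p * w s) has_integral
      lam * integral {a..c} (\<lambda>s. \<bar>v s\<bar> powr p * w s) - integral {a..c} (\<lambda>s. \<bar>v' s\<bar> powr p * w s)) {a..c}"
    using int1 int2 by (intro has_integral_diff has_integral_mult_right integrable_integral)
  then have "lam * integral {a..c} (\<lambda>s. \<bar>v s\<bar> powr p * w s)
      - integral {a..c} (\<lambda>s. \<bar>v' s\<bar> powr p * w s) \<le> H c - H a"
    using HH lower by (rule has_integral_le)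
  moreover have "H c = 0" using vc by (simp add: H_def)
  moreover have "0 \<le> H a"
    using gpos[of a] w_nonneg[of a] ac by (simp add: H_def)
  ultimately show ?thesis by (simp add: lam_def)
qed

section \<open>From the half interval to a symmetric interval\<close>

lemma integral_reflect_interval:
  fixes f :: "real \<Rightarrow> real"
  assumes f: "continuous_on {a..b} f"
  shows "integral {L - b..L - a} (\<lambda>s. f (L - s)) = integral {a..b} f"
proof -
  have "(f has_integral integral {a..b} f) (cbox a b)"
    using f by (simp add: integrable_continuous_real integrable_integral)
  from has_integral_affinity[OF this, of "-1" L]
  have "((\<lambda>s. f (L - s)) has_integral integral {a..b} f) ((\<lambda>s. L - s) ` {a..b})"
    by (simp add: algebra_simps)
  then show ?thesis
    by (simp add: integral_unique)
qed

text \<open>Concavity yields monotonicity of the weight without any formula for its derivative,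
  whereas the half-interval inequality asks for a sign of that derivative, one-sided at the
  ends.\<close>

lemma mono_on_imp_deriv_nonneg_within:
  fixes w :: "real \<Rightarrow> real"
  assumes w: "(w has_field_derivative D) (at s within {a..c})"
    and mono: "\<And>s t. a \<le> s \<Longrightarrow> s \<le> t \<Longrightarrow> t \<le> c \<Longrightarrow> w s \<le> w t"
    and s: "a < c" "s \<in> {a..c}"
  shows "0 \<le> D"
proof (rule tendsto_lowerbound)
  show "((\<lambda>t. (w t - w s) / (t - s)) \<longlongrightarrow> D) (at s within {a..c})"
    using w by (simp add: has_field_derivative_iff)
  have "0 \<le> (w t - w s) / (t - s)" if "t \<in> {a..c}" for t
    using that s mono[of s t] mono[of t s]
    by (cases s t rule: linorder_cases) (auto simp: divide_nonpos_neg)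
  then show "\<forall>\<^sub>F t in at s within {a..c}. 0 \<le> (w t - w s) / (t - s)"
    by (simp add: eventually_at_filter)
  show "at s within {a..c} \<noteq> bot"
    using s by (simp add: trivial_limit_within islimpt_Icc)
qed

text \<open>The half-interval inequality is applied to \<open>v\<close> and to its mirror image
  \<open>v (L - s)\<close>, both on the left half, where the even weight is nondecreasing. The two
  halves of \<open>v\<close> are linked only by the zero at \<open>L / 2\<close>. Since
  \<open>a > 0\<close>, each half is strictly shorter than \<open>L / 2\<close>, which leaves the
  slack that the shift of the Riccati solution needs.\<close>

lemma weighted_poincare_symmetric:
  fixes p L a :: real and v v' w w' :: "real \<Rightarrow> real"
  assumes p: "1 < p" and L: "0 < L" and a: "0 < a" "a < L / 2"
    and v: "\<And>s. s \<in> {a..L - a} \<Longrightarrow> (v has_field_derivative v' s) (at s)"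
    and v': "continuous_on {a..L - a} v'"
    and w: "\<And>s. s \<in> {a..L - a} \<Longrightarrow> (w has_field_derivative w' s) (at s)"
    and mono: "\<And>s t. a \<le> s \<Longrightarrow> s \<le> t \<Longrightarrow> t \<le> L / 2 \<Longrightarrow> w s \<le> w t"
    and w_nonneg: "\<And>s. s \<in> {a..L - a} \<Longrightarrow> 0 \<le> w s"
    and even: "\<And>s. s \<in> {a..L - a} \<Longrightarrow> w (L - s) = w s"
    and mid: "v (L / 2) = 0"
  shows "(pi_p p / L) powr p * integral {a..L - a} (\<lambda>s. \<bar>v s\<bar> powr p * w s)
    \<le> integral {a..L - a} (\<lambda>s. \<bar>v' s\<bar> powr p * w s)"
proof -
  let ?m = "L / 2"
  have sub: "{a..?m} \<subseteq> {a..L - a}" "{?m..L - a} \<subseteq> {a..L - a}" using a by auto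
  have w'_nonneg: "0 \<le> w' s" if "s \<in> {a..?m}" for s
  proof (rule mono_on_imp_deriv_nonneg_within)
    show "(w has_field_derivative w' s) (at s within {a..?m})"
      using w[of s] that sub by (auto intro: has_field_derivative_at_within)
  qed (use mono a that in auto)
  have contv: "continuous_on {a..L - a} v"
    using v by (intro DERIV_continuous_on) (auto intro: has_field_derivative_at_within)
  have contw: "continuous_on {a..L - a} w"
    using w by (intro DERIV_continuous_on) (auto intro: has_field_derivative_at_within)
  have cont: "continuous_on {a..L - a} (\<lambda>s. \<bar>v s\<bar> powr p * w s)"
      "continuous_on {a..L - a} (\<lambda>s. \<bar>v' s\<bar> powr p * w s)"
    using p by (intro continuous_intros continuous_on_powr' contv contw v'; simp)+
  have left: "(pi_p p / L) powr p * integral {a..?m} (\<lambda>s. \<bar>v s\<bar> powr p * w s)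
      \<le> integral {a..?m} (\<lambda>s. \<bar>v' s\<bar> powr p * w s)"
  proof (rule weighted_poincare_half[OF p L])
    show "(v has_field_derivative v' s) (at s within {a..?m})"
      "(w has_field_derivative w' s) (at s within {a..?m})" "0 \<le> w s" if "s \<in> {a..?m}" for s
      using that sub v w w_nonneg by (auto intro: has_field_derivative_at_within)
  qed (use a mid w'_nonneg v' sub in \<open>auto intro: continuous_on_subset\<close>)
  have "(pi_p p / L) powr p * integral {a..?m} (\<lambda>s. \<bar>v (L - s)\<bar> powr p * w s)
      \<le> integral {a..?m} (\<lambda>s. \<bar>- v' (L - s)\<bar> powr p * w s)"
  proof (rule weighted_poincare_half[OF p L])
    show "((\<lambda>s. v (L - s)) has_field_derivative - v' (L - s)) (at s within {a..?m})"
      "(w has_field_derivative w' s) (at s within {a..?m})" "0 \<le> w s" if "s \<in> {a..?m}" for s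
    proof -
      have "((\<lambda>s. v (L - s)) has_field_derivative v' (L - s) * - 1) (at s)"
        by (rule DERIV_chain2[OF v]) (use that a in \<open>auto intro!: derivative_eq_intros\<close>)
      then show "((\<lambda>s. v (L - s)) has_field_derivative - v' (L - s)) (at s within {a..?m})"
        by (auto intro: has_field_derivative_at_within)
    qed (use that sub w w_nonneg in \<open>auto intro: has_field_derivative_at_within\<close>)
    show "continuous_on {a..?m} (\<lambda>s. - v' (L - s))"
      using a by (intro continuous_intros continuous_on_compose2[OF v']) auto
  qed (use a mid w'_nonneg in auto)
  moreover have refl: "integral {a..?m} (\<lambda>s. \<bar>h (L - s)\<bar> powr p * w s) =
      integral {?m..L - a} (\<lambda>s. \<bar>h s\<bar> powr p * w s)"
    if h: "continuous_on {a..L - a} h" for h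
  proof -
    have "continuous_on {?m..L - a} (\<lambda>s. \<bar>h s\<bar> powr p * w s)"
      using p sub by (intro continuous_intros continuous_on_powr' continuous_on_subset[OF contw]
        continuous_on_subset[OF h]) auto
    then have "integral {L - (L - a)..L - ?m} (\<lambda>s. \<bar>h (L - s)\<bar> powr p * w (L - s)) =
        integral {?m..L - a} (\<lambda>s. \<bar>h s\<bar> powr p * w s)"
      by (rule integral_reflect_interval)
    moreover have "integral {a..?m} (\<lambda>s. \<bar>h (L - s)\<bar> powr p * w (L - s)) =
        integral {a..?m} (\<lambda>s. \<bar>h (L - s)\<bar> powr p * w s)"
      using even sub by (intro integral_cong) auto
    ultimately show ?thesis by simp
  qed
  ultimately have right: "(pi_p p / L) powr p * integral {?m..L - a} (\<lambda>s. \<bar>v s\<bar> powr p * w s)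
      \<le> integral {?m..L - a} (\<lambda>s. \<bar>v' s\<bar> powr p * w s)"
    using contv v' by simp
  have "integral {a..L - a} (\<lambda>s. \<bar>v s\<bar> powr p * w s) =
      integral {a..?m} (\<lambda>s. \<bar>v s\<bar> powr p * w s) + integral {?m..L - a} (\<lambda>s. \<bar>v s\<bar> powr p * w s)"
    "integral {a..L - a} (\<lambda>s. \<bar>v' s\<bar> powr p * w s) =
      integral {a..?m} (\<lambda>s. \<bar>v' s\<bar> powr p * w s) + integral {?m..L - a} (\<lambda>s. \<bar>v' s\<bar> powr p * w s)"
    using a cont by (intro Henstock_Kurzweil_Integration.integral_combine[symmetric] integrable_continuous_real; simp)+
  with left right show ?thesis by (simp add: distrib_left)
qed

section \<open>Change of variables in the plane\<close>

text \<open>Determinants and the change of variables formula are at home in \<open>real ^ 2\<close>,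
  the strip in \<open>real \<times> real\<close>. This map and its inverse carry statements from one
  to the other.\<close>

definition pair_of_vec :: "real ^ 2 \<Rightarrow> real \<times> real" where
  "pair_of_vec v = (v $ 1, v $ 2)"

definition vec_of_pair :: "real \<times> real \<Rightarrow> real ^ 2" where
  "vec_of_pair z = vector [fst z, snd z]"

lemma vec_of_pair_inverse [simp]: "pair_of_vec (vec_of_pair z) = z"
  by (simp add: pair_of_vec_def vec_of_pair_def)

lemma pair_of_vec_inverse [simp]: "vec_of_pair (pair_of_vec v) = v"
  by (simp add: pair_of_vec_def vec_of_pair_def vec_eq_iff forall_2)

lemma bounded_linear_pair_of_vec: "bounded_linear pair_of_vec"
  unfolding linear_conv_bounded_linear[symmetric]
  by (rule linearI) (auto simp: pair_of_vec_def)

lemma bounded_linear_vec_of_pair: "bounded_linear vec_of_pair"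
  unfolding linear_conv_bounded_linear[symmetric]
  by (rule linearI) (auto simp: vec_of_pair_def vec_eq_iff forall_2)

lemma continuous_on_pair_of_vec: "continuous_on S pair_of_vec"
  and continuous_on_vec_of_pair: "continuous_on T vec_of_pair"
  by (simp_all add: linear_continuous_on bounded_linear_pair_of_vec bounded_linear_vec_of_pair)

text \<open>Boxes pull back to boxes with the same side lengths, and Lebesgue measure is determined
  by its values on boxes.\<close>

lemma lborel_pair_of_vec: "distr lborel borel pair_of_vec = (lborel :: (real \<times> real) measure)"
proof (rule lborel_eqI[symmetric])
  fix l u :: "real \<times> real"
  assume *: "\<And>b. b \<in> Basis \<Longrightarrow> l \<bullet> b \<le> u \<bullet> b"
  have meas: "pair_of_vec \<in> borel_measurable lborel"
    using continuous_on_pair_of_vec[of UNIV] by (simp add: borel_measurable_continuous_onI)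
  have Basis2: "(Basis :: (real ^ 2) set) = {axis 1 1, axis 2 1}"
    by (auto simp: Basis_vec_def UNIV_2)
  have "fst l \<le> fst u" "snd l \<le> snd u"
    using *[of "(1, 0)"] *[of "(0, 1)"] by (auto simp: Basis_prod_def inner_prod_def)
  then have lu: "\<And>b. b \<in> Basis \<Longrightarrow> vec_of_pair l \<bullet> b \<le> vec_of_pair u \<bullet> b"
    by (auto simp: Basis2 inner_axis vec_of_pair_def)
  have pre: "pair_of_vec -` box l u = box (vec_of_pair l) (vec_of_pair u)"
    by (auto simp: box_def Basis_prod_def pair_of_vec_def vec_of_pair_def inner_prod_def
        Basis_vec_def inner_axis forall_2)
  have "emeasure (distr lborel borel pair_of_vec) (box l u) = emeasure lborel (pair_of_vec -` box l u)"
    using meas by (simp add: emeasure_distr)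
  also have "\<dots> = (\<Prod>b\<in>Basis. (vec_of_pair u - vec_of_pair l) \<bullet> b)"
    unfolding pre using lu by (rule emeasure_lborel_box)
  also have "(\<Prod>b\<in>Basis. (vec_of_pair u - vec_of_pair l) \<bullet> b) = (\<Prod>b\<in>Basis. (u - l) \<bullet> b)"
  proof -
    have "(axis 1 1 :: real ^ 2) \<noteq> axis 2 1"
      by (simp add: axis_eq_axis)
    moreover have "(\<Prod>b\<in>Basis. (u - l) \<bullet> b) = (\<Prod>b\<in>{(1, 0), (0, 1)}. (u - l) \<bullet> b)"
      by (rule prod.cong) (auto simp: Basis_prod_def)
    ultimately show ?thesis
      by (simp add: Basis2 inner_axis vec_of_pair_def inner_prod_def)
  qed
  finally show "emeasure (distr lborel borel pair_of_vec) (box l u) = (\<Prod>b\<in>Basis. (u - l) \<bullet> b)" .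
qed simp

lemma absolutely_integrable_continuous_compact:
  fixes f :: "'a::euclidean_space \<Rightarrow> real"
  assumes "compact S" "continuous_on S f"
  shows "f absolutely_integrable_on S"
  using borel_integrable_compact[OF assms]
  by (simp add: set_integrable_def integrable_completion borel_measurable_integrable)

lemma integral_pair_of_vec:
  fixes f :: "real \<times> real \<Rightarrow> real"
  assumes S: "compact S" and f: "continuous_on S f"
  shows "integral S f = integral (vec_of_pair ` S) (\<lambda>v. f (pair_of_vec v))"
proof -
  let ?T = "vec_of_pair ` S"
  have T: "compact ?T"
    using S by (intro compact_continuous_image continuous_on_vec_of_pair)
  have ft: "continuous_on ?T (\<lambda>v. f (pair_of_vec v))"
    by (rule continuous_on_compose2[OF f continuous_on_pair_of_vec]) auto
  have lint: "integral A g = (\<integral>x. indicator A x *\<^sub>R g x \<partial>lborel)"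
    if "compact A" "continuous_on A g" for A and g :: "'c::euclidean_space \<Rightarrow> real"
    using set_lebesgue_integral_eq_integral(2)[OF absolutely_integrable_continuous_compact[OF that]]
      borel_integrable_compact[OF that]
    by (simp add: set_lebesgue_integral_def integral_completion borel_measurable_integrable)
  have "integral S f = (\<integral>z. indicator S z *\<^sub>R f z \<partial>distr lborel borel pair_of_vec)"
    using lint[OF S f] by (simp add: lborel_pair_of_vec)
  also have "\<dots> = (\<integral>v. indicator S (pair_of_vec v) *\<^sub>R f (pair_of_vec v) \<partial>lborel)"
    using borel_integrable_compact[OF S f] continuous_on_pair_of_vec[of UNIV]
    by (intro integral_distr) (auto simp: borel_measurable_continuous_onI dest: borel_measurable_integrable)
  also have "\<dots> = (\<integral>v. indicator ?T v *\<^sub>R f (pair_of_vec v) \<partial>lborel)"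
    by (intro Bochner_Integration.integral_cong refl arg_cong2[where f = "(*\<^sub>R)"])
      (auto simp: indicator_def image_iff intro: pair_of_vec_inverse[symmetric])
  also have "\<dots> = integral ?T (\<lambda>v. f (pair_of_vec v))"
    using lint[OF T ft] by simp
  finally show ?thesis .
qed

text \<open>Conjugation with \<open>pair_of_vec\<close> reduces this to the formula for vectors. The
  Jacobian is a separate function \<open>J\<close> so that a closed form with evident continuity can
  be supplied; compactness and continuity then settle all integrability questions.\<close>

lemma integral_change_of_variables_plane:
  fixes \<Phi> :: "real \<times> real \<Rightarrow> real \<times> real" and f :: "real \<times> real \<Rightarrow> real"
  assumes S: "compact S"
    and der: "\<And>z. z \<in> S \<Longrightarrow> (\<Phi> has_derivative \<Phi>' z) (at z within S)"
    and inj: "inj_on \<Phi> S"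
    and f: "continuous_on (\<Phi> ` S) f"
    and J: "\<And>z. z \<in> S \<Longrightarrow> J z =
      \<bar>fst (\<Phi>' z (1, 0)) * snd (\<Phi>' z (0, 1)) - fst (\<Phi>' z (0, 1)) * snd (\<Phi>' z (1, 0))\<bar>"
    and contJ: "continuous_on S J"
  shows "integral (\<Phi> ` S) f = integral S (\<lambda>z. J z * f (\<Phi> z))"
proof -
  let ?e = pair_of_vec and ?e' = vec_of_pair
  let ?T = "?e' ` S"
  define g where "g v = ?e' (\<Phi> (?e v))" for v
  define g' where "g' v h = ?e' (\<Phi>' (?e v) (?e h))" for v h
  have contP: "continuous_on S \<Phi>"
    by (rule has_derivative_continuous_on[OF der])
  have T: "compact ?T"
    using S by (intro compact_continuous_image continuous_on_vec_of_pair)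
  have eT: "?e ` ?T = S" by (force simp: image_iff)
  have gT: "g ` ?T = ?e' ` \<Phi> ` S" by (force simp: g_def image_iff)
  have dg: "(g has_derivative g' v) (at v within ?T)" if v: "v \<in> ?T" for v
  proof -
    have "?e v \<in> S" using v by auto
    then have "((\<lambda>v. \<Phi> (?e v)) has_derivative (\<lambda>h. \<Phi>' (?e v) (?e h))) (at v within ?T)"
      using has_derivative_in_compose[OF bounded_linear.has_derivative[OF bounded_linear_pair_of_vec has_derivative_ident], of \<Phi> "\<Phi>' (?e v)" v ?T] der
      by (simp add: eT)
    then show ?thesis
      unfolding g_def g'_def by (rule bounded_linear.has_derivative[OF bounded_linear_vec_of_pair])
  qed
  have ig: "inj_on g ?T"
  proof (rule inj_onI)
    fix v w assume "v \<in> ?T" "w \<in> ?T" "g v = g w"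
    then have "\<Phi> (?e v) = \<Phi> (?e w)" unfolding g_def by (metis vec_of_pair_inverse)
    then have "?e v = ?e w" using inj \<open>v \<in> ?T\<close> \<open>w \<in> ?T\<close> by (auto dest: inj_onD)
    then show "v = w" by (metis pair_of_vec_inverse)
  qed
  have det: "\<bar>det (matrix (g' v))\<bar> = J (?e v)" if "v \<in> ?T" for v
  proof -
    have "?e (axis 1 1) = (1, 0)" "?e (axis 2 1) = (0, 1)"
      by (auto simp: pair_of_vec_def axis_def)
    moreover have "?e v \<in> S" using that by auto
    ultimately show ?thesis
      using J[of "?e v"] by (simp add: det_2 matrix_def g'_def vec_of_pair_def)
  qed
  have comP: "compact (\<Phi> ` S)" using S contP by (rule compact_continuous_image[rotated])
  have cont: "continuous_on (g ` ?T) (\<lambda>v. f (?e v))"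
    unfolding gT by (rule continuous_on_compose2[OF f continuous_on_pair_of_vec]) auto
  have contJf: "continuous_on S (\<lambda>z. J z * f (\<Phi> z))"
    by (intro continuous_intros contJ continuous_on_compose2[OF f contP]) auto
  \<comment> \<open>The formula concerns vector-valued integrands, so the scalar is wrapped in
    \<open>real ^ 1\<close> and recovered afterwards as component 1.\<close>
  have "(\<lambda>v. vec (f (?e v)) :: real ^ 1) absolutely_integrable_on (g ` ?T)"
    using absolutely_integrable_continuous_compact[OF _ cont] comP
    by (simp add: absolutely_integrable_on_1_iff gT compact_continuous_image continuous_on_vec_of_pair)
  then have "integral ?T (\<lambda>v. \<bar>det (matrix (g' v))\<bar> *\<^sub>R vec (f (?e (g v)))) =
      integral (g ` ?T) (\<lambda>v. vec (f (?e v)) :: real ^ 1)"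
    using has_absolute_integral_change_of_variables_compact[OF T dg ig, of "\<lambda>v. vec (f (?e v)) :: real ^ 1"
      "integral (g ` ?T) (\<lambda>v. vec (f (?e v)) :: real ^ 1)"] by blast
  then have "integral ?T (\<lambda>v. (\<bar>det (matrix (g' v))\<bar> *\<^sub>R (vec (f (?e (g v))) :: real ^ 1)) $ 1) =
      integral (g ` ?T) (\<lambda>v. (vec (f (?e v)) :: real ^ 1) $ 1)"
    by (simp only: integral_on_1_eq vec_component vec_eq_iff simp_thms)
  then have "integral ?T (\<lambda>v. \<bar>det (matrix (g' v))\<bar> * f (?e (g v))) = integral (g ` ?T) (\<lambda>v. f (?e v))"
    by simp
  moreover have "integral ?T (\<lambda>v. \<bar>det (matrix (g' v))\<bar> * f (?e (g v))) =
      integral ?T (\<lambda>v. J (?e v) * f (\<Phi> (?e v)))"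
    using det by (intro integral_cong) (simp add: g_def)
  ultimately show ?thesis
    using integral_pair_of_vec[OF S contJf] integral_pair_of_vec[OF comP f] by (simp add: gT)
qed

section \<open>Smooth functions on the strip\<close>

text \<open>Second derivatives of the curve enter only through Frenet's equations, and the two
  concavity alternatives only through \<open>mono\<close>. Everything is required on the open
  interval, where derivatives are two-sided; the boxes used below never reach its endpoints.\<close>

locale symmetric_strip =
  fixes L :: real and x y x1 y1 k \<delta> \<delta>1 :: "real \<Rightarrow> real"
  assumes L: "0 < L"
    and x: "s \<in> {0<..<L} \<Longrightarrow> (x has_field_derivative x1 s) (at s)"
    and y: "s \<in> {0<..<L} \<Longrightarrow> (y has_field_derivative y1 s) (at s)"
    and x1: "s \<in> {0<..<L} \<Longrightarrow> (x1 has_field_derivative - k s * y1 s) (at s)"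
    and y1: "s \<in> {0<..<L} \<Longrightarrow> (y1 has_field_derivative k s * x1 s) (at s)"
    and unit_speed: "s \<in> {0<..<L} \<Longrightarrow> (x1 s)\<^sup>2 + (y1 s)\<^sup>2 = 1"
    and k: "s \<in> {0<..<L} \<Longrightarrow> k differentiable (at s)"
    and \<delta>: "s \<in> {0<..<L} \<Longrightarrow> (\<delta> has_field_derivative \<delta>1 s) (at s)"
    and \<delta>1: "continuous_on {0<..<L} \<delta>1"
    and slope: "s \<in> {0<..<L} \<Longrightarrow> \<bar>\<delta>1 s\<bar> \<le> 1"
    and \<delta>_pos: "s \<in> {0<..<L} \<Longrightarrow> 0 < \<delta> s"
    and jac_pos: "s \<in> {0<..<L} \<Longrightarrow> 0 < r \<Longrightarrow> r < \<delta> s \<Longrightarrow> 0 < 1 + r * k s"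
    and even: "s \<in> {0<..<L} \<Longrightarrow> \<delta> (L - s) = \<delta> s" "s \<in> {0<..<L} \<Longrightarrow> k (L - s) = k s"
    and mono: "0 < t \<Longrightarrow> t < 1 \<Longrightarrow> 0 < s \<Longrightarrow> s \<le> s' \<Longrightarrow> s' \<le> L / 2 \<Longrightarrow>
      \<delta> s * (1 + t * \<delta> s * k s) \<le> \<delta> s' * (1 + t * \<delta> s' * k s')"
    and mid: "x (L / 2) = 0" "y1 (L / 2) = 0"
    and inj: "inj_on (\<lambda>(s, r). (x s + r * y1 s, y s - r * x1 s)) (flat_domain L \<delta>)"
begin

text \<open>The order \<open>(t, s)\<close> makes \<open>s\<close> the inner variable of the
  iterated integral, so that each inner integral runs along one slice of constant
  \<open>t\<close>.\<close>

definition chart :: "real \<times> real \<Rightarrow> real \<times> real" where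
  "chart z = (x (snd z) + fst z * \<delta> (snd z) * y1 (snd z), y (snd z) - fst z * \<delta> (snd z) * x1 (snd z))"

text \<open>The partial derivative in \<open>s\<close>, resolved along the unit tangent and the
  normal. The normal part stems from the variable height \<open>t * \<delta> s\<close> of the
  slice.\<close>

definition chart_s :: "real \<times> real \<Rightarrow> real \<times> real" where
  "chart_s z = (1 + fst z * \<delta> (snd z) * k (snd z)) *\<^sub>R (x1 (snd z), y1 (snd z)) +
     (fst z * \<delta>1 (snd z)) *\<^sub>R (y1 (snd z), - x1 (snd z))"

definition chart_t :: "real \<times> real \<Rightarrow> real \<times> real" where
  "chart_t z = \<delta> (snd z) *\<^sub>R (y1 (snd z), - x1 (snd z))"

definition jac :: "real \<times> real \<Rightarrow> real" where
  "jac z = \<delta> (snd z) * (1 + fst z * \<delta> (snd z) * k (snd z))"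

lemma cont:
  "continuous_on {0<..<L} x" "continuous_on {0<..<L} y"
  "continuous_on {0<..<L} x1" "continuous_on {0<..<L} y1"
  "continuous_on {0<..<L} k" "continuous_on {0<..<L} \<delta>"
  using DERIV_isCont[OF x] DERIV_isCont[OF y] DERIV_isCont[OF x1] DERIV_isCont[OF y1]
    DERIV_isCont[OF \<delta>] differentiable_imp_continuous_within[OF k]
  by (blast intro!: continuous_at_imp_continuous_on)+

lemma chart_has_derivative:
  assumes "snd z \<in> {0<..<L}"
  shows "(chart has_derivative (\<lambda>h. fst h *\<^sub>R chart_t z + snd h *\<^sub>R chart_s z)) (at z)"
proof -
  have D: "((\<lambda>z. f (snd z)) has_derivative (\<lambda>h. snd h * f')) (at z)"
    if "(f has_field_derivative f') (at (snd z))" for f f'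
  proof -
    have "(f has_derivative (*) f') (at (snd z))"
      using that by (simp add: has_field_derivative_def)
    from has_derivative_compose[OF has_derivative_snd[OF has_derivative_ident] this]
    show ?thesis by (simp add: mult.commute)
  qed
  note D' = D[OF x[OF assms]] D[OF y[OF assms]] D[OF x1[OF assms]] D[OF y1[OF assms]] D[OF \<delta>[OF assms]]
  show ?thesis
    unfolding chart_def
    by (rule has_derivative_eq_rhs, (rule derivative_intros D')+)
      (auto simp: chart_t_def chart_s_def fun_eq_iff algebra_simps)
qed

text \<open>The normal part of \<open>chart_s\<close> is parallel to \<open>chart_t\<close> and
  drops out of the determinant, so the slope of \<open>\<delta>\<close> does not affect the area
  element.\<close>

lemma jac_eq:
  assumes "snd z \<in> {0<..<L}" "fst z \<in> {0<..<1}"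
  shows "jac z = \<bar>fst (chart_t z) * snd (chart_s z) - fst (chart_s z) * snd (chart_t z)\<bar>"
    and "0 < jac z"
proof -
  have "fst z * \<delta> (snd z) < \<delta> (snd z)" "0 < fst z * \<delta> (snd z)"
    using assms \<delta>_pos[of "snd z"] by auto
  then show pos: "0 < jac z"
    using jac_pos[of "snd z" "fst z * \<delta> (snd z)"] \<delta>_pos[of "snd z"] assms by (simp add: jac_def)
  have "fst (chart_t z) * snd (chart_s z) - fst (chart_s z) * snd (chart_t z) =
      jac z * ((x1 (snd z))\<^sup>2 + (y1 (snd z))\<^sup>2)"
    by (simp add: chart_t_def chart_s_def jac_def power2_eq_square algebra_simps)
  then show "jac z = \<bar>fst (chart_t z) * snd (chart_s z) - fst (chart_s z) * snd (chart_t z)\<bar>"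
    using pos unit_speed[OF assms(1)] by simp
qed

text \<open>Tangent and normal are orthonormal, so the squared norm is a sum of two squares. The
  tangential coefficient is positive, the normal one is at most 1 in absolute value, and
  \<open>max 1\<close> dominates both; the factor \<open>sqrt 2\<close> counts the two
  summands.\<close>

lemma norm_chart_s:
  assumes "snd z \<in> {0<..<L}" "fst z \<in> {0<..<1}"
  shows "norm (chart_s z) \<le> sqrt 2 * max 1 (1 + fst z * \<delta> (snd z) * k (snd z))"
proof -
  let ?m = "1 + fst z * \<delta> (snd z) * k (snd z)" and ?d = "fst z * \<delta>1 (snd z)"
  have "fst z * \<delta> (snd z) < \<delta> (snd z)" "0 < fst z * \<delta> (snd z)"
    using assms \<delta>_pos[of "snd z"] by auto
  then have m: "0 < ?m"
    using jac_pos[of "snd z" "fst z * \<delta> (snd z)"] assms by simp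
  have "\<bar>?d\<bar> \<le> 1 * 1"
    unfolding abs_mult by (rule mult_mono) (use assms slope[OF assms(1)] in auto)
  then have d: "?d\<^sup>2 \<le> 1" by (simp add: abs_square_le_1)
  have "(norm (chart_s z))\<^sup>2 = (?m\<^sup>2 + ?d\<^sup>2) * ((x1 (snd z))\<^sup>2 + (y1 (snd z))\<^sup>2)"
    by (simp add: power2_norm_eq_inner inner_prod_def chart_s_def)
      (simp add: power2_eq_square algebra_simps)
  also have "\<dots> = ?m\<^sup>2 + ?d\<^sup>2"
    using unit_speed[OF assms(1)] by simp
  also have "\<dots> \<le> (max 1 ?m)\<^sup>2 + (max 1 ?m)\<^sup>2"
  proof (rule add_mono)
    show "?m\<^sup>2 \<le> (max 1 ?m)\<^sup>2"
      using m by (intro power_mono) auto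
    have "1 \<le> (max 1 ?m)\<^sup>2"
      by (rule one_le_power) simp
    with d show "?d\<^sup>2 \<le> (max 1 ?m)\<^sup>2" by (rule order_trans)
  qed
  also have "\<dots> = (sqrt 2 * max 1 ?m)\<^sup>2"
    by (simp add: power_mult_distrib)
  finally show ?thesis
    using m by (simp add: power2_le_iff_abs_le)
qed

lemma chart_inj: "inj_on chart ({0<..<1} \<times> {0<..<L})"
proof (rule inj_onI)
  fix z z' assume z: "z \<in> {0<..<1} \<times> {0<..<L}" "z' \<in> {0<..<1} \<times> {0<..<L}" and eq: "chart z = chart z'"
  have flat: "(snd z, fst z * \<delta> (snd z)) \<in> flat_domain L \<delta>" if "z \<in> {0<..<1} \<times> {0<..<L}" for z
    using that \<delta>_pos[of "snd z"] by (auto simp: flat_domain_def)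
  have "(snd z, fst z * \<delta> (snd z)) = (snd z', fst z' * \<delta> (snd z'))"
    by (rule inj_onD[OF inj _ flat[OF z(1)] flat[OF z(2)]])
      (use eq in \<open>simp add: chart_def\<close>)
  then show "z = z'"
    using z \<delta>_pos[of "snd z'"] by (auto simp: prod_eq_iff)
qed

lemma cont_snd:
  assumes "continuous_on {0<..<L} (f :: real \<Rightarrow> real)"
  shows "continuous_on ({0<..<1::real} \<times> {0<..<L}) (\<lambda>z. f (snd z))"
  by (rule continuous_on_compose2[OF assms]) (auto intro: continuous_intros)

lemma cont_chart:
  "continuous_on ({0<..<1} \<times> {0<..<L}) chart"
  "continuous_on ({0<..<1} \<times> {0<..<L}) chart_s"
  "continuous_on ({0<..<1} \<times> {0<..<L}) jac"
  unfolding chart_def chart_s_def jac_def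
  by (intro continuous_intros cont_snd cont \<delta>1)+

text \<open>\<open>\<beta>\<close> stands for \<open>B_p\<close>, and the hypothesis on it says
  exactly that it absorbs the \<open>p\<close>-th power of the speed bound for the slices. The
  margin \<open>\<eta>\<close> on all four sides makes the coordinate box a compact subset of the
  open rectangle, where all data are continuous and the Jacobian is positive.\<close>

lemma smooth_inequality:
  fixes f :: "real \<times> real \<Rightarrow> real" and g :: "real \<times> real \<Rightarrow> real \<times> real" and \<eta> p \<beta> :: real
  defines "R \<equiv> cbox (\<eta>, \<eta>) (1 - \<eta>, L - \<eta>)"
  assumes p: "1 < p" and \<eta>: "0 < \<eta>" "\<eta> < 1 / 2" "\<eta> < L / 2"
    and f: "\<And>z. z \<in> chart ` R \<Longrightarrow> (f has_derivative (\<lambda>h. g z \<bullet> h)) (at z)"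
    and g: "continuous_on (chart ` R) g"
    and axis: "\<And>z. z \<in> chart ` R \<Longrightarrow> fst z = 0 \<Longrightarrow> f z = 0"
    and \<beta>_nonneg: "0 \<le> \<beta>"
    and \<beta>: "\<And>s r. s \<in> {0<..<L} \<Longrightarrow> 0 < r \<Longrightarrow> r < \<delta> s \<Longrightarrow> \<beta> * (sqrt 2 * max 1 (1 + r * k s)) powr p \<le> 1"
  shows "\<beta> * (pi_p p / L) powr p * integral (chart ` R) (\<lambda>z. \<bar>f z\<bar> powr p)
    \<le> integral (chart ` R) (\<lambda>z. norm (g z) powr p)"
proof -
  let ?lam = "(pi_p p / L) powr p"
  have R: "R \<subseteq> {0<..<1} \<times> {0<..<L}"
    using \<eta> by (auto simp: R_def cbox_Pair_eq)
  have Rmem: "(t, s) \<in> R \<longleftrightarrow> t \<in> {\<eta>..1 - \<eta>} \<and> s \<in> {\<eta>..L - \<eta>}" for t s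
    by (auto simp: R_def cbox_Pair_eq)
  note chartR = continuous_on_subset[OF cont_chart(1) R] and chart_sR = continuous_on_subset[OF cont_chart(2) R]
    and jacR = continuous_on_subset[OF cont_chart(3) R]
  have contf: "continuous_on (chart ` R) f"
    by (intro continuous_at_imp_continuous_on ballI has_derivative_continuous[OF f])
  have gR: "continuous_on R (\<lambda>z. g (chart z))" and fR: "continuous_on R (\<lambda>z. f (chart z))"
    by (rule continuous_on_compose2[OF g chartR] continuous_on_compose2[OF contf chartR]; simp)+
  define A where "A z = jac z * \<bar>f (chart z)\<bar> powr p" for z
  define B where "B z = jac z * norm (g (chart z)) powr p" for z
  have contA: "continuous_on R A" and contB: "continuous_on R B"
    unfolding A_def B_def using p
    by (intro continuous_intros continuous_on_powr' jacR fR gR; simp)+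
  have cov: "integral (chart ` R) F = integral {\<eta>..1 - \<eta>} (\<lambda>t. integral {\<eta>..L - \<eta>} (\<lambda>s. jac (t, s) * F (chart (t, s))))"
    if F: "continuous_on (chart ` R) F" for F
  proof -
    have "integral (chart ` R) F = integral R (\<lambda>z. jac z * F (chart z))"
    proof (rule integral_change_of_variables_plane)
      show "(chart has_derivative (\<lambda>h. fst h *\<^sub>R chart_t z + snd h *\<^sub>R chart_s z)) (at z within R)"
        if "z \<in> R" for z
        by (rule has_derivative_at_withinI[OF chart_has_derivative]) (use R that in auto)
      show "jac z = \<bar>fst (fst (1::real, 0::real) *\<^sub>R chart_t z + snd (1::real, 0::real) *\<^sub>R chart_s z) *
          snd (fst (0::real, 1::real) *\<^sub>R chart_t z + snd (0::real, 1::real) *\<^sub>R chart_s z) -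
          fst (fst (0::real, 1::real) *\<^sub>R chart_t z + snd (0::real, 1::real) *\<^sub>R chart_s z) *
          snd (fst (1::real, 0::real) *\<^sub>R chart_t z + snd (1::real, 0::real) *\<^sub>R chart_s z)\<bar>"
        if "z \<in> R" for z
        using jac_eq(1)[of z] R that by auto
    qed (use F jacR inj_on_subset[OF chart_inj R] in \<open>auto simp: R_def\<close>)
    also have "\<dots> = integral {\<eta>..1 - \<eta>} (\<lambda>t. integral {\<eta>..L - \<eta>} (\<lambda>s. jac (t, s) * F (chart (t, s))))"
      unfolding R_def
      by (subst integral_prod_continuous)
        (auto intro!: continuous_intros continuous_on_compose2[OF F chartR] jacR simp flip: R_def)
    finally show ?thesis .
  qed
  have contFf: "continuous_on (chart ` R) (\<lambda>z. \<bar>f z\<bar> powr p)"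
    and contFg: "continuous_on (chart ` R) (\<lambda>z. norm (g z) powr p)"
    using p by (intro continuous_intros continuous_on_powr' contf g; simp)+
  have swap: "continuous_on {\<eta>..1 - \<eta>} (\<lambda>t. integral (cbox \<eta> (L - \<eta>)) (\<lambda>s. F (t, s)))"
    if "continuous_on R F" for F :: "real \<times> real \<Rightarrow> real"
  proof (rule integral_continuous_on_param)
    have "{\<eta>..1 - \<eta>} \<times> cbox \<eta> (L - \<eta>) = R" by (simp add: R_def cbox_Pair_eq)
    then show "continuous_on ({\<eta>..1 - \<eta>} \<times> cbox \<eta> (L - \<eta>)) (\<lambda>(t, s). F (t, s))"
      using that by simp
  qed
  \<comment> \<open>For fixed \<open>t\<close> this is the weighted one-dimensional problem with
    weight \<open>jac (t, s)\<close>, which is even about \<open>L / 2\<close> and nondecreasing to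
    the left of it.\<close>
  have slice: "\<beta> * ?lam * integral {\<eta>..L - \<eta>} (\<lambda>s. A (t, s)) \<le> integral {\<eta>..L - \<eta>} (\<lambda>s. B (t, s))"
    if t: "t \<in> {\<eta>..1 - \<eta>}" for t
  proof -
    have t01: "0 < t" "t < 1" using t \<eta> by auto
    have sR: "(t, s) \<in> R" "s \<in> {0<..<L}" if "s \<in> {\<eta>..L - \<eta>}" for s
      using that t \<eta> by (auto simp: Rmem)
    have slice_cont: "continuous_on {\<eta>..L - \<eta>} (\<lambda>s. F (t, s))" if "continuous_on R F" for F :: "real \<times> real \<Rightarrow> 'd::topological_space"
      by (rule continuous_on_compose2[OF that]) (auto intro!: continuous_intros sR)
    define v where "v s = f (chart (t, s))" for s
    define v' where "v' s = g (chart (t, s)) \<bullet> chart_s (t, s)" for s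
    define w where "w s = jac (t, s)" for s
    have dv: "(v has_field_derivative v' s) (at s)" if s: "s \<in> {\<eta>..L - \<eta>}" for s
    proof -
      have "((\<lambda>s. (t, s)) has_derivative (\<lambda>h. (0, h))) (at s)"
        by (auto intro!: derivative_eq_intros)
      from has_derivative_compose[OF this chart_has_derivative] sR[OF s]
      have "((\<lambda>s. chart (t, s)) has_derivative (\<lambda>h. h *\<^sub>R chart_s (t, s))) (at s)"
        by simp
      from has_derivative_compose[OF this f] sR[OF s]
      have "(v has_derivative (\<lambda>h. g (chart (t, s)) \<bullet> (h *\<^sub>R chart_s (t, s)))) (at s)"
        by (simp add: v_def[abs_def])
      then show ?thesis
        by (simp add: has_field_derivative_def v'_def mult_commute_abs)
    qed
    obtain w' where w': "\<And>s. s \<in> {\<eta>..L - \<eta>} \<Longrightarrow> (w has_field_derivative w' s) (at s)"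
    proof -
      have "\<exists>D. (w has_field_derivative D) (at s)" if s: "s \<in> {\<eta>..L - \<eta>}" for s
      proof -
        obtain k' where "(k has_field_derivative k') (at s)"
          using k[OF sR(2)[OF s]] by (auto simp: real_differentiable_def)
        from DERIV_mult[OF \<delta>[OF sR(2)[OF s]] DERIV_add[OF DERIV_const[of 1]
          DERIV_mult[OF DERIV_cmult[OF \<delta>[OF sR(2)[OF s]], of t] this]]]
        show ?thesis unfolding w_def[abs_def] jac_def by auto
      qed
      then show ?thesis using that by metis
    qed
    have contv': "continuous_on {\<eta>..L - \<eta>} v'"
      unfolding v'_def by (intro continuous_intros slice_cont[OF gR] slice_cont[OF chart_sR])
    have wpos: "0 < w s" if "s \<in> {\<eta>..L - \<eta>}" for s
      using jac_eq(2)[of "(t, s)"] sR[OF that] t01 by (simp add: w_def)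
    have "?lam * integral {\<eta>..L - \<eta>} (\<lambda>s. \<bar>v s\<bar> powr p * w s)
        \<le> integral {\<eta>..L - \<eta>} (\<lambda>s. \<bar>v' s\<bar> powr p * w s)"
    proof (rule weighted_poincare_symmetric[OF p L])
      show "w s \<le> w s'" if "\<eta> \<le> s" "s \<le> s'" "s' \<le> L / 2" for s s'
        using mono[of t s s'] that t01 \<eta> by (simp add: w_def jac_def)
      show "w (L - s) = w s" if "s \<in> {\<eta>..L - \<eta>}" for s
        using even sR[OF that] by (simp add: w_def jac_def)
      \<comment> \<open>Every slice meets the axis at its midpoint: \<open>x\<close> and
        \<open>y1\<close> vanish at \<open>L / 2\<close>, hence so does the first coordinate of
        \<open>chart (t, L / 2)\<close>.\<close>
      have "(t, L / 2) \<in> R" using t \<eta> by (auto simp: Rmem)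
      then have "chart (t, L / 2) \<in> chart ` R" by (rule imageI)
      then show "v (L / 2) = 0"
        unfolding v_def by (rule axis) (simp add: chart_def mid)
    qed (use \<eta> dv w' contv' wpos in \<open>auto intro: less_imp_le\<close>)
    then have 1: "?lam * integral {\<eta>..L - \<eta>} (\<lambda>s. A (t, s)) \<le> integral {\<eta>..L - \<eta>} (\<lambda>s. w s * \<bar>v' s\<bar> powr p)"
      by (simp add: A_def v_def w_def mult.commute)
    have contw: "continuous_on {\<eta>..L - \<eta>} w"
      unfolding w_def by (rule slice_cont[OF jacR])
    have i1: "(\<lambda>s. w s * \<bar>v' s\<bar> powr p) integrable_on {\<eta>..L - \<eta>}"
      using p by (intro integrable_continuous_real continuous_intros continuous_on_powr' contw contv'; simp)
    have i2: "(\<lambda>s. B (t, s)) integrable_on {\<eta>..L - \<eta>}"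
      by (intro integrable_continuous_real slice_cont contB)
    have "\<beta> * integral {\<eta>..L - \<eta>} (\<lambda>s. w s * \<bar>v' s\<bar> powr p) = integral {\<eta>..L - \<eta>} (\<lambda>s. \<beta> * (w s * \<bar>v' s\<bar> powr p))"
      by simp
    also have "\<dots> \<le> integral {\<eta>..L - \<eta>} (\<lambda>s. B (t, s))"
    proof (rule integral_le)
      show "(\<lambda>s. \<beta> * (w s * \<bar>v' s\<bar> powr p)) integrable_on {\<eta>..L - \<eta>}"
        using i1 by (rule integrable_on_mult_right)
      fix s assume s: "s \<in> {\<eta>..L - \<eta>}"
      let ?N = "sqrt 2 * max 1 (1 + t * \<delta> s * k s)" and ?G = "norm (g (chart (t, s)))"
      \<comment> \<open>The derivative along the slice is at most the full gradient times the speed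
        of the slice, and \<open>\<beta>\<close> pays for the power of that speed.\<close>
      have "\<bar>v' s\<bar> \<le> ?G * norm (chart_s (t, s))"
        unfolding v'_def by (rule Cauchy_Schwarz_ineq2)
      also have "\<dots> \<le> ?G * ?N"
        using norm_chart_s[of "(t, s)"] sR[OF s] t01 by (intro mult_left_mono) auto
      finally have "\<bar>v' s\<bar> powr p \<le> (?G * ?N) powr p"
        using p by (intro powr_mono2) auto
      also have "\<dots> = ?G powr p * ?N powr p"
        by (rule powr_mult)
      finally have "\<beta> * \<bar>v' s\<bar> powr p \<le> \<beta> * (?G powr p * ?N powr p)"
        using \<beta>_nonneg by (rule mult_left_mono)
      also have "\<dots> = (\<beta> * ?N powr p) * ?G powr p" by simp
      also have "\<dots> \<le> 1 * ?G powr p"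
        using \<beta>[of s "t * \<delta> s"] sR[OF s] t01 \<delta>_pos[of s] by (intro mult_right_mono) auto
      finally have "w s * (\<beta> * \<bar>v' s\<bar> powr p) \<le> w s * ?G powr p"
        using wpos[OF s] by (intro mult_left_mono) auto
      then show "\<beta> * (w s * \<bar>v' s\<bar> powr p) \<le> B (t, s)"
        by (simp add: B_def w_def algebra_simps)
    qed (rule i2)
    finally show ?thesis
      using mult_left_mono[OF 1 \<beta>_nonneg] by (simp add: mult.assoc)
  qed
  have "\<beta> * ?lam * integral (chart ` R) (\<lambda>z. \<bar>f z\<bar> powr p) =
      integral {\<eta>..1 - \<eta>} (\<lambda>t. \<beta> * ?lam * integral {\<eta>..L - \<eta>} (\<lambda>s. A (t, s)))"
    unfolding cov[OF contFf] A_def by simp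
  also have "\<dots> \<le> integral {\<eta>..1 - \<eta>} (\<lambda>t. integral {\<eta>..L - \<eta>} (\<lambda>s. B (t, s)))"
    using swap[OF contA] swap[OF contB] slice
    by (intro integral_le integrable_continuous_real continuous_intros) auto
  also have "\<dots> = integral (chart ` R) (\<lambda>z. norm (g z) powr p)"
    unfolding cov[OF contFg] B_def by simp
  finally show ?thesis .
qed

end

section \<open>Bump functions\<close>

text \<open>\<open>flat_exp 0\<close> is the classical flat function \<open>exp (- 1 / t)\<close>,
  extended by 0. With \<open>y = 1 / t\<close>, differentiating \<open>P(y) exp (- y)\<close> in
  \<open>t\<close> gives \<open>y^2 (P(y) - P'(y)) exp (- y)\<close>, which is the
  recursion.\<close>

fun flat_exp_poly :: "nat \<Rightarrow> real poly" where
  "flat_exp_poly 0 = 1"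
| "flat_exp_poly (Suc n) = [:0, 0, 1:] * (flat_exp_poly n - pderiv (flat_exp_poly n))"

definition flat_exp :: "nat \<Rightarrow> real \<Rightarrow> real" where
  "flat_exp n t = (if 0 < t then poly (flat_exp_poly n) (1 / t) * exp (- (1 / t)) else 0)"

lemma poly_times_exp_minus_tendsto_0: "((\<lambda>y::real. poly Q y * exp (- y)) \<longlongrightarrow> 0) at_top"
proof -
  have "((\<lambda>y. \<Sum>i\<le>degree Q. coeff Q i * (y ^ i / exp y)) \<longlongrightarrow> (\<Sum>i\<le>degree Q. coeff Q i * 0)) at_top"
    by (intro tendsto_intros tendsto_power_div_exp_0)
  then show ?thesis
    by (simp add: poly_altdef sum_distrib_right exp_minus divide_inverse mult.assoc)
qed

lemma flat_exp_deriv: "(flat_exp n has_field_derivative flat_exp (Suc n) t) (at t)"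
proof (cases t "0::real" rule: linorder_cases)
  case less
  have "((\<lambda>t. 0) has_field_derivative 0) (at t)" by simp
  then have "(flat_exp n has_field_derivative 0) (at t)"
    by (rule has_field_derivative_transform_within_open[where S = "{..<0}"])
      (use less in \<open>auto simp: flat_exp_def\<close>)
  then show ?thesis using less by (simp add: flat_exp_def)
next
  case greater
  let ?P = "flat_exp_poly n"
  have "((\<lambda>t. poly ?P (1 / t) * exp (- (1 / t))) has_field_derivative
      (poly (pderiv ?P) (1 / t) * (- (1 / t\<^sup>2))) * exp (- (1 / t)) +
      exp (- (1 / t)) * (1 / t\<^sup>2) * poly ?P (1 / t)) (at t)"
    using greater
    by (auto intro!: derivative_eq_intros DERIV_chain2[OF poly_DERIV] simp: power2_eq_square)
  then have "(flat_exp n has_field_derivative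
      (poly (pderiv ?P) (1 / t) * (- (1 / t\<^sup>2))) * exp (- (1 / t)) +
      exp (- (1 / t)) * (1 / t\<^sup>2) * poly ?P (1 / t)) (at t)"
    by (rule has_field_derivative_transform_within_open[where S = "{0<..}"])
      (use greater in \<open>auto simp: flat_exp_def\<close>)
  then show ?thesis
    using greater by (simp add: flat_exp_def power2_eq_square algebra_simps)
next
  case equal
  \<comment> \<open>With \<open>y = 1 / t\<close> the right-hand difference quotient at 0 is
    \<open>y P(y) exp (- y)\<close>; \<open>pCons 0\<close> supplies the factor
    \<open>y\<close>.\<close>
  have "((\<lambda>t. poly (pCons 0 (flat_exp_poly n)) (inverse t) * exp (- inverse t)) \<longlongrightarrow> 0) (at_right 0)"
    by (rule filterlim_compose[OF poly_times_exp_minus_tendsto_0 filterlim_inverse_at_top_right])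
  then have "((\<lambda>t. flat_exp n t / t) \<longlongrightarrow> 0) (at_right 0)"
    by (rule Lim_transform_eventually)
      (auto simp: eventually_at_filter flat_exp_def field_simps)
  moreover have "((\<lambda>t. flat_exp n t / t) \<longlongrightarrow> 0) (at_left 0)"
    by (rule Lim_transform_eventually[OF tendsto_const])
      (auto simp: eventually_at_filter flat_exp_def)
  ultimately have "((\<lambda>t. flat_exp n t / t) \<longlongrightarrow> 0) (at 0)"
    by (simp add: filterlim_at_split)
  then show ?thesis
    using equal by (simp add: has_field_derivative_iff flat_exp_def)
qed

definition bump :: "real \<Rightarrow> real \<Rightarrow> real \<Rightarrow> real" where
  "bump a b x = flat_exp 0 (x - a) * flat_exp 0 (b - x)"

lemma bump_nonneg: "0 \<le> bump a b x"
  and bump_eq_0_iff: "bump a b x = 0 \<longleftrightarrow> \<not> (a < x \<and> x < b)"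
  by (auto simp: bump_def flat_exp_def)

text \<open>A family of functions closed under differentiation that contains
  \<open>bump a b\<close>. The argument \<open>b - x\<close> contributes a minus sign to the product
  rule, so differences are the only closure operation required.\<close>

inductive_set bump_span :: "real \<Rightarrow> real \<Rightarrow> (real \<Rightarrow> real) set" for a b where
  base: "(\<lambda>x. flat_exp i (x - a) * flat_exp j (b - x)) \<in> bump_span a b"
| diff: "f \<in> bump_span a b \<Longrightarrow> g \<in> bump_span a b \<Longrightarrow> (\<lambda>x. f x - g x) \<in> bump_span a b"

lemma bump_in_span: "bump a b \<in> bump_span a b"
  using bump_span.base[of 0 a 0 b] by (simp add: bump_def[abs_def])

lemma bump_span_deriv:
  assumes "f \<in> bump_span a b"
  shows "\<exists>f'\<in>bump_span a b. \<forall>x. (f has_field_derivative f' x) (at x)"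
  using assms
proof induction
  case (base i j)
  let ?f' = "\<lambda>x. flat_exp (Suc i) (x - a) * flat_exp j (b - x) - flat_exp i (x - a) * flat_exp (Suc j) (b - x)"
  have "((\<lambda>x. flat_exp i (x - a) * flat_exp j (b - x)) has_field_derivative ?f' x) (at x)" for x
    by (auto intro!: derivative_eq_intros DERIV_chain2[OF flat_exp_deriv] simp del: flat_exp_poly.simps)
  moreover have "?f' \<in> bump_span a b"
    by (intro bump_span.intros)
  ultimately show ?case by (intro bexI[of _ ?f']) auto
next
  case (diff f g)
  then obtain f' g' where "f' \<in> bump_span a b" "g' \<in> bump_span a b"
    "\<forall>x. (f has_field_derivative f' x) (at x)" "\<forall>x. (g has_field_derivative g' x) (at x)"
    by blast
  then show ?case
    by (intro bexI[of _ "\<lambda>x. f' x - g' x"]) (auto intro: bump_span.intros DERIV_diff)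
qed

lemma bump_span_support:
  assumes "f \<in> bump_span a b" "\<not> (a < x \<and> x < b)"
  shows "f x = 0"
  using assms by induction (auto simp: flat_exp_def)

section \<open>Smooth mollifiers in the plane\<close>

lemma has_derivative_mult_fst_snd:
  fixes f g :: "real \<Rightarrow> real"
  assumes "(f has_field_derivative f') (at (fst z))" "(g has_field_derivative g') (at (snd z))"
  shows "((\<lambda>z. c * (f (fst z) * g (snd z))) has_derivative
    (\<lambda>h. (c * (f' * g (snd z)), c * (f (fst z) * g')) \<bullet> h)) (at z)"
proof -
  have 1: "((\<lambda>z. f (fst z)) has_derivative (\<lambda>h. f' * fst h)) (at z)"
    using has_derivative_compose[OF has_derivative_fst[OF has_derivative_ident]
      assms(1)[unfolded has_field_derivative_def]] .
  have 2: "((\<lambda>z. g (snd z)) has_derivative (\<lambda>h. g' * snd h)) (at z)"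
    using has_derivative_compose[OF has_derivative_snd[OF has_derivative_ident]
      assms(2)[unfolded has_field_derivative_def]] .
  show ?thesis
    by (rule has_derivative_eq_rhs[OF has_derivative_mult_right[OF has_derivative_mult[OF 1 2]]])
      (auto simp: inner_prod_def algebra_simps)
qed

text \<open>Each partial derivative of a function in the class \<open>C\<close> of scaled products
  lies in \<open>C\<close> again, so induction on the list of directions never leaves a class of
  differentiable functions.\<close>

lemma smooth_fun_bump_product:
  fixes c :: real
  assumes "f \<in> bump_span a b" "g \<in> bump_span a' b'"
  shows "smooth_fun (\<lambda>z. c * (f (fst z) * g (snd z)))"
proof -
  define C where "C = {\<lambda>z::real \<times> real. c * (f (fst z) * g (snd z)) | f g. f \<in> bump_span a b \<and> g \<in> bump_span a' b'}"
  have step: "\<phi> differentiable_on UNIV \<and> (\<forall>v\<in>Basis. (\<lambda>z. frechet_derivative \<phi> (at z) v) \<in> C)" if mem: "\<phi> \<in> C" for \<phi>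
  proof -
    obtain f g where \<phi>: "\<phi> = (\<lambda>z. c * (f (fst z) * g (snd z)))" and fg: "f \<in> bump_span a b" "g \<in> bump_span a' b'"
      using mem by (auto simp: C_def)
    obtain f' g' where f': "f' \<in> bump_span a b" "\<And>x. (f has_field_derivative f' x) (at x)"
      and g': "g' \<in> bump_span a' b'" "\<And>x. (g has_field_derivative g' x) (at x)"
      using bump_span_deriv[OF fg(1)] bump_span_deriv[OF fg(2)] by blast
    have D: "(\<phi> has_derivative (\<lambda>h. (c * (f' (fst z) * g (snd z)), c * (f (fst z) * g' (snd z))) \<bullet> h)) (at z)" for z
      unfolding \<phi> by (rule has_derivative_mult_fst_snd[OF f'(2) g'(2)])
    then have diff: "\<phi> differentiable_on UNIV"
      by (auto simp: differentiable_on_def differentiable_def)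
    have "frechet_derivative \<phi> (at z) = (\<lambda>h. (c * (f' (fst z) * g (snd z)), c * (f (fst z) * g' (snd z))) \<bullet> h)" for z
      using frechet_derivative_at[OF D] by simp
    moreover have "(\<lambda>z. c * (f' (fst z) * g (snd z))) \<in> C" "(\<lambda>z. c * (f (fst z) * g' (snd z))) \<in> C"
      using f' g' fg by (auto simp: C_def)
    ultimately show ?thesis
      using diff by (auto simp: Basis_prod_def inner_prod_def)
  qed
  have "fold (\<lambda>b f z. frechet_derivative f (at z) b) bs \<phi> \<in> C"
    if "bs \<in> lists Basis" "\<phi> \<in> C" for bs \<phi>
    using that by (induction bs arbitrary: \<phi>) (use step in auto)
  moreover have "(\<lambda>z. c * (f (fst z) * g (snd z))) \<in> C"
    using assms by (auto simp: C_def)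
  ultimately show ?thesis
    unfolding smooth_fun_def using step by blast
qed

lemma bump_reflect: "bump (- e) e (x - t) = bump (x - e) (x + e) t"
  by (simp add: bump_def algebra_simps)

text \<open>A product of one-dimensional bumps instead of a radial kernel: partial derivatives
  remain products, and evenness of the first factor gives the invariance under reflection in the
  \<open>y\<close>-axis.\<close>

lemma obtain_mollifier:
  fixes e :: real
  assumes e: "0 < e"
  obtains \<rho> :: "real \<times> real \<Rightarrow> real" and \<rho>' :: "real \<times> real \<Rightarrow> real \<times> real"
  where "\<And>z. 0 \<le> \<rho> z" "\<And>z. e \<le> norm z \<Longrightarrow> \<rho> z = 0" "\<And>z. e \<le> norm z \<Longrightarrow> \<rho>' z = 0"
    and "integrable lborel \<rho>" "(\<integral>z. \<rho> z \<partial>lborel) = 1"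
    and "\<And>z. (\<rho> has_derivative (\<lambda>h. \<rho>' z \<bullet> h)) (at z)" "continuous_on UNIV \<rho>'"
    and "\<And>z. \<rho> (- fst z, snd z) = \<rho> z"
    and "\<And>x. smooth_fun (\<lambda>z. \<rho> (x - z))"
proof -
  \<comment> \<open>A point of the open square of half-width \<open>d\<close> has coordinates with
    absolute values summing to less than \<open>2 * d = e\<close>, so the square lies in the ball of
    radius \<open>e\<close>.\<close>
  define d where "d = e / 2"
  have d: "0 < d" using e by (simp add: d_def)
  define b where "b = bump (- d) d"
  obtain b' where b'_span: "b' \<in> bump_span (- d) d" and b': "\<And>x. (b has_field_derivative b' x) (at x)"
    using bump_span_deriv[OF bump_in_span] unfolding b_def by blast
  obtain b'' where b'': "\<And>x. (b' has_field_derivative b'' x) (at x)"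
    using bump_span_deriv[OF b'_span] by blast
  have contb: "continuous_on S b" "continuous_on S b'" for S
    using DERIV_isCont[OF b'] DERIV_isCont[OF b''] by (auto intro: continuous_at_imp_continuous_on)
  have b0: "b x = 0" "b' x = 0" if "\<not> (- d < x \<and> x < d)" for x
    using that bump_span_support[OF b'_span] by (auto simp: b_def bump_eq_0_iff)
  define r where "r z = b (fst z) * b (snd z)" for z
  have r_nonneg: "0 \<le> r z" for z by (simp add: r_def b_def bump_nonneg)
  have contr: "continuous_on UNIV r"
    unfolding r_def by (intro continuous_intros continuous_on_compose2[OF contb(1)[of UNIV]]) auto
  have supp: "\<not> (- d < fst z \<and> fst z < d) \<or> \<not> (- d < snd z \<and> snd z < d)" if "e \<le> norm z" for z :: "real \<times> real"
  proof (rule ccontr)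
    assume "\<not> ?thesis"
    then have "\<bar>fst z\<bar> + \<bar>snd z\<bar> < e" by (auto simp: d_def)
    moreover have "norm z \<le> \<bar>fst z\<bar> + \<bar>snd z\<bar>"
      by (metis norm_Pair_le prod.collapse real_norm_def)
    ultimately show False using that by simp
  qed
  have r_ind: "r = (\<lambda>z. indicator (cball 0 e) z *\<^sub>R r z)"
  proof
    fix z :: "real \<times> real"
    show "r z = indicator (cball 0 e) z *\<^sub>R r z"
    proof (cases "norm z \<le> e")
      case False
      then have "r z = 0" using supp[of z] b0 by (auto simp: r_def)
      then show ?thesis by simp
    qed (simp add: indicator_def)
  qed
  have int: "integrable lborel r"
    by (subst r_ind) (intro borel_integrable_compact continuous_on_subset[OF contr], auto)
  define Z where "Z = (\<integral>z. r z \<partial>lborel)"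
  have Z: "0 < Z"
  proof -
    have "Z \<noteq> 0"
    proof
      assume "Z = 0"
      then have "AE z in lborel. r z = 0"
        unfolding Z_def using integral_nonneg_eq_0_iff_AE[OF int] r_nonneg by auto
      then have "AE z in lborel. z \<notin> box (- d, - d) (d, d)"
        by eventually_elim (auto simp: r_def b_def bump_eq_0_iff box_def Basis_prod_def)
      then have "box (- d, - d) (d, d) \<in> null_sets lborel"
        by (simp add: AE_iff_null_sets)
      then have "negligible (box (- d, - d) (d, d))"
        using negligible_iff_null_sets null_sets_completionI by blast
      then have "box (- d, - d) (d, d) = {}"
        using open_not_negligible open_box by blast
      moreover have "0 \<in> box (- d, - d) (d, d)"
        using d by (auto simp: box_def Basis_prod_def)
      ultimately show False by blast
    qed
    moreover have "0 \<le> Z" using r_nonneg by (simp add: Z_def)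
    ultimately show ?thesis by simp
  qed
  define \<rho> where "\<rho> z = (1 / Z) * (b (fst z) * b (snd z))" for z
  define \<rho>' where "\<rho>' z = ((1 / Z) * (b' (fst z) * b (snd z)), (1 / Z) * (b (fst z) * b' (snd z)))" for z
  have \<rho>r: "\<rho> = (\<lambda>z. (1 / Z) * r z)" by (simp add: \<rho>_def[abs_def] r_def)
  show ?thesis
  proof (rule that[of \<rho> \<rho>'])
    show "0 \<le> \<rho> z" for z using r_nonneg Z by (simp add: \<rho>r)
    show "\<rho> z = 0" "\<rho>' z = 0" if "e \<le> norm z" for z
      using supp[OF that] b0 by (auto simp: \<rho>_def \<rho>'_def zero_prod_def)
    show "integrable lborel \<rho>" unfolding \<rho>r using int by simp
    have "(\<integral>z. \<rho> z \<partial>lborel) = (1 / Z) * (\<integral>z. r z \<partial>lborel)"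
      unfolding \<rho>r by (rule integral_mult_right_zero)
    then show "(\<integral>z. \<rho> z \<partial>lborel) = 1" using Z by (simp add: Z_def)
    show "(\<rho> has_derivative (\<lambda>h. \<rho>' z \<bullet> h)) (at z)" for z
      unfolding \<rho>_def \<rho>'_def by (rule has_derivative_mult_fst_snd[OF b' b'])
    show "continuous_on UNIV \<rho>'"
      unfolding \<rho>'_def
      by (intro continuous_intros continuous_on_compose2[OF contb(1)[of UNIV]]
          continuous_on_compose2[OF contb(2)[of UNIV]]) auto
    show "\<rho> (- fst z, snd z) = \<rho> z" for z
      by (simp add: \<rho>_def b_def bump_def add.commute)
    show "smooth_fun (\<lambda>z. \<rho> (x - z))" for x
    proof -
      have "(\<lambda>z. \<rho> (x - z)) = (\<lambda>z. 1 / Z * (bump (fst x - d) (fst x + d) (fst z) * bump (snd x - d) (snd x + d) (snd z)))"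
        by (simp add: \<rho>_def b_def bump_reflect)
      then show ?thesis
        by (simp only: smooth_fun_bump_product[OF bump_in_span bump_in_span])
    qed
  qed
qed

section \<open>Mollification\<close>

text \<open>Two steps, each by dominated convergence: \<open>u\<close> is clamped in value and cut
  off in space, and the result is then approached by continuous functions that converge to it almost
  everywhere.\<close>

lemma continuous_dense_L1:
  fixes u :: "'a::euclidean_space \<Rightarrow> real"
  assumes u: "integrable lborel u" and \<eta>: "0 < \<eta>"
  obtains v K where "continuous_on UNIV v" "0 < K" "\<And>x. K \<le> norm x \<Longrightarrow> v x = 0"
    "integrable lborel v" "(\<integral>x. \<bar>u x - v x\<bar> \<partial>lborel) < \<eta>"
proof -
  define cl where "cl M t = max (- M) (min M t)" for M t :: real
  define ct where "ct M x = max 0 (min 1 (M + 1 - norm x))" for M and x :: 'a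
  have cl: "\<bar>cl M t\<bar> \<le> \<bar>t\<bar>" "\<bar>cl M t\<bar> \<le> M" if "0 \<le> M" for M t
    using that by (auto simp: cl_def)
  have ct: "0 \<le> ct M x" "ct M x \<le> 1" for M x by (auto simp: ct_def)
  have ct0: "ct M x = 0" if "M + 1 \<le> norm x" for M x using that by (auto simp: ct_def)
  have contct: "continuous_on UNIV (ct M)" for M unfolding ct_def by (intro continuous_intros)
  have contcl: "continuous_on UNIV (cl M)" for M unfolding cl_def by (intro continuous_intros)
  note meas [measurable] = borel_measurable_continuous_onI[OF contct] borel_measurable_continuous_onI[OF contcl]
    borel_measurable_integrable[OF u, simplified]
  define uM where "uM n x = cl (real n) (u x) * ct (real n) x" for n :: nat and x
  have uM_le: "\<bar>uM n x\<bar> \<le> \<bar>u x\<bar>" for n x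
    using mult_mono[OF cl(1)[of n "u x"] ct(2)[of n x]] ct(1)[of n x] by (simp add: uM_def abs_mult)
  have "(\<lambda>n. \<integral>x. \<bar>u x - uM n x\<bar> \<partial>lborel) \<longlonglongrightarrow> (\<integral>x. 0 \<partial>(lborel :: 'a measure))"
  proof (rule integral_dominated_convergence[where w = "\<lambda>x. 2 * \<bar>u x\<bar>"])
    show "AE x in lborel. (\<lambda>n. \<bar>u x - uM n x\<bar>) \<longlonglongrightarrow> 0"
    proof (rule AE_I2)
      fix x
      obtain N where N: "max \<bar>u x\<bar> (norm x) \<le> real N" using real_arch_simple by blast
      have "\<bar>u x - uM n x\<bar> = 0" if "N \<le> n" for n
      proof -
        have "max \<bar>u x\<bar> (norm x) \<le> real n" using N that by linarith
        then show ?thesis by (auto simp: uM_def cl_def ct_def)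
      qed
      then have "\<forall>\<^sub>F n in sequentially. \<bar>u x - uM n x\<bar> = 0"
        by (auto simp: eventually_sequentially)
      then show "(\<lambda>n. \<bar>u x - uM n x\<bar>) \<longlonglongrightarrow> 0" by (rule tendsto_eventually)
    qed
    show "AE x in lborel. norm \<bar>u x - uM n x\<bar> \<le> 2 * \<bar>u x\<bar>" for n
      using uM_le[of n] by (intro AE_I2) (smt (verit) real_norm_def)
  qed (use u in \<open>auto simp: uM_def\<close>)
  then have "\<forall>\<^sub>F n in sequentially. (\<integral>x. \<bar>u x - uM n x\<bar> \<partial>lborel) < \<eta> / 2"
    using \<eta> by (intro order_tendstoD(2)) auto
  then obtain M where M: "(\<integral>x. \<bar>u x - uM M x\<bar> \<partial>lborel) < \<eta> / 2"
    by (auto simp: eventually_sequentially)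
  have "u \<in> borel_measurable lebesgue"
    using borel_measurable_integrable[OF u] by (rule measurable_completion)
  then have "u measurable_on UNIV"
    using lebesgue_measurable_imp_measurable_on[of u UNIV] by simp
  then obtain N g where N: "negligible N" and g: "\<And>n. continuous_on UNIV (g n)"
    and lim: "\<And>x. x \<notin> N \<Longrightarrow> (\<lambda>n. g n x) \<longlonglongrightarrow> u x"
    unfolding measurable_on_def by auto
  \<comment> \<open>The continuous approximations receive the same clamp and cutoff as
    \<open>u\<close>. They still converge to \<open>uM M\<close> almost everywhere and now share an
    integrable bound.\<close>
  define v where "v n x = cl (real M) (g n x) * ct (real M) x" for n x
  have contv: "continuous_on UNIV (v n)" for n
    unfolding v_def by (intro continuous_intros contct continuous_on_compose2[OF contcl g]) auto
  note [measurable] = borel_measurable_continuous_onI[OF contv]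
  have uMM [measurable]: "uM M \<in> borel_measurable lborel"
    unfolding uM_def by measurable
  have bound: "\<bar>v n x\<bar> \<le> real M * indicator (cball 0 (real M + 1)) x"
    "\<bar>uM M x\<bar> \<le> real M * indicator (cball 0 (real M + 1)) x" for n x
  proof -
    have "\<bar>cl (real M) t\<bar> * ct (real M) x \<le> real M * indicator (cball 0 (real M + 1)) x" for t
    proof (cases "norm x \<le> real M + 1")
      case True
      then show ?thesis
        using mult_mono[OF cl(2)[of M t] ct(2)[of M x]] ct(1)[of M x] by simp
    next
      case False
      then show ?thesis using ct0[of "real M" x] by simp
    qed
    then show "\<bar>v n x\<bar> \<le> real M * indicator (cball 0 (real M + 1)) x"
      "\<bar>uM M x\<bar> \<le> real M * indicator (cball 0 (real M + 1)) x"
      using ct(1)[of M x] by (auto simp: v_def uM_def abs_mult)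
  qed
  have intind: "integrable lborel (\<lambda>x::'a. c * indicat_real (cball 0 (real M + 1)) x)" for c
    using emeasure_bounded_finite[OF bounded_cball]
    by (intro integrable_mult_right integrable_real_indicator) auto
  have "(\<lambda>n. \<integral>x. \<bar>uM M x - v n x\<bar> \<partial>lborel) \<longlonglongrightarrow> (\<integral>x. 0 \<partial>(lborel :: 'a measure))"
  proof (rule integral_dominated_convergence[where w = "\<lambda>x. (2 * real M) * indicator (cball 0 (real M + 1)) x"])
    have "AE x in lebesgue. x \<notin> N"
      using N by (simp add: negligible_iff_null_sets AE_not_in)
    then have "AE x in lborel. x \<notin> N"
      by (simp add: AE_completion_iff)
    then show "AE x in lborel. (\<lambda>n. \<bar>uM M x - v n x\<bar>) \<longlonglongrightarrow> 0"
    proof eventually_elim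
      case (elim x)
      have "isCont (cl M) (u x)" using contcl by (simp add: continuous_on_eq_continuous_at)
      then have "(\<lambda>n. cl M (g n x)) \<longlonglongrightarrow> cl M (u x)"
        using lim[OF elim] by (rule isCont_tendsto_compose)
      then have "(\<lambda>n. \<bar>uM M x - v n x\<bar>) \<longlonglongrightarrow> \<bar>cl M (u x) * ct M x - cl M (u x) * ct M x\<bar>"
        unfolding uM_def v_def by (intro tendsto_intros)
      then show ?case by simp
    qed
    show "AE x in lborel. norm \<bar>uM M x - v n x\<bar> \<le> (2 * real M) * indicator (cball 0 (real M + 1)) x" for n
    proof (rule AE_I2)
      fix x
      show "norm \<bar>uM M x - v n x\<bar> \<le> (2 * real M) * indicator (cball 0 (real M + 1)) x"
        using bound(1)[of n x] bound(2)[of x] abs_triangle_ineq4[of "uM M x" "v n x"] by simp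
    qed
  qed (use intind in auto)
  then have "\<forall>\<^sub>F n in sequentially. (\<integral>x. \<bar>uM M x - v n x\<bar> \<partial>lborel) < \<eta> / 2"
    using \<eta> by (intro order_tendstoD(2)) auto
  then obtain n where n: "(\<integral>x. \<bar>uM M x - v n x\<bar> \<partial>lborel) < \<eta> / 2"
    by (auto simp: eventually_sequentially)
  have intv: "integrable lborel (v n)"
    by (rule Bochner_Integration.integrable_bound[OF intind[of "real M"]]) (use bound in \<open>auto intro!: AE_I2\<close>)
  have intuM: "integrable lborel (uM M)"
    by (rule Bochner_Integration.integrable_bound[OF intind[of "real M"]]) (use bound in \<open>auto intro!: AE_I2\<close>)
  have "(\<integral>x. \<bar>u x - v n x\<bar> \<partial>lborel) \<le> (\<integral>x. \<bar>u x - uM M x\<bar> + \<bar>uM M x - v n x\<bar> \<partial>lborel)"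
    using u intv intuM by (intro integral_mono) auto
  also have "\<dots> = (\<integral>x. \<bar>u x - uM M x\<bar> \<partial>lborel) + (\<integral>x. \<bar>uM M x - v n x\<bar> \<partial>lborel)"
    using u intv intuM by (intro Bochner_Integration.integral_add) auto
  finally have "(\<integral>x. \<bar>u x - v n x\<bar> \<partial>lborel) < \<eta>" using M n by linarith
  moreover have "v n x = 0" if "real M + 1 \<le> norm x" for x
    using ct0[OF that] by (simp add: v_def)
  ultimately show ?thesis
    using contv intv by (intro that[of "v n" "real M + 1"]) auto
qed

section \<open>Convolution with a compactly supported kernel\<close>

lemma lborel_reflect_translate: "distr lborel borel (\<lambda>z. x - z) = (lborel :: 'a::euclidean_space measure)"
  using lborel_affine[of "-1" x] by (simp add: density_1)

text \<open>One continuous derivative of the kernel is enough for the convolution estimates.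
  Infinite smoothness matters where the kernel serves as a test function and is a hypothesis
  there.\<close>

locale mollifier =
  fixes \<rho> :: "'a::euclidean_space \<Rightarrow> real" and \<rho>' :: "'a \<Rightarrow> 'a" and e :: real
  assumes e: "0 < e"
    and nonneg: "0 \<le> \<rho> z"
    and supp: "e \<le> norm z \<Longrightarrow> \<rho> z = 0" and supp': "e \<le> norm z \<Longrightarrow> \<rho>' z = 0"
    and integrable: "integrable lborel \<rho>" and integral_one: "(\<integral>z. \<rho> z \<partial>lborel) = 1"
    and deriv: "(\<rho> has_derivative (\<lambda>h. \<rho>' z \<bullet> h)) (at z)"
    and cont': "continuous_on UNIV \<rho>'"
begin

definition conv :: "('a \<Rightarrow> 'b::euclidean_space) \<Rightarrow> 'a \<Rightarrow> 'b" where
  "conv u x = (\<integral>z. \<rho> (x - z) *\<^sub>R u z \<partial>lborel)"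

text \<open>The derivative falls on the kernel, so this makes sense for every integrable
  \<open>u\<close>; inside the domain it later turns out to be the mollified weak gradient.\<close>

definition conv_grad :: "('a \<Rightarrow> real) \<Rightarrow> 'a \<Rightarrow> 'a" where
  "conv_grad u x = (\<integral>z. u z *\<^sub>R \<rho>' (x - z) \<partial>lborel)"

lemma cont: "continuous_on UNIV \<rho>"
  by (intro continuous_at_imp_continuous_on ballI has_derivative_continuous[OF deriv])

lemma measurable [measurable]: "\<rho> \<in> borel_measurable borel" "\<rho>' \<in> borel_measurable borel"
  using cont cont' by (auto intro: borel_measurable_continuous_onI)

lemma bounded_of_cont:
  fixes f :: "'a \<Rightarrow> 'b::real_normed_vector"
  assumes "continuous_on UNIV f" "\<And>z. e \<le> norm z \<Longrightarrow> f z = 0"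
  obtains B where "0 < B" "\<And>z. norm (f z) \<le> B"
proof -
  have "bounded (f ` cball 0 e)"
    using assms by (intro compact_imp_bounded compact_continuous_image) (auto intro: continuous_on_subset)
  then obtain B where B: "0 < B" "\<And>z. z \<in> cball 0 e \<Longrightarrow> norm (f z) \<le> B"
    by (auto simp: bounded_pos)
  have "norm (f z) \<le> B" for z
    using B assms(2)[of z] by (cases "norm z \<le> e") (auto simp: less_imp_le)
  with B(1) that show ?thesis by blast
qed

lemma integrable_shift: "integrable lborel (\<lambda>z. \<rho> (x - z))" "(\<integral>z. \<rho> (x - z) \<partial>lborel) = 1"
proof -
  have "integrable (distr lborel borel (\<lambda>z. x - z)) \<rho>"
    using integrable by (simp add: lborel_reflect_translate)
  then show "integrable lborel (\<lambda>z. \<rho> (x - z))"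
    by (subst (asm) integrable_distr_eq) auto
  have "(\<integral>z. \<rho> z \<partial>distr lborel borel (\<lambda>z. x - z)) = (\<integral>z. \<rho> (x - z) \<partial>lborel)"
    by (rule integral_distr) auto
  then show "(\<integral>z. \<rho> (x - z) \<partial>lborel) = 1"
    by (simp add: lborel_reflect_translate integral_one)
qed

lemma nn_integral_shift: "(\<integral>\<^sup>+x. ennreal (\<rho> (x - z)) \<partial>lborel) = 1"
proof -
  have "(\<integral>\<^sup>+x. ennreal (\<rho> x) \<partial>lborel) = (\<integral>\<^sup>+x. ennreal (\<rho> x) \<partial>distr lborel borel ((+) (- z)))"
    by (simp add: lborel_distr_plus)
  also have "\<dots> = (\<integral>\<^sup>+x. ennreal (\<rho> (- z + x)) \<partial>lborel)"
    by (rule nn_integral_distr) auto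
  finally show ?thesis
    using nn_integral_eq_integral[OF integrable] nonneg integral_one by simp
qed

lemma integrable_conv:
  fixes u :: "'a \<Rightarrow> 'b::euclidean_space"
  assumes u: "integrable lborel u"
  shows "integrable lborel (\<lambda>z. \<rho> (x - z) *\<^sub>R u z)"
proof -
  obtain B where B: "0 < B" "\<And>z. norm (\<rho> z) \<le> B"
    using bounded_of_cont[OF cont supp] by blast
  have [measurable]: "u \<in> borel_measurable borel"
    using borel_measurable_integrable[OF u] by simp
  show ?thesis
  proof (rule Bochner_Integration.integrable_bound)
    show "integrable lborel (\<lambda>z. B * norm (u z))" using u by simp
    show "AE z in lborel. norm (\<rho> (x - z) *\<^sub>R u z) \<le> norm (B * norm (u z))"
      using B by (intro AE_I2) (simp add: mult_right_mono)
  qed measurable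
qed

lemma integrable_conv_grad:
  fixes u :: "'a \<Rightarrow> real"
  assumes u: "integrable lborel u"
  shows "integrable lborel (\<lambda>z. u z *\<^sub>R \<rho>' (x - z))"
proof -
  obtain B where B: "0 < B" "\<And>z. norm (\<rho>' z) \<le> B"
    using bounded_of_cont[OF cont' supp'] by blast
  have [measurable]: "u \<in> borel_measurable borel"
    using borel_measurable_integrable[OF u] by simp
  show ?thesis
  proof (rule Bochner_Integration.integrable_bound)
    show "integrable lborel (\<lambda>z. \<bar>u z\<bar> * B)" using u by simp
    show "AE z in lborel. norm (u z *\<^sub>R \<rho>' (x - z)) \<le> norm (\<bar>u z\<bar> * B)"
      using B by (intro AE_I2) (simp add: mult_left_mono abs_mult)
  qed measurable
qed

lemma conv_grad_continuous:
  assumes u: "integrable lborel u"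
  shows "continuous_on UNIV (conv_grad u)"
proof -
  obtain B where B: "0 < B" "\<And>z. norm (\<rho>' z) \<le> B"
    using bounded_of_cont[OF cont' supp'] by blast
  have [measurable]: "u \<in> borel_measurable borel"
    using borel_measurable_integrable[OF u] by simp
  have "(\<lambda>n. conv_grad u (X n)) \<longlonglongrightarrow> conv_grad u a" if X: "X \<longlonglongrightarrow> a" for X a
    unfolding conv_grad_def
  proof (rule integral_dominated_convergence)
    show "integrable lborel (\<lambda>z. \<bar>u z\<bar> * B)" using u by simp
    show "AE z in lborel. norm (u z *\<^sub>R \<rho>' (X n - z)) \<le> \<bar>u z\<bar> * B" for n
      using B by (intro AE_I2) (simp add: mult_left_mono)
    have "(\<lambda>n. \<rho>' (X n - z)) \<longlonglongrightarrow> \<rho>' (a - z)" for z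
      using cont' X by (intro isCont_tendsto_compose[of _ \<rho>'] tendsto_intros)
        (auto simp: continuous_on_eq_continuous_at)
    then show "AE z in lborel. (\<lambda>n. u z *\<^sub>R \<rho>' (X n - z)) \<longlonglongrightarrow> u z *\<^sub>R \<rho>' (a - z)"
      by (intro AE_I2 tendsto_intros)
  qed measurable
  then show ?thesis
    by (auto simp: continuous_on_sequentially o_def)
qed

text \<open>Dominated convergence for the first-order remainder of the kernel: a bound
  \<open>B\<close> for \<open>\<rho>'\<close> makes \<open>\<rho>\<close> Lipschitz, so the
  remainder quotient is at most \<open>2 * B\<close>, and it tends to 0 pointwise.\<close>

lemma conv_has_derivative:
  fixes u :: "'a \<Rightarrow> real"
  assumes u: "integrable lborel u"
  shows "(conv u has_derivative (\<lambda>h. conv_grad u x \<bullet> h)) (at x)"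
proof -
  obtain B where B: "0 < B" "\<And>z. norm (\<rho>' z) \<le> B"
    using bounded_of_cont[OF cont' supp'] by blast
  have [measurable]: "u \<in> borel_measurable borel"
    using borel_measurable_integrable[OF u] by simp
  \<comment> \<open>For \<open>y = x\<close> the quotient is 0 by the convention for division by
    zero, so the bound on \<open>q\<close> holds there as well.\<close>
  define q where "q y z = (\<rho> (y - z) - \<rho> (x - z) - \<rho>' (x - z) \<bullet> (y - x)) / norm (y - x)" for y z
  have [measurable]: "q y \<in> borel_measurable borel" for y
    unfolding q_def by measurable
  have Lip: "\<bar>\<rho> a - \<rho> b\<bar> \<le> B * norm (a - b)" for a b
  proof -
    have "norm (\<rho> a - \<rho> b) \<le> B * norm (a - b)"
    proof (rule differentiable_bound[of UNIV \<rho> "\<lambda>z h. \<rho>' z \<bullet> h"])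
      show "onorm (\<lambda>h. \<rho>' z \<bullet> h) \<le> B" for z
      proof (rule onorm_bound)
        show "norm (\<rho>' z \<bullet> h) \<le> B * norm h" for h
          using order_trans[OF Cauchy_Schwarz_ineq2 mult_right_mono[OF B(2)[of z] norm_ge_zero[of h]]]
          by simp
      qed (use B in simp)
    qed (use deriv in auto)
    then show ?thesis by simp
  qed
  have qB: "\<bar>q y z\<bar> \<le> 2 * B" for y z
  proof (cases "y = x")
    case False
    have "\<bar>\<rho>' (x - z) \<bullet> (y - x)\<bar> \<le> B * norm (y - x)"
      using Cauchy_Schwarz_ineq2[of "\<rho>' (x - z)" "y - x"] B(2)[of "x - z"]
      by (meson mult_right_mono norm_ge_zero order_trans)
    moreover have "\<bar>\<rho> (y - z) - \<rho> (x - z)\<bar> \<le> B * norm (y - x)"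
      using Lip[of "y - z" "x - z"] by simp
    ultimately have "\<bar>\<rho> (y - z) - \<rho> (x - z) - \<rho>' (x - z) \<bullet> (y - x)\<bar> \<le> (2 * B) * norm (y - x)"
      by linarith
    then show ?thesis
      using False by (simp add: q_def divide_le_eq)
  qed (use B in \<open>simp add: q_def\<close>)
  have q0: "((\<lambda>y. q y z) \<longlongrightarrow> 0) (at x)" for z
  proof -
    have "((\<lambda>y. \<rho> (y - z)) has_derivative (\<lambda>h. \<rho>' (x - z) \<bullet> h)) (at x)"
    proof (rule has_derivative_compose[where f = "\<lambda>y. y - z" and f' = "\<lambda>h. h", OF _ deriv])
      show "((\<lambda>y. y - z) has_derivative (\<lambda>h. h)) (at x)"
        by (auto intro!: derivative_eq_intros)
    qed
    then have "((\<lambda>y. norm (q y z)) \<longlongrightarrow> 0) (at x)"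
      by (simp add: q_def has_derivative_iff_norm)
    then show ?thesis by (rule tendsto_norm_zero_cancel)
  qed
  have int_q: "integrable lborel (\<lambda>z. q y z * u z)" for y
  proof (rule Bochner_Integration.integrable_bound)
    show "integrable lborel (\<lambda>z. (2 * B) * \<bar>u z\<bar>)" using u by simp
    show "AE z in lborel. norm (q y z * u z) \<le> norm ((2 * B) * \<bar>u z\<bar>)"
      using qB[of y] B by (intro AE_I2) (simp add: abs_mult mult_right_mono)
  qed measurable
  have quot: "(conv u y - conv u x - conv_grad u x \<bullet> (y - x)) / norm (y - x) = (\<integral>z. q y z * u z \<partial>lborel)" for y
  proof -
    have "conv_grad u x \<bullet> (y - x) = (\<integral>z. (u z *\<^sub>R \<rho>' (x - z)) \<bullet> (y - x) \<partial>lborel)"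
      unfolding conv_grad_def
      by (rule integral_inner_left[symmetric]) (rule integrable_conv_grad[OF u])
    then have "conv u y - conv u x - conv_grad u x \<bullet> (y - x) =
      (\<integral>z. \<rho> (y - z) *\<^sub>R u z - \<rho> (x - z) *\<^sub>R u z - (u z *\<^sub>R \<rho>' (x - z)) \<bullet> (y - x) \<partial>lborel)"
      unfolding conv_def
      using Bochner_Integration.integral_diff[OF Bochner_Integration.integrable_diff[OF
            integrable_conv[OF u, of y] integrable_conv[OF u, of x]]
          integrable_inner_left[OF integrable_conv_grad[OF u], of x "y - x"]]
        Bochner_Integration.integral_diff[OF integrable_conv[OF u, of y] integrable_conv[OF u, of x]]
      by (simp only:)
    then have "(conv u y - conv u x - conv_grad u x \<bullet> (y - x)) / norm (y - x) =
      (\<integral>z. (\<rho> (y - z) *\<^sub>R u z - \<rho> (x - z) *\<^sub>R u z - (u z *\<^sub>R \<rho>' (x - z)) \<bullet> (y - x)) / norm (y - x) \<partial>lborel)"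
      by simp
    also have "\<dots> = (\<integral>z. q y z * u z \<partial>lborel)"
      by (intro Bochner_Integration.integral_cong refl) (simp add: q_def field_simps)
    finally show ?thesis .
  qed
  have "((\<lambda>y. \<integral>z. q y z * u z \<partial>lborel) \<longlongrightarrow> 0) (at x)"
    unfolding tendsto_at_iff_sequentially o_def
  proof (intro allI impI)
    fix X :: "nat \<Rightarrow> 'a" assume X: "\<forall>i. X i \<in> UNIV - {x}" "X \<longlonglongrightarrow> x"
    have "(\<lambda>n. \<integral>z. q (X n) z * u z \<partial>lborel) \<longlonglongrightarrow> (\<integral>z. 0 \<partial>(lborel :: 'a measure))"
    proof (rule integral_dominated_convergence)
      show "integrable lborel (\<lambda>z. (2 * B) * \<bar>u z\<bar>)" using u by simp
      show "AE z in lborel. norm (q (X n) z * u z) \<le> (2 * B) * \<bar>u z\<bar>" for n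
        using qB by (intro AE_I2) (simp add: abs_mult mult_right_mono)
      show "AE z in lborel. (\<lambda>n. q (X n) z * u z) \<longlonglongrightarrow> 0"
      proof (rule AE_I2)
        fix z
        have "(\<lambda>n. q (X n) z) \<longlonglongrightarrow> 0"
          using q0[of z] X by (auto simp: tendsto_at_iff_sequentially o_def)
        then show "(\<lambda>n. q (X n) z * u z) \<longlonglongrightarrow> 0" by (rule tendsto_mult_left_zero)
      qed
    qed measurable
    then show "(\<lambda>n. \<integral>z. q (X n) z * u z \<partial>lborel) \<longlonglongrightarrow> 0" by simp
  qed
  then have "((\<lambda>y. norm ((conv u y - conv u x - conv_grad u x \<bullet> (y - x)) / norm (y - x))) \<longlongrightarrow> 0) (at x)"
    unfolding quot by (rule tendsto_norm_zero)
  then show ?thesis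
    by (simp add: has_derivative_iff_norm bounded_linear_inner_right)
qed

lemma norm_conv_le:
  assumes u: "integrable lborel u"
  shows "norm (conv u x) \<le> (\<integral>z. \<rho> (x - z) * norm (u z) \<partial>lborel)"
  unfolding conv_def using nonneg
  by (intro order_trans[OF integral_norm_bound]) simp

text \<open>The tangent line of \<open>t\<^sup>p\<close> at the mean value \<open>m\<close>, integrated against \<open>\<rho>\<close>.\<close>

lemma norm_conv_powr_le:
  fixes u :: "'a \<Rightarrow> 'b::euclidean_space"
  assumes p: "1 < p" and u: "integrable lborel u" and up: "integrable lborel (\<lambda>z. norm (u z) powr p)"
  shows "norm (conv u x) powr p \<le> (\<integral>z. \<rho> (x - z) * norm (u z) powr p \<partial>lborel)"
proof -
  define m where "m = (\<integral>z. \<rho> (x - z) * norm (u z) \<partial>lborel)"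
  have i1: "integrable lborel (\<lambda>z. \<rho> (x - z) * norm (u z))"
    using integrable_conv[of "\<lambda>z. norm (u z)"] u by simp
  have i2: "integrable lborel (\<lambda>z. \<rho> (x - z) * norm (u z) powr p)"
    using integrable_conv[OF up] by simp
  have m: "norm (conv u x) \<le> m" "0 \<le> m"
    using norm_conv_le[OF u, of x] order_trans[OF norm_ge_zero norm_conv_le[OF u, of x]]
    by (simp_all add: m_def)
  have "p * m powr (p - 1) * m - (p - 1) * m powr p =
      (\<integral>z. p * m powr (p - 1) * (\<rho> (x - z) * norm (u z)) - (p - 1) * m powr p * \<rho> (x - z) \<partial>lborel)"
    using i1 integrable_shift[of x] by (subst Bochner_Integration.integral_diff) (auto simp: m_def)
  also have "\<dots> \<le> (\<integral>z. \<rho> (x - z) * norm (u z) powr p \<partial>lborel)"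
  proof (rule integral_mono)
    fix z
    have "p * norm (u z) * m powr (p - 1) - (p - 1) * m powr p \<le> norm (u z) powr p"
      using young_powr[OF p, of "norm (u z)" m] m by simp
    from mult_left_mono[OF this nonneg[of "x - z"]]
    show "p * m powr (p - 1) * (\<rho> (x - z) * norm (u z)) - (p - 1) * m powr p * \<rho> (x - z) \<le> \<rho> (x - z) * norm (u z) powr p"
      by (simp add: algebra_simps)
  qed (use i1 i2 integrable_shift[of x] in auto)
  finally have "p * (m powr (p - 1) * m) - (p - 1) * m powr p \<le> (\<integral>z. \<rho> (x - z) * norm (u z) powr p \<partial>lborel)"
    by (simp only: mult.assoc)
  moreover have "m powr (p - 1) * m = m powr p"
    using m(2) p by (cases "m = 0") (auto simp: powr_diff)
  ultimately have "m powr p \<le> (\<integral>z. \<rho> (x - z) * norm (u z) powr p \<partial>lborel)"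
    by (simp only: left_diff_distrib)
  moreover have "norm (conv u x) powr p \<le> m powr p"
    using m p by (intro powr_mono2) auto
  ultimately show ?thesis by (rule order_trans[rotated])
qed

text \<open>Tonelli: for each fixed \<open>z\<close> the kernel has mass 1 as a function of
  \<open>x\<close>.\<close>

lemma nn_integral_conv:
  assumes [measurable]: "a \<in> borel_measurable borel" and a: "\<And>z. 0 \<le> (a z :: real)"
  shows "(\<integral>\<^sup>+x. (\<integral>\<^sup>+z. ennreal (\<rho> (x - z) * a z) \<partial>lborel) \<partial>lborel) = (\<integral>\<^sup>+z. ennreal (a z) \<partial>lborel)"
proof -
  have "(\<integral>\<^sup>+x. (\<integral>\<^sup>+z. ennreal (\<rho> (x - z) * a z) \<partial>lborel) \<partial>lborel) =
      (\<integral>\<^sup>+z. (\<integral>\<^sup>+x. ennreal (\<rho> (x - z) * a z) \<partial>lborel) \<partial>lborel)"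
    by (rule lborel_pair.Fubini') measurable
  also have "\<dots> = (\<integral>\<^sup>+z. ennreal (a z) \<partial>lborel)"
    using nonneg a by (simp add: ennreal_mult nn_integral_multc nn_integral_shift)
  finally show ?thesis .
qed

lemma nn_integral_conv_le:
  assumes u: "integrable lborel u"
  shows "(\<integral>\<^sup>+x. ennreal (norm (conv u x)) \<partial>lborel) \<le> (\<integral>\<^sup>+z. ennreal (norm (u z)) \<partial>lborel)"
proof -
  have [measurable]: "u \<in> borel_measurable borel"
    using borel_measurable_integrable[OF u] by simp
  have "(\<integral>\<^sup>+x. ennreal (norm (conv u x)) \<partial>lborel) \<le>
      (\<integral>\<^sup>+x. (\<integral>\<^sup>+z. ennreal (\<rho> (x - z) * norm (u z)) \<partial>lborel) \<partial>lborel)"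
  proof (rule nn_integral_mono)
    fix x
    have "integrable lborel (\<lambda>z. \<rho> (x - z) * norm (u z))"
      using integrable_conv[of "\<lambda>z. norm (u z)"] u by simp
    then show "ennreal (norm (conv u x)) \<le> (\<integral>\<^sup>+z. ennreal (\<rho> (x - z) * norm (u z)) \<partial>lborel)"
      using norm_conv_le[OF u, of x] nonneg by (subst nn_integral_eq_integral) (auto intro: ennreal_leI)
  qed
  also have "\<dots> = (\<integral>\<^sup>+z. ennreal (norm (u z)) \<partial>lborel)"
    by (rule nn_integral_conv) auto
  finally show ?thesis .
qed

lemma conv_diff:
  assumes "integrable lborel u" "integrable lborel v"
  shows "conv (\<lambda>z. u z - v z) x = conv u x - conv v x"
  unfolding conv_def scaleR_diff_right
  by (rule Bochner_Integration.integral_diff) (intro integrable_conv assms)+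

lemma conv_near:
  fixes v :: "'a \<Rightarrow> real"
  assumes v: "integrable lborel v" and near: "\<And>z. norm (x - z) < e \<Longrightarrow> \<bar>v z - v x\<bar> \<le> \<eta>"
  shows "\<bar>conv v x - v x\<bar> \<le> \<eta>"
proof -
  have "conv v x - v x = (\<integral>z. \<rho> (x - z) * v z - \<rho> (x - z) * v x \<partial>lborel)"
    using integrable_conv[OF v, of x] integrable_shift[of x]
    by (subst Bochner_Integration.integral_diff) (auto simp: conv_def)
  also have "\<bar>\<dots>\<bar> \<le> (\<integral>z. \<bar>\<rho> (x - z) * v z - \<rho> (x - z) * v x\<bar> \<partial>lborel)"
    using integral_norm_bound[of lborel "\<lambda>z. \<rho> (x - z) * v z - \<rho> (x - z) * v x"] by simp
  also have "\<dots> \<le> (\<integral>z. \<eta> * \<rho> (x - z) \<partial>lborel)"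
  proof (rule integral_mono)
    fix z
    show "\<bar>\<rho> (x - z) * v z - \<rho> (x - z) * v x\<bar> \<le> \<eta> * \<rho> (x - z)"
    proof (cases "norm (x - z) < e")
      case True
      have "\<bar>\<rho> (x - z) * v z - \<rho> (x - z) * v x\<bar> = \<rho> (x - z) * \<bar>v z - v x\<bar>"
        using nonneg[of "x - z"] by (simp only: right_diff_distrib[symmetric] abs_mult abs_of_nonneg)
      also have "\<dots> \<le> \<rho> (x - z) * \<eta>"
        by (rule mult_left_mono[OF near[OF True] nonneg])
      finally show ?thesis by (simp add: mult.commute)
    qed (use supp[of "x - z"] in simp)
  qed (use integrable_conv[OF v, of x] integrable_shift[of x] in auto)
  finally show ?thesis using integrable_shift[of x] by simp
qed

end

context mollifier
begin

lemma integrable_conv_fun: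
  fixes u :: "'a \<Rightarrow> real"
  assumes u: "integrable lborel u"
  shows "integrable lborel (conv u)" "(\<integral>x. \<bar>conv u x\<bar> \<partial>lborel) \<le> (\<integral>x. \<bar>u x\<bar> \<partial>lborel)"
proof -
  have "continuous_on UNIV (conv u)"
    by (intro continuous_at_imp_continuous_on ballI has_derivative_continuous[OF conv_has_derivative[OF u]])
  then have [measurable]: "conv u \<in> borel_measurable lborel"
    by (simp add: borel_measurable_continuous_onI)
  have fin: "(\<integral>\<^sup>+z. ennreal (norm (u z)) \<partial>lborel) = ennreal (\<integral>x. \<bar>u x\<bar> \<partial>lborel)"
    using u by (subst nn_integral_eq_integral) auto
  show int: "integrable lborel (conv u)"
    using nn_integral_conv_le[OF u] unfolding fin
    by (intro integrableI_bounded) (auto intro: le_less_trans)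
  have "ennreal (\<integral>x. \<bar>conv u x\<bar> \<partial>lborel) = (\<integral>\<^sup>+x. ennreal (norm (conv u x)) \<partial>lborel)"
    using int by (subst nn_integral_eq_integral) auto
  also have "\<dots> \<le> ennreal (\<integral>x. \<bar>u x\<bar> \<partial>lborel)"
    using nn_integral_conv_le[OF u] unfolding fin .
  finally show "(\<integral>x. \<bar>conv u x\<bar> \<partial>lborel) \<le> (\<integral>x. \<bar>u x\<bar> \<partial>lborel)"
    by (subst (asm) ennreal_le_iff) auto
qed

end

text \<open>An argument with three errors. Convolution is a contraction in \<open>L1\<close>, so
  replacing \<open>u\<close> by a continuous \<open>v\<close> costs at most the distance of
  \<open>u\<close> and \<open>v\<close>, once before and once after mollifying; for \<open>v\<close>
  itself uniform continuity applies.\<close>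

lemma mollifications_tendsto_L1:
  fixes u :: "'a::euclidean_space \<Rightarrow> real"
  assumes u: "integrable lborel u"
    and moll: "\<And>n. mollifier (\<rho> n) (\<rho>' n) (e n)" and e: "e \<longlonglongrightarrow> 0"
  shows "(\<lambda>n. \<integral>x. norm (mollifier.conv (\<rho> n) u x - u x) \<partial>lborel) \<longlonglongrightarrow> 0"
proof (rule order_tendstoI)
  fix a :: real assume "a < 0"
  then show "\<forall>\<^sub>F n in sequentially. a < (\<integral>x. norm (mollifier.conv (\<rho> n) u x - u x) \<partial>lborel)"
    by (intro always_eventually allI less_le_trans[OF _ Bochner_Integration.integral_nonneg]) auto
next
  fix \<eta> :: real assume \<eta>: "0 < \<eta>"
  obtain v K where contv: "continuous_on UNIV v" and K: "0 < K" and v0: "\<And>x. K \<le> norm x \<Longrightarrow> v x = 0"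
    and v: "integrable lborel v" and uv: "(\<integral>x. \<bar>u x - v x\<bar> \<partial>lborel) < \<eta> / 3"
    using continuous_dense_L1[OF u, of "\<eta> / 3"] \<eta> by auto
  define c where "c = measure lborel (cball (0::'a) (K + 1))"
  \<comment> \<open>The summand 1 in the denominator makes \<open>h * c < \<eta> / 3\<close> follow
    from \<open>0 \<le> c\<close> alone.\<close>
  define h where "h = \<eta> / (3 * (c + 1))"
  have c: "0 \<le> c" by (simp add: c_def)
  have h: "0 < h" "h * c < \<eta> / 3" using \<eta> c by (auto simp: h_def field_simps)
  \<comment> \<open>Radius \<open>K + 2\<close> contains all points within distance 1 of the ball of
    radius \<open>K + 1\<close>. Outside that smaller ball \<open>v\<close> and, once
    \<open>e n < 1\<close>, also its mollification vanish.\<close>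
  have "uniformly_continuous_on (cball 0 (K + 2)) v"
    by (intro compact_uniformly_continuous continuous_on_subset[OF contv]) auto
  then obtain d where d: "0 < d"
    and unif: "\<And>x z. x \<in> cball 0 (K + 2) \<Longrightarrow> z \<in> cball 0 (K + 2) \<Longrightarrow> dist z x < d \<Longrightarrow> dist (v z) (v x) < h"
    using h(1) unfolding uniformly_continuous_on_def by metis
  have "\<forall>\<^sub>F n in sequentially. e n < min 1 d"
    using d by (intro order_tendstoD(2)[OF e]) auto
  then show "\<forall>\<^sub>F n in sequentially. (\<integral>x. norm (mollifier.conv (\<rho> n) u x - u x) \<partial>lborel) < \<eta>"
  proof eventually_elim
    case (elim n)
    interpret mollifier "\<rho> n" "\<rho>' n" "e n" by (rule moll)
    have close: "\<bar>conv v x - v x\<bar> \<le> h * indicator (cball 0 (K + 1)) x" for x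
    proof (rule conv_near[OF v])
      fix z assume z: "norm (x - z) < e n"
      show "\<bar>v z - v x\<bar> \<le> h * indicator (cball 0 (K + 1)) x"
      proof (cases "norm x \<le> K + 1")
        case True
        have "norm z \<le> norm x + norm (x - z)"
          using norm_triangle_ineq2[of z x] by (simp add: norm_minus_commute)
        then have "\<bar>v z - v x\<bar> < h"
          using unif[of x z] True z elim by (auto simp: dist_norm norm_minus_commute)
        then show ?thesis using True by simp
      next
        case False
        have "norm x \<le> norm z + norm (x - z)"
          using norm_triangle_ineq2[of x z] by simp
        then have "K \<le> norm z" "K \<le> norm x" using False z elim by auto
        then show ?thesis using v0 False by simp
      qed
    qed
    have fin: "emeasure lborel (cball (0::'a) (K + 1)) < \<infinity>"
      by (rule emeasure_bounded_finite) simp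
    note cv = integrable_conv_fun[OF v] and cu = integrable_conv_fun[OF u]
    have duv: "integrable lborel (\<lambda>x. u x - v x)" using u v by simp
    note cd = integrable_conv_fun[OF duv]
    have "(\<integral>x. \<bar>conv v x - v x\<bar> \<partial>lborel) \<le> (\<integral>x. h * indicator (cball (0::'a) (K + 1)) x \<partial>lborel)"
    proof (rule integral_mono)
      show "integrable lborel (\<lambda>x. h * indicat_real (cball (0::'a) (K + 1)) x)"
        using fin by (intro integrable_mult_right integrable_real_indicator) auto
    qed (use close cv v in auto)
    also have "\<dots> = h * c" by (simp add: c_def)
    finally have 1: "(\<integral>x. \<bar>conv v x - v x\<bar> \<partial>lborel) \<le> h * c" .
    have "(\<integral>x. norm (conv u x - u x) \<partial>lborel) \<le>
        (\<integral>x. \<bar>conv (\<lambda>x. u x - v x) x\<bar> + \<bar>conv v x - v x\<bar> + \<bar>u x - v x\<bar> \<partial>lborel)"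
    proof (rule integral_mono)
      fix x
      show "norm (conv u x - u x) \<le> \<bar>conv (\<lambda>x. u x - v x) x\<bar> + \<bar>conv v x - v x\<bar> + \<bar>u x - v x\<bar>"
        unfolding conv_diff[OF u v] real_norm_def by linarith
    qed (use u v cu cv cd in auto)
    also have "\<dots> = (\<integral>x. \<bar>conv (\<lambda>x. u x - v x) x\<bar> \<partial>lborel) + (\<integral>x. \<bar>conv v x - v x\<bar> \<partial>lborel) + (\<integral>x. \<bar>u x - v x\<bar> \<partial>lborel)"
      using u v cv cd by (subst Bochner_Integration.integral_add, simp, simp)+ simp
    also have "\<dots> < \<eta>" using cd(2) 1 h(2) uv by linarith
    finally show ?case .
  qed
qed

lemma mollifications_tendsto_AE:
  fixes u :: "'a::euclidean_space \<Rightarrow> real"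
  assumes u: "integrable lborel u"
    and moll: "\<And>n. mollifier (\<rho> n) (\<rho>' n) (e n)" and e: "e \<longlonglongrightarrow> 0"
  obtains r where "strict_mono r" "AE x in lborel. (\<lambda>n. mollifier.conv (\<rho> (r n)) u x) \<longlonglongrightarrow> u x"
proof -
  have "integrable lborel (\<lambda>x. mollifier.conv (\<rho> n) u x - u x)" for n
    using mollifier.integrable_conv_fun(1)[OF moll u] u by simp
  from tendsto_L1_AE_subseq[OF this mollifications_tendsto_L1[OF assms]]
  obtain r where "strict_mono r" "AE x in lborel. (\<lambda>n. mollifier.conv (\<rho> (r n)) u x - u x) \<longlonglongrightarrow> 0"
    by blast
  then show ?thesis
    by (intro that[of r]) (auto simp: LIM_zero_iff)
qed

text \<open>Sobolev functions are measurable for the completed measure, whereas convolutions and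
  Tonelli's theorem are used over \<open>lborel\<close>. A Borel representative, chosen coordinate
  by coordinate, mediates.\<close>

lemma ex_borel_AE_eq:
  fixes f :: "'a::euclidean_space \<Rightarrow> 'b::euclidean_space"
  assumes f: "f \<in> borel_measurable lebesgue"
  obtains g where "g \<in> borel_measurable borel" "AE x in lborel. f x = g x"
proof -
  have "\<exists>g\<in>borel_measurable lborel. AE x in lborel. f x \<bullet> b = g x" for b
    by (rule completion_ex_borel_measurable_real[OF borel_measurable_inner[OF f measurable_const]]) simp
  then obtain g where g: "\<And>b. g b \<in> borel_measurable lborel" "\<And>b. AE x in lborel. f x \<bullet> b = g b x"
    by metis
  have "AE x in lborel. \<forall>b\<in>Basis. f x \<bullet> b = g b x"
    using g(2) by (intro AE_finite_allI) auto
  then have "AE x in lborel. f x = (\<Sum>b\<in>Basis. g b x *\<^sub>R b)"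
    by eventually_elim (metis (no_types, lifting) euclidean_representation sum.cong)
  moreover have "(\<lambda>x. \<Sum>b\<in>Basis. g b x *\<^sub>R b) \<in> borel_measurable borel"
    using g(1) by simp
  ultimately show ?thesis using that by blast
qed

text \<open>Here \<open>G\<close> is a Borel representative of the extension of \<open>F\<close> by
  zero, so integrals over \<open>D\<close> become integrals over the whole space.\<close>

lemma lebesgue_on_eq_lborel:
  fixes F G :: "'a::euclidean_space \<Rightarrow> 'b::euclidean_space"
  assumes D: "D \<in> sets lebesgue" and F: "F \<in> borel_measurable (lebesgue_on D)"
    and G: "G \<in> borel_measurable borel" and eq: "AE z in lborel. indicator D z *\<^sub>R F z = G z"
  shows "integrable (lebesgue_on D) F \<longleftrightarrow> integrable lborel G"
    and "(LINT z|lebesgue_on D. F z) = (\<integral>z. G z \<partial>lborel)"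
proof -
  have F': "(\<lambda>z. indicator D z *\<^sub>R F z) \<in> borel_measurable lebesgue"
    using F D by (subst (asm) borel_measurable_restrict_space_iff) auto
  have G': "G \<in> borel_measurable lborel" "G \<in> borel_measurable lebesgue"
    using G by (auto intro: measurable_completion)
  have eq': "AE z in lebesgue. indicator D z *\<^sub>R F z = G z"
    using eq by (rule AE_completion)
  show "integrable (lebesgue_on D) F \<longleftrightarrow> integrable lborel G"
    using integrable_cong_AE[OF F' G'(2) eq'] D G'(1)
    by (simp add: integrable_restrict_space integrable_completion)
  show "(LINT z|lebesgue_on D. F z) = (\<integral>z. G z \<partial>lborel)"
    using integral_cong_AE[OF F' G'(2) eq'] D G'(1)
    by (simp add: integral_restrict_space integral_completion)
qed

lemma nn_integral_compact:
  fixes h :: "'a::euclidean_space \<Rightarrow> real"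
  assumes "compact K" "continuous_on K h" "\<And>z. z \<in> K \<Longrightarrow> 0 \<le> h z"
  shows "(\<integral>\<^sup>+z. indicator K z * ennreal (h z) \<partial>lborel) = ennreal (integral K h)"
proof -
  have int: "integrable lborel (\<lambda>z. indicator K z *\<^sub>R h z)"
    by (rule borel_integrable_compact[OF assms(1,2)])
  have "(\<integral>\<^sup>+z. indicator K z * ennreal (h z) \<partial>lborel) = (\<integral>\<^sup>+z. ennreal (indicator K z *\<^sub>R h z) \<partial>lborel)"
    by (intro nn_integral_cong) (auto simp: indicator_def)
  also have "\<dots> = ennreal (\<integral>z. indicator K z *\<^sub>R h z \<partial>lborel)"
    using int assms(3) by (intro nn_integral_eq_integral) (auto simp: indicator_def)
  also have "(\<integral>z. indicator K z *\<^sub>R h z \<partial>lborel) = integral K h"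
    using set_lebesgue_integral_eq_integral(2)[OF absolutely_integrable_continuous_compact[OF assms(1,2)]] int
    by (simp add: set_lebesgue_integral_def integral_completion borel_measurable_integrable)
  finally show ?thesis .
qed

section \<open>Reflection in the y-axis\<close>

definition reflect_x :: "real \<times> real \<Rightarrow> real \<times> real" where
  "reflect_x z = (- fst z, snd z)"

lemma reflect_x_measurable [measurable]: "reflect_x \<in> borel_measurable borel"
  unfolding reflect_x_def by (intro borel_measurable_continuous_onI continuous_intros)

lemma lborel_reflect_x: "distr lborel borel reflect_x = lborel"
proof -
  let ?c = "\<lambda>j :: real \<times> real. if j = (1, 0) then - 1 else 1 :: real"
  have B: "(Basis :: (real \<times> real) set) = {(1, 0), (0, 1)}"
    by (auto simp: Basis_prod_def)
  have "(\<lambda>x. 0 + (\<Sum>j\<in>Basis. (?c j * (x \<bullet> j)) *\<^sub>R j)) = reflect_x"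
    unfolding B by (auto simp: fun_eq_iff reflect_x_def inner_prod_def)
  moreover have "(\<Prod>j\<in>Basis. \<bar>?c j\<bar>) = 1"
    by (intro prod.neutral) auto
  ultimately show ?thesis
    using lborel_affine_euclidean[of ?c 0] by (simp add: density_1)
qed

section \<open>Sobolev functions on the strip\<close>

lemma (in mollifier) test_function_shift:
  assumes smooth: "smooth_fun (\<lambda>z. \<rho> (x - z))" and D: "cball x e \<subseteq> D"
  shows "test_function D (\<lambda>z. \<rho> (x - z))"
proof -
  have "z \<in> cball x e" if "\<rho> (x - z) \<noteq> 0" for z
    using supp[of "x - z"] that by (force simp: dist_norm)
  then have "closure {z. \<rho> (x - z) \<noteq> 0} \<subseteq> cball x e"
    by (intro closure_minimal) auto
  then show ?thesis
    using smooth D unfolding test_function_def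
    by (meson bounded_cball bounded_subset closed_closure compact_eq_bounded_closed order_trans)
qed

text \<open>The substitution \<open>T\<close> preserves the measure and the kernel centred at
  \<open>x\<close> but changes the sign of \<open>u\<close>, so the value equals its own negative.
  Almost everywhere oddness thus becomes a zero at a definite point.\<close>

lemma (in mollifier) conv_reflect_odd:
  assumes u: "integrable lborel u" and odd: "AE z in lborel. u (T z) = - u z"
    and T: "T \<in> borel_measurable borel" "distr lborel borel T = lborel"
    and x: "\<And>z. \<rho> (x - T z) = \<rho> (x - z)"
  shows "conv u x = (0 :: real)"
proof -
  have [measurable]: "u \<in> borel_measurable borel"
    using borel_measurable_integrable[OF u] by simp
  have "conv u x = (\<integral>z. \<rho> (x - z) * u z \<partial>distr lborel borel T)"
    by (simp add: conv_def T)
  also have "\<dots> = (\<integral>z. \<rho> (x - T z) * u (T z) \<partial>lborel)"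
    using T(1) by (intro integral_distr) auto
  also have "\<dots> = (\<integral>z. - (\<rho> (x - z) * u z) \<partial>lborel)"
    using odd T(1) by (intro integral_cong_AE) (auto simp: x elim: eventually_mono)
  also have "\<dots> = - conv u x" by (simp add: conv_def)
  finally show ?thesis by simp
qed

text \<open>For \<open>t \<ge> 0\<close> and \<open>p > 1\<close> one has
  \<open>t \<le> 1 + t powr p\<close>, and the constant 1 is integrable over a bounded set.\<close>

lemma integrable_of_powr_integrable:
  fixes u :: "'a::euclidean_space \<Rightarrow> 'b::euclidean_space"
  assumes p: "1 < p" and D: "open D" "bounded D" and u: "u \<in> borel_measurable borel"
    and up: "integrable lborel (\<lambda>z. norm (u z) powr p)" and u0: "AE z in lborel. z \<notin> D \<longrightarrow> u z = 0"
  shows "integrable lborel u"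
proof (rule Bochner_Integration.integrable_bound)
  show "integrable lborel (\<lambda>z. indicat_real D z + norm (u z) powr p)"
    using D up emeasure_bounded_finite[OF D(2)]
    by (intro Bochner_Integration.integrable_add integrable_real_indicator) auto
  show "AE z in lborel. norm (u z) \<le> norm (indicat_real D z + norm (u z) powr p)"
    using u0
  proof eventually_elim
    case (elim z)
    show ?case
    proof (cases "z \<in> D")
      case True
      have "norm (u z) \<le> 1 + norm (u z) powr p"
      proof (cases "norm (u z) \<le> 1")
        case False
        then have "norm (u z) powr 1 \<le> norm (u z) powr p" using p by (intro powr_mono) auto
        then show ?thesis using False by simp
      qed (simp add: add_increasing2)
      then show ?thesis using True by simp
    qed (use elim in simp)
  qed
qed (use u in simp)

lemma (in symmetric_strip) open_image: "open (chart ` ({0<..<1} \<times> {0<..<L}))"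
  by (intro invariance_of_domain cont_chart chart_inj open_Times) auto

lemma (in symmetric_strip) sobolev_inequality:
  fixes u :: "real \<times> real \<Rightarrow> real" and U :: "real \<times> real \<Rightarrow> real \<times> real"
  defines "D \<equiv> chart ` ({0<..<1} \<times> {0<..<L})"
  assumes p: "1 < p" and bdd: "bounded D" and sym: "\<And>z. z \<in> D \<Longrightarrow> reflect_x z \<in> D"
    and sob: "sobolev_with_gradient p D u U" and odd: "odd_in_x D u"
    and \<beta>_nonneg: "0 \<le> \<beta>"
    and \<beta>: "\<And>s r. s \<in> {0<..<L} \<Longrightarrow> 0 < r \<Longrightarrow> r < \<delta> s \<Longrightarrow> \<beta> * (sqrt 2 * max 1 (1 + r * k s)) powr p \<le> 1"
  shows "\<beta> * (pi_p p / L) powr p * (LINT z|lebesgue_on D. \<bar>u z\<bar> powr p)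
    \<le> (LINT z|lebesgue_on D. norm (U z) powr p)"
proof -
  let ?lam = "(pi_p p / L) powr p"
  have oD: "open D" unfolding D_def by (rule open_image)
  then have D: "D \<in> sets lebesgue" "D \<in> sets borel" by auto
  have uLp: "u \<in> borel_measurable (lebesgue_on D)" "integrable (lebesgue_on D) (\<lambda>z. \<bar>u z\<bar> powr p)"
    and ULp: "U \<in> borel_measurable (lebesgue_on D)" "integrable (lebesgue_on D) (\<lambda>z. norm (U z) powr p)"
    and weak: "has_weak_gradient D u U"
    using sob by (auto simp: sobolev_with_gradient_def in_Lp_def)
  have "(\<lambda>z. indicator D z *\<^sub>R u z) \<in> borel_measurable lebesgue"
    using uLp(1) D by (subst (asm) borel_measurable_restrict_space_iff) auto
  then obtain u0 where u0m [measurable]: "u0 \<in> borel_measurable borel"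
    and u0: "AE z in lborel. indicator D z *\<^sub>R u z = u0 z"
    by (rule ex_borel_AE_eq)
  have "(\<lambda>z. indicator D z *\<^sub>R U z) \<in> borel_measurable lebesgue"
    using ULp(1) D by (subst (asm) borel_measurable_restrict_space_iff) auto
  then obtain U0 where U0m [measurable]: "U0 \<in> borel_measurable borel"
    and U0: "AE z in lborel. indicator D z *\<^sub>R U z = U0 z"
    by (rule ex_borel_AE_eq)
  have eqp: "AE z in lborel. indicator D z *\<^sub>R (\<bar>u z\<bar> powr p) = \<bar>u0 z\<bar> powr p"
    using u0 by eventually_elim (use p in \<open>auto simp: indicator_def split: if_splits\<close>)
  have eqUp: "AE z in lborel. indicator D z *\<^sub>R (norm (U z) powr p) = norm (U0 z) powr p"
    using U0 by eventually_elim (use p in \<open>auto simp: indicator_def split: if_splits\<close>)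
  have u0p: "integrable lborel (\<lambda>z. \<bar>u0 z\<bar> powr p)"
    and u0p_eq: "(LINT z|lebesgue_on D. \<bar>u z\<bar> powr p) = (\<integral>z. \<bar>u0 z\<bar> powr p \<partial>lborel)"
    using lebesgue_on_eq_lborel[OF D(1) borel_measurable_integrable[OF uLp(2)] _ eqp] uLp(2) by auto
  have U0p: "integrable lborel (\<lambda>z. norm (U0 z) powr p)"
    and U0p_eq: "(LINT z|lebesgue_on D. norm (U z) powr p) = (\<integral>z. norm (U0 z) powr p \<partial>lborel)"
    using lebesgue_on_eq_lborel[OF D(1) borel_measurable_integrable[OF ULp(2)] _ eqUp] ULp(2) by auto
  have u0D: "AE z in lborel. z \<notin> D \<longrightarrow> u0 z = 0"
    using u0 by eventually_elim (metis indicator_simps(2) scaleR_zero_left)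
  have U0D: "AE z in lborel. z \<notin> D \<longrightarrow> U0 z = 0"
    using U0 by eventually_elim (metis indicator_simps(2) scaleR_zero_left)
  have intu: "integrable lborel u0"
    by (rule integrable_of_powr_integrable[OF p oD bdd u0m _ u0D]) (use u0p in simp)
  have intU: "integrable lborel U0"
    by (rule integrable_of_powr_integrable[OF p oD bdd U0m U0p U0D])
  \<comment> \<open>The reflection preserves null sets, which gives the description of
    \<open>u0\<close> at the reflected point; symmetry of \<open>D\<close> makes \<open>z\<close>
    and its mirror image lie in \<open>D\<close> together, and off \<open>D\<close> both sides are
    0.\<close>
  have odd0: "AE z in lborel. u0 (reflect_x z) = - u0 z"
  proof -
    have "AE z in lebesgue. z \<in> D \<longrightarrow> u (- fst z, snd z) = - u z"
      using odd D by (simp add: odd_in_x_def AE_restrict_space_iff)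
    then have 1: "AE z in lborel. z \<in> D \<longrightarrow> u (- fst z, snd z) = - u z"
      by (simp add: AE_completion_iff)
    have "AE z in distr lborel borel reflect_x. indicator D z *\<^sub>R u z = u0 z"
      unfolding lborel_reflect_x by (rule u0)
    then have 2: "AE z in lborel. indicator D (reflect_x z) *\<^sub>R u (reflect_x z) = u0 (reflect_x z)"
      by (rule AE_distrD[rotated]) simp
    show ?thesis
      using u0 1 2
    proof eventually_elim
      case (elim z)
      have "reflect_x (reflect_x z) = z" by (simp add: reflect_x_def)
      then have "reflect_x z \<in> D \<longleftrightarrow> z \<in> D" using sym by metis
      then show ?case
        using elim by (auto simp: indicator_def reflect_x_def split: if_splits)
    qed
  qed
  define I where "I = (\<integral>z. norm (U0 z) powr p \<partial>lborel)"
  have I: "0 \<le> I" by (simp add: I_def)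
  \<comment> \<open>The definition of the weak gradient, tested with \<open>\<rho> (x - z)\<close>
    as a function of \<open>z\<close>. Its derivative carries a minus sign that cancels the one from
    integration by parts. The kernel is admissible only if the ball of radius \<open>e\<close>
    around \<open>x\<close> lies in \<open>D\<close>.\<close>
  have test: "conv_g x = conv_U x"
    if moll: "mollifier \<rho> \<rho>' e" and smooth: "smooth_fun (\<lambda>z. \<rho> (x - z))" and sub: "cball x e \<subseteq> D"
      and conv_g: "conv_g = mollifier.conv_grad \<rho>' u0" and conv_U: "conv_U = mollifier.conv \<rho> U0"
    for \<rho> \<rho>' e x and conv_g conv_U :: "real \<times> real \<Rightarrow> real \<times> real"
  proof -
    interpret mollifier \<rho> \<rho>' e by (rule moll)
    let ?\<phi> = "\<lambda>z. \<rho> (x - z)"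
    have test: "test_function D ?\<phi>"
      by (rule test_function_shift[OF smooth sub])
    have "(?\<phi> has_derivative (\<lambda>h. - (\<rho>' (x - z) \<bullet> h))) (at z)" for z
    proof -
      have "((\<lambda>z. x - z) has_derivative (\<lambda>h. - h)) (at z)"
        by (auto intro!: derivative_eq_intros)
      from has_derivative_compose[OF this deriv] show ?thesis by simp
    qed
    then have fd: "frechet_derivative ?\<phi> (at z) = (\<lambda>h. - (\<rho>' (x - z) \<bullet> h))" for z
      using frechet_derivative_at by metis
    show ?thesis
    proof (rule euclidean_eqI)
      fix b :: "real \<times> real" assume b: "b \<in> Basis"
      have m: "(\<lambda>z. \<rho>' (x - z) \<bullet> b) \<in> borel_measurable borel" "(\<lambda>z. \<rho> (x - z)) \<in> borel_measurable borel"
        by measurable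
      have m': "(\<lambda>z. \<rho>' (x - z) \<bullet> b) \<in> borel_measurable (lebesgue_on D)"
          "(\<lambda>z. \<rho> (x - z)) \<in> borel_measurable (lebesgue_on D)"
        using m by (auto intro!: measurable_restrict_space1 measurable_completion)
      have "(LINT z|lebesgue_on D. u z * frechet_derivative ?\<phi> (at z) b) =
          (\<integral>z. u0 z * - (\<rho>' (x - z) \<bullet> b) \<partial>lborel)"
      proof (rule lebesgue_on_eq_lborel(2)[OF D(1)])
        show "(\<lambda>z. u z * frechet_derivative ?\<phi> (at z) b) \<in> borel_measurable (lebesgue_on D)"
          unfolding fd using uLp(1) m'(1) by (intro borel_measurable_times borel_measurable_uminus)
        show "AE z in lborel. indicator D z *\<^sub>R (u z * frechet_derivative ?\<phi> (at z) b) = u0 z * - (\<rho>' (x - z) \<bullet> b)"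
          using u0 by eventually_elim (auto simp: fd)
      qed measurable
      also have "\<dots> = - (\<integral>z. (u0 z *\<^sub>R \<rho>' (x - z)) \<bullet> b \<partial>lborel)"
        by simp
      also have "\<dots> = - (conv_grad u0 x \<bullet> b)"
        unfolding conv_grad_def
        by (subst integral_inner_left[OF integrable_conv_grad[OF intu]]) (rule refl)
      finally have lhs: "(LINT z|lebesgue_on D. u z * frechet_derivative ?\<phi> (at z) b) = - (conv_grad u0 x \<bullet> b)" .
      have "(LINT z|lebesgue_on D. (U z \<bullet> b) * ?\<phi> z) = (\<integral>z. (U0 z \<bullet> b) * \<rho> (x - z) \<partial>lborel)"
      proof (rule lebesgue_on_eq_lborel(2)[OF D(1)])
        show "(\<lambda>z. (U z \<bullet> b) * ?\<phi> z) \<in> borel_measurable (lebesgue_on D)"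
          using ULp(1) m'(2) by (intro borel_measurable_times borel_measurable_inner) auto
        show "AE z in lborel. indicator D z *\<^sub>R ((U z \<bullet> b) * ?\<phi> z) = (U0 z \<bullet> b) * \<rho> (x - z)"
          using U0 by eventually_elim (auto simp flip: inner_scaleR_left)
      qed measurable
      also have "\<dots> = (\<integral>z. (\<rho> (x - z) *\<^sub>R U0 z) \<bullet> b \<partial>lborel)"
        by (simp add: mult.commute)
      also have "\<dots> = conv U0 x \<bullet> b"
        unfolding conv_def
        by (subst integral_inner_left[OF integrable_conv[OF intU]]) (rule refl)
      finally have rhs: "(LINT z|lebesgue_on D. (U z \<bullet> b) * ?\<phi> z) = conv U0 x \<bullet> b" .
      show "conv_g x \<bullet> b = conv_U x \<bullet> b"
        using weak test b lhs rhs unfolding has_weak_gradient_def conv_g conv_U by fastforce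
    qed
  qed
  show ?thesis
  proof (cases "\<beta> * ?lam = 0")
    case True
    show ?thesis unfolding True U0p_eq using I by (simp add: I_def)
  next
    case False
    define c where "c = \<beta> * ?lam"
    have c: "0 < c" using False \<beta>_nonneg by (simp add: c_def less_le)
    have on_box: "(\<integral>\<^sup>+z. indicator (chart ` cbox (\<eta>, \<eta>) (1 - \<eta>, L - \<eta>)) z * ennreal (\<bar>u0 z\<bar> powr p) \<partial>lborel) \<le> ennreal (I / c)"
      if \<eta>: "0 < \<eta>" "\<eta> < 1 / 2" "\<eta> < L / 2" for \<eta>
    proof -
      let ?R = "cbox (\<eta>, \<eta>) (1 - \<eta>, L - \<eta>)"
      let ?K = "chart ` ?R"
      have R: "?R \<subseteq> {0<..<1} \<times> {0<..<L}"
        using \<eta> by (auto simp: cbox_Pair_eq)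
      have K: "compact ?K" "?K \<subseteq> D"
        using R by (auto simp: D_def intro!: compact_continuous_image continuous_on_subset[OF cont_chart(1)])
      obtain \<epsilon> where \<epsilon>: "0 < \<epsilon>" "(\<Union>x\<in>?K. cball x \<epsilon>) \<subseteq> D"
        using compact_subset_open_imp_cball_epsilon_subset[OF K(1) oD K(2)] .
      \<comment> \<open>All radii, the one for \<open>n = 0\<close> included, are at most
        \<open>\<epsilon>\<close>, so every mollification has the right gradient on all of
        \<open>?K\<close>.\<close>
      define e where "e n = \<epsilon> / real (Suc n)" for n
      have e_pos: "0 < e n" and e_le: "e n \<le> \<epsilon>" for n
        using \<epsilon>(1) by (auto simp: e_def divide_le_eq)
      have e_lim: "e \<longlonglongrightarrow> 0"
        unfolding e_def using LIMSEQ_Suc[OF lim_const_over_n[of \<epsilon>]] by simp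
      have "\<exists>\<rho> \<rho>'. mollifier \<rho> \<rho>' (e n) \<and> (\<forall>z. \<rho> (reflect_x z) = \<rho> z) \<and> (\<forall>x. smooth_fun (\<lambda>z. \<rho> (x - z)))" for n
      proof (rule obtain_mollifier[OF e_pos[of n]], goal_cases)
        case (1 \<rho> \<rho>')
        have "mollifier \<rho> \<rho>' (e n)"
          by unfold_locales (fact 1 e_pos)+
        then show ?thesis
          using 1(8,9) by (intro exI[of _ \<rho>] exI[of _ \<rho>']) (simp add: reflect_x_def)
      qed
      then obtain \<rho> \<rho>' where moll: "\<And>n. mollifier (\<rho> n) (\<rho>' n) (e n)"
        and rho_refl: "\<And>n z. \<rho> n (reflect_x z) = \<rho> n z" and smooth: "\<And>n x. smooth_fun (\<lambda>z. \<rho> n (x - z))"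
        by metis
      define f where "f n = mollifier.conv (\<rho> n) u0" for n
      have contf: "continuous_on S (f n)" for S n
      proof -
        interpret mollifier "\<rho> n" "\<rho>' n" "e n" by (rule moll)
        show ?thesis
          unfolding f_def
          by (intro continuous_at_imp_continuous_on ballI has_derivative_continuous[OF conv_has_derivative[OF intu]])
      qed
      have bound: "(\<integral>\<^sup>+z. indicator ?K z * ennreal (\<bar>f n z\<bar> powr p) \<partial>lborel) \<le> ennreal (I / c)" for n
      proof -
        interpret mollifier "\<rho> n" "\<rho>' n" "e n" by (rule moll)
        have grad: "conv_grad u0 x = conv U0 x" if "x \<in> ?K" for x
        proof (rule test[OF moll smooth _ refl refl])
          have "cball x (e n) \<subseteq> cball x \<epsilon>" by (rule subset_cball[OF e_le])
          then show "cball x (e n) \<subseteq> D" using \<epsilon>(2) that by blast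
        qed
        have contg: "continuous_on ?K (conv_grad u0)"
          by (rule continuous_on_subset[OF conv_grad_continuous[OF intu]]) simp
        have "\<beta> * ?lam * integral ?K (\<lambda>z. \<bar>f n z\<bar> powr p) \<le> integral ?K (\<lambda>z. norm (conv_grad u0 z) powr p)"
        proof (rule smooth_inequality[OF p \<eta> _ contg _ \<beta>_nonneg \<beta>])
          show "(f n has_derivative (\<lambda>h. conv_grad u0 z \<bullet> h)) (at z)" for z
            unfolding f_def by (rule conv_has_derivative[OF intu])
          show "f n z = 0" if "fst z = 0" for z
            unfolding f_def
          proof (rule conv_reflect_odd[OF intu odd0 reflect_x_measurable lborel_reflect_x])
            fix w
            have "z - reflect_x w = reflect_x (z - w)"
              using that by (simp add: reflect_x_def prod_eq_iff)
            then show "\<rho> n (z - reflect_x w) = \<rho> n (z - w)" by (simp add: rho_refl)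
          qed
        qed
        \<comment> \<open>Jensen's inequality applies on \<open>?K\<close>, where the gradient is a
          mollification of \<open>U0\<close>; the outer integral is then enlarged from
          \<open>?K\<close> to the plane, and Tonelli returns \<open>I\<close>.\<close>
        moreover have "ennreal (integral ?K (\<lambda>z. norm (conv_grad u0 z) powr p)) \<le> ennreal I"
        proof -
          have "ennreal (integral ?K (\<lambda>z. norm (conv_grad u0 z) powr p)) =
              (\<integral>\<^sup>+z. indicator ?K z * ennreal (norm (conv_grad u0 z) powr p) \<partial>lborel)"
            using p by (intro nn_integral_compact[symmetric] K continuous_on_powr' continuous_intros contg) auto
          also have "\<dots> \<le> (\<integral>\<^sup>+x. (\<integral>\<^sup>+z. ennreal (\<rho> n (x - z) * norm (U0 z) powr p) \<partial>lborel) \<partial>lborel)"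
          proof (rule nn_integral_mono)
            fix x
            show "indicator ?K x * ennreal (norm (conv_grad u0 x) powr p) \<le>
                (\<integral>\<^sup>+z. ennreal (\<rho> n (x - z) * norm (U0 z) powr p) \<partial>lborel)"
            proof (cases "x \<in> ?K")
              case True
              have "integrable lborel (\<lambda>z. \<rho> n (x - z) * norm (U0 z) powr p)"
                using integrable_conv[OF U0p, of x] by simp
              then have "(\<integral>\<^sup>+z. ennreal (\<rho> n (x - z) * norm (U0 z) powr p) \<partial>lborel) =
                  ennreal (\<integral>z. \<rho> n (x - z) * norm (U0 z) powr p \<partial>lborel)"
                using nonneg by (intro nn_integral_eq_integral) auto
              then show ?thesis
                using norm_conv_powr_le[OF p intU U0p, of x] True by (simp add: grad ennreal_leI)
            qed simp
          qed
          also have "\<dots> = (\<integral>\<^sup>+z. ennreal (norm (U0 z) powr p) \<partial>lborel)"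
            by (rule nn_integral_conv) auto
          also have "\<dots> = ennreal I"
            unfolding I_def using U0p by (intro nn_integral_eq_integral) auto
          finally show ?thesis .
        qed
        moreover have "(\<integral>\<^sup>+z. indicator ?K z * ennreal (\<bar>f n z\<bar> powr p) \<partial>lborel) = ennreal (integral ?K (\<lambda>z. \<bar>f n z\<bar> powr p))"
          using p by (intro nn_integral_compact K continuous_on_powr' continuous_intros contf) auto
        ultimately show ?thesis
          using c I by (auto simp: c_def ennreal_le_iff pos_le_divide_eq mult.commute intro!: ennreal_leI)
      qed
      \<comment> \<open>The bound is uniform in \<open>n\<close>, so it passes to this subsequence,
        and Fatou's lemma carries it to \<open>u0\<close>.\<close>
      obtain r where AE: "AE x in lborel. (\<lambda>n. f (r n) x) \<longlonglongrightarrow> u0 x"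
        by (rule mollifications_tendsto_AE[OF intu moll e_lim], unfold f_def[symmetric]) (rule that)
      have Km: "?K \<in> sets borel" using K(1) by (simp add: borel_compact)
      have fm [measurable]: "f n \<in> borel_measurable borel" for n
        by (rule borel_measurable_continuous_onI[OF contf])
      let ?F = "\<lambda>n z. indicator ?K z * ennreal (\<bar>f (r n) z\<bar> powr p)"
      have Fm: "?F n \<in> borel_measurable lborel" for n
        using Km by measurable
      have "AE z in lborel. indicator ?K z * ennreal (\<bar>u0 z\<bar> powr p) = liminf (\<lambda>n. ?F n z)"
        using AE
      proof eventually_elim
        case (elim z)
        have "(\<lambda>n. \<bar>f (r n) z\<bar> powr p) \<longlonglongrightarrow> \<bar>u0 z\<bar> powr p"
          using elim p by (intro tendsto_powr' tendsto_intros) auto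
        then have "(\<lambda>n. ?F n z) \<longlonglongrightarrow> indicator ?K z * ennreal (\<bar>u0 z\<bar> powr p)"
          by (cases "z \<in> ?K") (auto intro: tendsto_ennrealI)
        then show ?case by (simp add: lim_imp_Liminf)
      qed
      then have "(\<integral>\<^sup>+z. indicator ?K z * ennreal (\<bar>u0 z\<bar> powr p) \<partial>lborel) = (\<integral>\<^sup>+z. liminf (\<lambda>n. ?F n z) \<partial>lborel)"
        by (rule nn_integral_cong_AE)
      also have "\<dots> \<le> liminf (\<lambda>n. \<integral>\<^sup>+z. ?F n z \<partial>lborel)"
        by (rule nn_integral_liminf[OF Fm])
      also have "\<dots> \<le> ennreal (I / c)"
        by (rule Liminf_le) (use bound in auto)
      finally show ?thesis .
    qed
    \<comment> \<open>The quarters keep every \<open>\<eta> n\<close>, starting with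
      \<open>n = 0\<close>, strictly below \<open>1 / 2\<close> and \<open>L / 2\<close>.\<close>
    define m where "m = min (1 / 4) (L / 4)"
    have m: "0 < m" "m \<le> 1 / 4" "m \<le> L / 4" using L by (auto simp: m_def)
    define \<eta> where "\<eta> n = m / real (Suc n)" for n
    have \<eta>: "0 < \<eta> n" "\<eta> n < 1 / 2" "\<eta> n < L / 2" for n
    proof -
      have "\<eta> n \<le> m"
        using m(1) unfolding \<eta>_def by (simp add: divide_le_eq)
      then show "\<eta> n < 1 / 2" "\<eta> n < L / 2" using m L by auto
      show "0 < \<eta> n" using m by (simp add: \<eta>_def)
    qed
    have \<eta>_lim: "\<eta> \<longlonglongrightarrow> 0"
      unfolding \<eta>_def using LIMSEQ_Suc[OF lim_const_over_n[of m]] by simp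
    let ?K = "\<lambda>n. chart ` cbox (\<eta> n, \<eta> n) (1 - \<eta> n, L - \<eta> n)"
    have sub: "cbox (\<eta> n, \<eta> n) (1 - \<eta> n, L - \<eta> n) \<subseteq> {0<..<1} \<times> {0<..<L}" for n
      using \<eta>[of n] by (auto simp: cbox_Pair_eq)
    have Km [measurable]: "?K n \<in> sets borel" for n
      by (intro borel_compact compact_continuous_image continuous_on_subset[OF cont_chart(1) sub]) auto
    \<comment> \<open>Each point of \<open>D\<close> lies in all but finitely many of the boxes, so
      a second use of Fatou's lemma passes from the boxes to \<open>D\<close>.\<close>
    have "indicator D z * ennreal (\<bar>u0 z\<bar> powr p) = liminf (\<lambda>n. indicator (?K n) z * ennreal (\<bar>u0 z\<bar> powr p))" for z
    proof -
      have "\<forall>\<^sub>F n in sequentially. indicator (?K n) z = (indicator D z :: ennreal)"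
      proof (cases "z \<in> D")
        case True
        then obtain t s where z: "z = chart (t, s)" "0 < t" "t < 1" "0 < s" "s < L"
          by (auto simp: D_def)
        have "\<forall>\<^sub>F n in sequentially. \<eta> n < Min {t, 1 - t, s, L - s}"
          using z by (intro order_tendstoD(2)[OF \<eta>_lim]) auto
        then show ?thesis
        proof eventually_elim
          case (elim n)
          then have "(t, s) \<in> cbox (\<eta> n, \<eta> n) (1 - \<eta> n, L - \<eta> n)"
            by (auto simp: cbox_Pair_eq)
          then have "z \<in> ?K n" unfolding z(1) by (rule imageI)
          then show ?case using True by simp
        qed
      next
        case False
        then have "z \<notin> ?K n" for n using sub[of n] unfolding D_def by blast
        then show ?thesis using False by simp
      qed
      then have "\<forall>\<^sub>F n in sequentially. indicator (?K n) z * ennreal (\<bar>u0 z\<bar> powr p) = indicator D z * ennreal (\<bar>u0 z\<bar> powr p)"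
        by eventually_elim simp
      then have "(\<lambda>n. indicator (?K n) z * ennreal (\<bar>u0 z\<bar> powr p)) \<longlonglongrightarrow> indicator D z * ennreal (\<bar>u0 z\<bar> powr p)"
        by (rule tendsto_eventually)
      then show ?thesis by (simp add: lim_imp_Liminf)
    qed
    then have "(\<integral>\<^sup>+z. indicator D z * ennreal (\<bar>u0 z\<bar> powr p) \<partial>lborel) =
        (\<integral>\<^sup>+z. liminf (\<lambda>n. indicator (?K n) z * ennreal (\<bar>u0 z\<bar> powr p)) \<partial>lborel)"
      by simp
    also have "\<dots> \<le> liminf (\<lambda>n. \<integral>\<^sup>+z. indicator (?K n) z * ennreal (\<bar>u0 z\<bar> powr p) \<partial>lborel)"
      by (intro nn_integral_liminf) measurable
    also have "\<dots> \<le> ennreal (I / c)"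
      by (rule Liminf_le) (use on_box[OF \<eta>] in auto)
    finally have "(\<integral>\<^sup>+z. indicator D z * ennreal (\<bar>u0 z\<bar> powr p) \<partial>lborel) \<le> ennreal (I / c)" .
    moreover have "(\<integral>\<^sup>+z. indicator D z * ennreal (\<bar>u0 z\<bar> powr p) \<partial>lborel) = (\<integral>\<^sup>+z. ennreal (\<bar>u0 z\<bar> powr p) \<partial>lborel)"
      using u0D by (intro nn_integral_cong_AE) (auto simp: indicator_def elim!: eventually_mono)
    moreover have "\<dots> = ennreal (\<integral>z. \<bar>u0 z\<bar> powr p \<partial>lborel)"
      using u0p by (intro nn_integral_eq_integral) auto
    ultimately have "(\<integral>z. \<bar>u0 z\<bar> powr p \<partial>lborel) \<le> I / c"
      using c I by (simp add: ennreal_le_iff)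
    then show ?thesis
      using c by (simp add: u0p_eq U0p_eq I_def c_def pos_le_divide_eq mult.commute)
  qed
qed

section \<open>The eigenvalue bound\<close>

lemma smooth_on_interval_has_derivative:
  assumes f: "smooth_on_interval {0..L} f" and s: "s \<in> {0..L}"
  shows "((deriv_within {0..L} ^^ n) f has_field_derivative (deriv_within {0..L} ^^ Suc n) f s) (at s within {0..L})"
proof -
  have "(deriv_within {0..L} ^^ n) f differentiable (at s within {0..L})"
    using f s by (auto simp: smooth_on_interval_def differentiable_on_def)
  then have "((deriv_within {0..L} ^^ n) f has_vector_derivative
      vector_derivative ((deriv_within {0..L} ^^ n) f) (at s within {0..L})) (at s within {0..L})"
    by (simp add: vector_derivative_works)
  then show ?thesis
    by (simp add: has_real_derivative_iff_has_vector_derivative deriv_within_def)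
qed

lemma smooth_on_interval_has_derivative_interior:
  assumes f: "smooth_on_interval {0..L} f" and s: "s \<in> {0<..<L}"
  shows "((deriv_within {0..L} ^^ n) f has_field_derivative (deriv_within {0..L} ^^ Suc n) f s) (at s)"
  using smooth_on_interval_has_derivative[OF f, of s n] s at_within_interior[of s "{0..L}"]
  by (simp add: interior_atLeastAtMost_real)

lemma smooth_on_interval_continuous:
  assumes f: "smooth_on_interval {0..L} f"
  shows "continuous_on {0..L} ((deriv_within {0..L} ^^ n) f)"
  by (rule DERIV_continuous_on[OF smooth_on_interval_has_derivative[OF f]])

text \<open>Used with \<open>c\<close> equal to 1 or -1: differentiation exchanges even and odd
  behaviour about \<open>L / 2\<close>.\<close>

lemma deriv_reflect:
  fixes f f1 :: "real \<Rightarrow> real"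
  assumes f: "\<And>s. s \<in> {0<..<L} \<Longrightarrow> (f has_field_derivative f1 s) (at s)"
    and refl: "\<And>s. s \<in> {0<..<L} \<Longrightarrow> f (L - s) = c * f s" and s: "s \<in> {0<..<L}"
  shows "f1 (L - s) = - c * f1 s"
proof -
  have "((\<lambda>s. f (L - s)) has_field_derivative f1 (L - s) * - 1) (at s)"
    by (rule DERIV_chain2[OF f]) (use s in \<open>auto intro!: derivative_eq_intros\<close>)
  moreover have "((\<lambda>s. f (L - s)) has_field_derivative c * f1 s) (at s)"
  proof (rule has_field_derivative_transform_within_open[where S = "{0<..<L}"])
    show "((\<lambda>s. c * f s) has_field_derivative c * f1 s) (at s)"
      by (rule DERIV_cmult[OF f[OF s]])
  qed (use s refl in auto)
  ultimately have "f1 (L - s) * - 1 = c * f1 s" by (rule DERIV_unique)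
  then show ?thesis by simp
qed

text \<open>The point \<open>s'\<close> lies between \<open>s\<close> and its mirror image
  \<open>L - s\<close>, where \<open>h\<close> takes the same value, and a concave function is at
  least that value in between.\<close>

lemma concave_even_mono:
  fixes h :: "real \<Rightarrow> real"
  assumes h: "concave_on {0..L} h" and even: "\<And>s. s \<in> {0<..<L} \<Longrightarrow> h (L - s) = h s"
    and s: "0 < s" "s \<le> s'" "s' \<le> L / 2"
  shows "h s \<le> h s'"
proof (cases "s = L / 2")
  case False
  then have sL: "s < L / 2" using s by linarith
  define t where "t = (s' - s) / (L - 2 * s)"
  have t: "0 \<le> t" "t \<le> 1" using s sL by (auto simp: t_def)
  have "(1 - t) *\<^sub>R s + t *\<^sub>R (L - s) = s + t * (L - 2 * s)"
    by (simp add: algebra_simps)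
  also have "\<dots> = s'" using sL by (simp add: t_def)
  finally have "(1 - t) * h s + t * h (L - s) \<le> h s'"
    using concave_onD[OF h t, of s "L - s"] s sL by auto
  then show ?thesis using even[of s] s sL by (simp add: algebra_simps)
next
  case True
  then have "s' = s" using s by linarith
  then show ?thesis by simp
qed

text \<open>The two factors of \<open>B_p\<close> are matched with the two factors of the speed
  bound. For \<open>p \<ge> 2\<close> one has \<open>1 - p \<le> - p / 2\<close>, so in both cases
  the numerical factor is at most \<open>2 powr (- p / 2)\<close>, the inverse of
  \<open>sqrt 2 powr p\<close>. The factor \<open>min 1\<close> offsets \<open>max 1\<close>: if
  \<open>1 + r * k s \<le> 1\<close> the entry 1 is used, otherwise the infimum.\<close>

lemma B_p_bounds:
  fixes F :: "(real \<times> real) set"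
  assumes p: "1 < p" and pos: "\<forall>(s, r)\<in>closure F. 0 < 1 + r * k s"
    and ne: "F \<noteq> {}"
  shows "0 \<le> B_p p F k"
    and "(s, r) \<in> closure F \<Longrightarrow> B_p p F k * (sqrt 2 * max 1 (1 + r * k s)) powr p \<le> 1"
proof -
  let ?c = "if p < 2 then 2 powr (- p / 2) else 2 powr (1 - p)"
  let ?I = "INF (s, r) \<in> closure F. 1 / (1 + r * k s) powr p"
  have ne': "closure F \<noteq> {}" using ne by simp
  have I0: "0 \<le> ?I"
    using ne' by (intro cINF_greatest) auto
  then show nonneg: "0 \<le> B_p p F k"
    unfolding B_p_def by (intro mult_nonneg_nonneg) auto
  have c: "?c \<le> 2 powr (- p / 2)"
    by (auto intro!: powr_mono)
  assume sr: "(s, r) \<in> closure F"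
  let ?j = "1 + r * k s"
  have j: "0 < ?j" using pos sr by auto
  have "bdd_below ((\<lambda>(s, r). 1 / (1 + r * k s) powr p) ` closure F)"
    by (rule bdd_belowI[of _ 0]) auto
  from cINF_lower[OF this sr] have I: "?I \<le> 1 / ?j powr p" by simp
  have 1: "min 1 ?I * (max 1 ?j) powr p \<le> 1"
  proof (cases "?j \<le> 1")
    case True
    then show ?thesis by (simp add: max_def)
  next
    case False
    then have "min 1 ?I * (max 1 ?j) powr p \<le> (1 / ?j powr p) * ?j powr p"
      using I by (intro mult_mono) (auto simp: max_def)
    then show ?thesis using j by simp
  qed
  have "2 powr (- p / 2) * (sqrt 2) powr p = 1"
    by (simp add: powr_half_sqrt[symmetric] powr_powr flip: powr_add)
  with mult_right_mono[OF c, of "(sqrt 2) powr p"] have 2: "?c * (sqrt 2) powr p \<le> 1"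
    by (simp only: powr_ge_zero)
  have 3: "0 \<le> min 1 ?I * (max 1 ?j) powr p"
    using I0 by simp
  have "B_p p F k * (sqrt 2 * max 1 ?j) powr p =
      (?c * (sqrt 2) powr p) * (min 1 ?I * (max 1 ?j) powr p)"
    unfolding B_p_def by (simp only: powr_mult mult_ac)
  then show "B_p p F k * (sqrt 2 * max 1 ?j) powr p \<le> 1"
    using mult_le_one[OF 2 3 1] by (simp only:)
qed

theorem theorem1p3:
  fixes L p :: real and x y \<delta> :: "real \<Rightarrow> real"
  defines "k \<equiv> signed_curvature L x y"
    and "DF \<equiv> flat_domain L \<delta>"
    and "D \<equiv> strip L x y \<delta>"
  assumes L_pos: "0 < L"
    and curve_smooth: "smooth_on_interval {0..L} x" "smooth_on_interval {0..L} y"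
    and simple_nonclosed: "inj_on (\<lambda>s. (x s, y s)) {0..L}"
    and arc_length:
      "\<forall>s\<in>{0..L}. (deriv_within {0..L} x s)\<^sup>2 + (deriv_within {0..L} y s)\<^sup>2 = 1"
    and curve_symmetric: "\<forall>s\<in>{0..L/2}. x (L - s) = - x s \<and> y (L - s) = y s"
    and \<delta>_pos: "\<forall>s\<in>{0..L}. 0 < \<delta> s"
    and \<delta>_smooth: "smooth_on_interval {0..L} \<delta>"
    and \<delta>_even: "\<forall>s\<in>{0..L}. \<delta> (L - s) = \<delta> s"
    and \<delta>_nonconstant: "\<not> \<delta> constant_on {0..L}"
    and one_to_one: "bij_betw (strip_map L x y) (closure DF) (closure D)"
    and p_gt_1: "1 < p"
    and \<delta>_concave: "concave_on {0..L} \<delta>"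
    and \<delta>k_concave:
      "concave_on {0..L} (\<lambda>s. \<delta> s * k s) \<or> concave_on {0..L} (\<lambda>s. (\<delta> s)\<^sup>2 * k s)"
    and \<delta>_slope: "\<forall>s\<in>{0..L}. \<bar>deriv_within {0..L} \<delta> s\<bar> \<le> 1"
    and jacobian_pos: "\<forall>(s, r)\<in>closure DF. 0 < 1 + r * k s"
  shows "mu1_odd p D \<ge> ereal (B_p p DF k * (pi_p p / L) powr p) \<and>
         pi_p p = 2 * pi * ((p - 1) powr (1 / p) / (p * sin (pi / p)))"
proof
  let ?d = "deriv_within {0..L}"
  note dx = smooth_on_interval_has_derivative_interior[OF curve_smooth(1)]
    and dy = smooth_on_interval_has_derivative_interior[OF curve_smooth(2)]
    and d\<delta> = smooth_on_interval_has_derivative_interior[OF \<delta>_smooth]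
  have x0: "(x has_field_derivative ?d x s) (at s)" and y0: "(y has_field_derivative ?d y s) (at s)"
    and x1: "(?d x has_field_derivative ?d (?d x) s) (at s)" and y1: "(?d y has_field_derivative ?d (?d y) s) (at s)"
    and x2: "(?d (?d x) has_field_derivative ?d (?d (?d x)) s) (at s)"
    and y2: "(?d (?d y) has_field_derivative ?d (?d (?d y)) s) (at s)"
    and \<delta>0: "(\<delta> has_field_derivative ?d \<delta> s) (at s)" if "s \<in> {0<..<L}" for s
    using dx[OF that, of 0] dx[OF that, of 1] dx[OF that, of 2]
      dy[OF that, of 0] dy[OF that, of 1] dy[OF that, of 2] d\<delta>[OF that, of 0]
    by (simp_all add: numeral_2_eq_2)
  have k_eq: "k s = ?d x s * ?d (?d y) s - ?d (?d x) s * ?d y s" for s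
    by (simp add: k_def signed_curvature_def Let_def)
  have unit: "(?d x s)\<^sup>2 + (?d y s)\<^sup>2 = 1" if "s \<in> {0<..<L}" for s
    using arc_length that by auto
  have orth: "?d x s * ?d (?d x) s + ?d y s * ?d (?d y) s = 0" if s: "s \<in> {0<..<L}" for s
  proof -
    have "((\<lambda>s. (?d x s)\<^sup>2 + (?d y s)\<^sup>2) has_field_derivative
        2 * ?d x s * ?d (?d x) s + 2 * ?d y s * ?d (?d y) s) (at s)"
      by (rule derivative_eq_intros x1[OF s] y1[OF s] refl)+ simp
    moreover have "((\<lambda>s. (?d x s)\<^sup>2 + (?d y s)\<^sup>2) has_field_derivative 0) (at s)"
      by (rule has_field_derivative_transform_within_open[where f = "\<lambda>_. 1" and S = "{0<..<L}"])
        (use s unit in auto)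
    ultimately have "2 * ?d x s * ?d (?d x) s + 2 * ?d y s * ?d (?d y) s = 0"
      by (rule DERIV_unique)
    then show ?thesis by simp
  qed
  \<comment> \<open>The second derivative is orthogonal to the unit tangent, hence a multiple of the
    normal \<open>(- y', x')\<close>, and \<open>k\<close> is the factor.\<close>
  have frenet: "?d (?d x) s = - k s * ?d y s" "?d (?d y) s = k s * ?d x s" if s: "s \<in> {0<..<L}" for s
    using unit[OF s] orth[OF s] unfolding k_eq by algebra+
  \<comment> \<open>The symmetry is given for the left half; on the right half it is read off at the
    point \<open>L - s\<close>.\<close>
  have x_refl: "x (L - s) = - x s" and y_refl: "y (L - s) = y s" if "s \<in> {0..L}" for s
    using curve_symmetric[rule_format, of s] curve_symmetric[rule_format, of "L - s"] that
    by (cases "s \<le> L / 2"; simp)+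
  \<comment> \<open>About \<open>L / 2\<close>, \<open>x'\<close> and \<open>y''\<close> are even
    while \<open>y'\<close> and \<open>x''\<close> are odd, so both products in the curvature are
    even.\<close>
  have x1_refl: "?d x (L - s) = ?d x s" if "s \<in> {0<..<L}" for s
    using deriv_reflect[OF x0 _ that, of "-1"] x_refl by simp
  have y1_refl: "?d y (L - s) = - ?d y s" if "s \<in> {0<..<L}" for s
    using deriv_reflect[OF y0 _ that, of 1] y_refl by simp
  have x2_refl: "?d (?d x) (L - s) = - ?d (?d x) s" if "s \<in> {0<..<L}" for s
    using deriv_reflect[OF x1 _ that, of 1] x1_refl by simp
  have y2_refl: "?d (?d y) (L - s) = ?d (?d y) s" if "s \<in> {0<..<L}" for s
    using deriv_reflect[OF y1 _ that, of "-1"] y1_refl by simp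
  have k_refl: "k (L - s) = k s" if "s \<in> {0<..<L}" for s
    using that by (simp add: k_eq x1_refl y1_refl x2_refl y2_refl)
  have \<delta>_refl: "\<delta> (L - s) = \<delta> s" if "s \<in> {0<..<L}" for s
    using \<delta>_even that by auto
  have in_DF: "(s, r) \<in> closure DF" if "s \<in> {0<..<L}" "0 < r" "r < \<delta> s" for s r
    using that closure_subset[of DF] by (auto simp: DF_def flat_domain_def)
  have jac: "0 < 1 + r * k s" if "s \<in> {0<..<L}" "0 < r" "r < \<delta> s" for s r
    using jacobian_pos in_DF[OF that] by auto
  have \<delta>_mono: "\<delta> s \<le> \<delta> s'" if "0 < s" "s \<le> s'" "s' \<le> L / 2" for s s'
    by (rule concave_even_mono[OF \<delta>_concave \<delta>_refl that])
  have weight_mono: "\<delta> s * (1 + t * \<delta> s * k s) \<le> \<delta> s' * (1 + t * \<delta> s' * k s')"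
    if t: "0 < t" "t < 1" and s: "0 < s" "s \<le> s'" "s' \<le> L / 2" for t s s'
  proof -
    have sL: "s \<in> {0<..<L}" "s' \<in> {0<..<L}" using s L_pos by auto
    have pos: "0 < \<delta> s" "0 < \<delta> s'" using \<delta>_pos sL by auto
    from \<delta>k_concave show ?thesis
    proof
      \<comment> \<open>In this case the weight is a product of two positive nondecreasing
        factors.\<close>
      assume "concave_on {0..L} (\<lambda>s. \<delta> s * k s)"
      then have "\<delta> s * k s \<le> \<delta> s' * k s'"
        by (rule concave_even_mono[OF _ _ s]) (simp add: \<delta>_refl k_refl)
      then have "1 + t * \<delta> s * k s \<le> 1 + t * \<delta> s' * k s'"
        using t by (simp add: mult.assoc)
      moreover have "0 < 1 + t * \<delta> s * k s"
        using jac[OF sL(1), of "t * \<delta> s"] t pos by simp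
      ultimately show ?thesis
        using \<delta>_mono[OF s] pos by (intro mult_mono) auto
    next
      \<comment> \<open>In this case the weight is the sum of the nondecreasing functions
        \<open>\<delta>\<close> and \<open>t * \<delta>^2 * k\<close>.\<close>
      assume "concave_on {0..L} (\<lambda>s. (\<delta> s)\<^sup>2 * k s)"
      then have "(\<delta> s)\<^sup>2 * k s \<le> (\<delta> s')\<^sup>2 * k s'"
        by (rule concave_even_mono[OF _ _ s]) (simp add: \<delta>_refl k_refl)
      then have "t * ((\<delta> s)\<^sup>2 * k s) \<le> t * ((\<delta> s')\<^sup>2 * k s')"
        using t by simp
      then show ?thesis
        using \<delta>_mono[OF s] by (simp add: power2_eq_square algebra_simps)
    qed
  qed
  interpret symmetric_strip L x y "?d x" "?d y" k \<delta> "?d \<delta>"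
  proof
    show "k differentiable (at s)" if s: "s \<in> {0<..<L}" for s
    proof -
      have "((\<lambda>s. ?d x s * ?d (?d y) s - ?d (?d x) s * ?d y s) has_field_derivative
        (?d x s * ?d (?d (?d y)) s + ?d (?d x) s * ?d (?d y) s) -
        (?d (?d x) s * ?d (?d y) s + ?d (?d (?d x)) s * ?d y s)) (at s)"
        by (intro DERIV_diff DERIV_mult' x1[OF s] y1[OF s] x2[OF s] y2[OF s])
      then show ?thesis
        unfolding real_differentiable_def k_eq[abs_def] by blast
    qed
    show "continuous_on {0<..<L} (?d \<delta>)"
      using smooth_on_interval_continuous[OF \<delta>_smooth, of 1]
      by (auto intro: continuous_on_subset)
    show "inj_on (\<lambda>(s, r). (x s + r * ?d y s, y s - r * ?d x s)) (flat_domain L \<delta>)"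
      using one_to_one closure_subset[of DF]
      by (auto simp: bij_betw_def strip_map_def DF_def intro: inj_on_subset)
    show "x (L / 2) = 0" using x_refl[of "L / 2"] L_pos by simp
    show "?d y (L / 2) = 0" using y1_refl[of "L / 2"] L_pos by simp
    show "(?d x has_real_derivative - k s * ?d y s) (at s)" if "s \<in> {0<..<L}" for s
      using x1[OF that] by (simp add: frenet[OF that])
    show "(?d y has_real_derivative k s * ?d x s) (at s)" if "s \<in> {0<..<L}" for s
      using y1[OF that] by (simp add: frenet[OF that])
  qed (use L_pos x0 y0 \<delta>0 unit jac \<delta>_pos \<delta>_slope \<delta>_refl k_refl weight_mono in auto)
  have D_eq: "D = chart ` ({0<..<1} \<times> {0<..<L})"
  proof (intro equalityI subsetI)
    fix z assume "z \<in> D"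
    then obtain s r where "z = (x s + r * ?d y s, y s - r * ?d x s)" "0 < s" "s < L" "0 < r" "r < \<delta> s"
      by (auto simp: D_def strip_def strip_map_def flat_domain_def)
    then have "z = chart (r / \<delta> s, s)" "(r / \<delta> s, s) \<in> {0<..<1} \<times> {0<..<L}"
      by (auto simp: chart_def)
    then show "z \<in> chart ` ({0<..<1} \<times> {0<..<L})" by blast
  next
    fix z assume "z \<in> chart ` ({0<..<1} \<times> {0<..<L})"
    then obtain t s where z: "z = chart (t, s)" and ts: "0 < t" "t < 1" "0 < s" "s < L" by auto
    have "z = strip_map L x y (s, t * \<delta> s)"
      by (simp add: z chart_def strip_map_def)
    moreover have "(s, t * \<delta> s) \<in> flat_domain L \<delta>"
      using ts \<delta>_pos by (auto simp: flat_domain_def)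
    ultimately show "z \<in> D" by (auto simp: D_def strip_def)
  qed
  have sym: "reflect_x z \<in> D" if "z \<in> D" for z
  proof -
    obtain t s where z: "z = chart (t, s)" and ts: "0 < t" "t < 1" "0 < s" "s < L"
      using \<open>z \<in> D\<close> by (auto simp: D_eq)
    have "reflect_x z = chart (t, L - s)"
      using ts by (simp add: z reflect_x_def chart_def x_refl y_refl x1_refl y1_refl \<delta>_refl)
    then show ?thesis using ts by (auto simp: D_eq)
  qed
  \<comment> \<open>Smoothness up to the endpoints makes \<open>chart\<close> continuous on the
    closed rectangle, whose image is compact and contains \<open>D\<close>.\<close>
  have bdd: "bounded D"
  proof -
    have c: "continuous_on {0..L} x" "continuous_on {0..L} y" "continuous_on {0..L} (?d x)"
      "continuous_on {0..L} (?d y)" "continuous_on {0..L} \<delta>"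
      using smooth_on_interval_continuous[OF curve_smooth(1), of 0] smooth_on_interval_continuous[OF curve_smooth(1), of 1]
        smooth_on_interval_continuous[OF curve_smooth(2), of 0] smooth_on_interval_continuous[OF curve_smooth(2), of 1]
        smooth_on_interval_continuous[OF \<delta>_smooth, of 0] by simp_all
    have c': "continuous_on ({0..1::real} \<times> {0..L}) (\<lambda>z. f (snd z))" if "continuous_on {0..L} f" for f :: "real \<Rightarrow> real"
      by (rule continuous_on_compose2[OF that]) (auto intro: continuous_intros)
    have "compact (chart ` ({0..1} \<times> {0..L}))"
      unfolding chart_def
      by (intro compact_continuous_image continuous_intros c' c compact_Times) auto
    moreover have "D \<subseteq> chart ` ({0..1} \<times> {0..L})"
      unfolding D_eq by (intro image_mono) auto
    ultimately show ?thesis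
      by (meson bounded_subset compact_imp_bounded)
  qed
  have ne: "DF \<noteq> {}"
  proof -
    have "(L / 2, \<delta> (L / 2) / 2) \<in> DF"
      using L_pos \<delta>_pos by (auto simp: DF_def flat_domain_def)
    then show ?thesis by blast
  qed
  note B = B_p_bounds[OF p_gt_1 jacobian_pos ne]
  let ?C = "B_p p DF k * (pi_p p / L) powr p"
  show "ereal ?C \<le> mu1_odd p D"
    unfolding mu1_odd_def
  proof (rule INF_greatest)
    fix \<mu> assume "\<mu> \<in> {\<mu>. \<mu> \<noteq> 0 \<and> (\<exists>u. neumann_eigenfunction p D \<mu> u \<and> odd_in_x D u)}"
    then obtain u U where ne0: "\<not> (AE z in lebesgue_on D. u z = 0)" and odd: "odd_in_x D u"
      and sob: "sobolev_with_gradient p D u U"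
      and weak: "(LINT z|lebesgue_on D. norm (U z) powr (p - 2) * (U z \<bullet> U z)) =
          \<mu> * (LINT z|lebesgue_on D. \<bar>u z\<bar> powr (p - 2) * u z * u z)"
      unfolding neumann_eigenfunction_def by blast
    \<comment> \<open>At \<open>a = 0\<close> both sides are 0 because \<open>0 powr b = 0\<close>
      for every \<open>b\<close>, so points where \<open>u\<close> or its gradient vanishes are
      harmless also for \<open>p < 2\<close>.\<close>
    have powr_sq: "a powr (p - 2) * (a * a) = a powr p" if "0 \<le> a" for a :: real
      using that by (cases "a = 0") (auto simp: powr_diff power2_eq_square)
    have "norm (U z) powr (p - 2) * (U z \<bullet> U z) = norm (U z) powr p" for z
      using powr_sq[of "norm (U z)"] by (simp add: dot_square_norm power2_eq_square)
    moreover have "\<bar>u z\<bar> powr (p - 2) * u z * u z = \<bar>u z\<bar> powr p" for z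
      using powr_sq[of "\<bar>u z\<bar>"] by (simp add: mult.assoc)
    ultimately have eigen: "(LINT z|lebesgue_on D. norm (U z) powr p) = \<mu> * (LINT z|lebesgue_on D. \<bar>u z\<bar> powr p)"
      using weak by simp
    have "?C * (LINT z|lebesgue_on D. \<bar>u z\<bar> powr p) \<le> (LINT z|lebesgue_on D. norm (U z) powr p)"
      using sobolev_inequality[OF p_gt_1, folded D_eq, OF bdd sym sob odd B(1)] B(2) in_DF by blast
    moreover have "0 < (LINT z|lebesgue_on D. \<bar>u z\<bar> powr p)"
    proof -
      have int: "integrable (lebesgue_on D) (\<lambda>z. \<bar>u z\<bar> powr p)"
        using sob by (simp add: sobolev_with_gradient_def in_Lp_def)
      have "(LINT z|lebesgue_on D. \<bar>u z\<bar> powr p) \<noteq> 0"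
        using integral_nonneg_eq_0_iff_AE[OF int] ne0 by simp
      then show ?thesis by (simp add: less_le)
    qed
    ultimately have "?C \<le> \<mu>"
      unfolding eigen by (simp only: mult_le_cancel_right_pos)
    then show "ereal ?C \<le> ereal \<mu>" by simp
  qed
  show "pi_p p = 2 * pi * ((p - 1) powr (1 / p) / (p * sin (pi / p)))"
    by (rule pi_p_eq[OF p_gt_1])
qed

end
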